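(* Let $\mathcal{A}$ and $\mathcal{B}$ be $AW^*$-algebras such that $\mathcal{A}$ does not have a type $\mathrm{I}_1$ direct summand. Then: (1) If $\Phi:\mathcal{A}^1\to\mathcal{B}^1$ is an order isomorphism with $\Phi(\tfrac12)=\tfrac12$, then there is a unique Jordan $^*$-isomorphism $J:\mathcal{A}\to\mathcal{B}$ whose restriction to $\mathcal{A}^1$ equals $\Phi$. (2) If $\Phi:\mathcal{A}^+\to\mathcal{B}^+$ is an order isomorphism, then there exist $b\in\mathcal{B}^{++}$ and a Jordan $^*$-isomorphism $J:\mathcal{A}\to\mathcal{B}$ such that $\Phi(a)=bJ(a)b$ for all $a\in\mathcal{A}^+$. (3) If $\Phi:\mathcal{A}^{++}\to\mathcal{B}^{++}$ is an order isomorphism, then there exist $b\in\mathcal{B}^{++}$ and a Jordan $^*$-isomorphism $J:\mathcal{A}\to\mathcal{B}$ such that $\Phi(a)=bJ(a)b$ for all $a\in\mathcal{A}^{++}$. (4) If $\Phi:\mathcal{A}^{sa}\to\mathcal{B}^{sa}$ is an order isomorphism, then there exist $b\in\mathcal{B}^{++}$, $c\in\mathcal{B}^{sa}$ and a Jordan $^*$-isomorphism $J:\mathcal{A}\to\mathcal{B}$ such that $\Phi(a)=bJ(a)b+c$ for all $a\in\mathcal{A}^{sa}$. (5) $\mathcal{A}^{sa}$ and $\mathcal{B}^{++}$ are not order isomorphic.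
   Context: All $C^*$-algebras are unital with unit $1$. For a $C^*$-algebra $\mathcal{A}$: $\mathcal{A}^{sa}$ is its set of self-adjoint elements, $\mathcal{A}^+$ its positive elements, $\mathcal{A}^{++}$ its positive invertible elements, and $\mathcal{A}^1=\{a\in\mathcal{A}^{sa}:0\le a\le 1\}$; all these carry the order $a\le b\iff b-a\in\mathcal{A}^+$. An order isomorphism between partially ordered sets is a bijection $\Phi$ with $a\le b\iff\Phi(a)\le\Phi(b)$. A Jordan $^*$-isomorphism $J:\mathcal{A}\to\mathcal{B}$ is a linear bijection with $J(a^* )=J(a)^*$ and $J(ab+ba)=J(a)J(b)+J(b)J(a)$. An $AW^*$-algebra is a $C^*$-algebra $\mathcal{A}$ such that for every nonempty $\mathcal{F}\subseteq\mathcal{A}$ there is a projection $p\in\mathcal{A}$ with $\{a\in\mathcal{A}: ba=0\ \forall b\in\mathcal{F}\}=p\mathcal{A}$. $\mathcal{A}$ has a type $\mathrm{I}_1$ direct summand if there is a nonzero central projection $z$ with $z\mathcal{A}$ commutative. *)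

theory Defs
  imports Complex_Main
begin

class cstar_algebra = real_normed_algebra_1 + banach +
  fixes cscale :: "complex \<Rightarrow> 'a \<Rightarrow> 'a"
    and adj :: "'a \<Rightarrow> 'a"
  assumes scaleR_cscale: "scaleR r x = cscale (complex_of_real r) x"
    and cscale_add_right: "cscale c (x + y) = cscale c x + cscale c y"
    and cscale_add_left: "cscale (c + d) x = cscale c x + cscale d x"
    and cscale_cscale: "cscale c (cscale d x) = cscale (c * d) x"
    and cscale_one: "cscale 1 x = x"
    and mult_cscale_left: "cscale c x * y = cscale c (x * y)"
    and mult_cscale_right: "x * cscale c y = cscale c (x * y)"
    and norm_cscale: "norm (cscale c x) = cmod c * norm x"
    and adj_adj: "adj (adj x) = x"
    and adj_add: "adj (x + y) = adj x + adj y"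
    and adj_mult: "adj (x * y) = adj y * adj x"
    and adj_cscale: "adj (cscale c x) = cscale (cnj c) (adj x)"
    and cstar_identity: "norm (adj x * x) = (norm x)\<^sup>2"

definition invertible_el :: "'a::cstar_algebra \<Rightarrow> bool" where
  "invertible_el x \<longleftrightarrow> (\<exists>y. x * y = 1 \<and> y * x = 1)"

definition spec :: "'a::cstar_algebra \<Rightarrow> complex set" where
  "spec a = {l. \<not> invertible_el (a - cscale l 1)}"

definition selfadj :: "'a::cstar_algebra \<Rightarrow> bool" where
  "selfadj a \<longleftrightarrow> adj a = a"

definition positive :: "'a::cstar_algebra \<Rightarrow> bool" where
  "positive a \<longleftrightarrow> selfadj a \<and> (\<forall>l\<in>spec a. Im l = 0 \<and> Re l \<ge> 0)"

definition cle :: "'a::cstar_algebra \<Rightarrow> 'a \<Rightarrow> bool" where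
  "cle a b \<longleftrightarrow> positive (b - a)"

definition SA :: "'a::cstar_algebra set" where
  "SA = {a. selfadj a}"

definition POS :: "'a::cstar_algebra set" where
  "POS = {a. positive a}"

definition PINV :: "'a::cstar_algebra set" where
  "PINV = {a. positive a \<and> invertible_el a}"

definition EFF :: "'a::cstar_algebra set" where
  "EFF = {a. selfadj a \<and> cle 0 a \<and> cle a 1}"

definition order_iso_on :: "('a::cstar_algebra \<Rightarrow> 'b::cstar_algebra) \<Rightarrow> 'a set \<Rightarrow> 'b set \<Rightarrow> bool" where
  "order_iso_on \<Phi> S T \<longleftrightarrow> bij_betw \<Phi> S T \<and>
     (\<forall>a\<in>S. \<forall>b\<in>S. cle a b \<longleftrightarrow> cle (\<Phi> a) (\<Phi> b))"

definition jordan_star_iso :: "('a::cstar_algebra \<Rightarrow> 'b::cstar_algebra) \<Rightarrow> bool" where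
  "jordan_star_iso J \<longleftrightarrow> bij J \<and>
     (\<forall>x y. J (x + y) = J x + J y) \<and>
     (\<forall>c x. J (cscale c x) = cscale c (J x)) \<and>
     (\<forall>x. J (adj x) = adj (J x)) \<and>
     (\<forall>x y. J (x * y + y * x) = J x * J y + J y * J x)"

definition projection :: "'a::cstar_algebra \<Rightarrow> bool" where
  "projection p \<longleftrightarrow> adj p = p \<and> p * p = p"

definition AW_star :: "'a::cstar_algebra itself \<Rightarrow> bool" where
  "AW_star _ \<longleftrightarrow> (\<forall>F::'a set. F \<noteq> {} \<longrightarrow>
     (\<exists>p. projection p \<and> {a. \<forall>b\<in>F. b * a = 0} = {p * x | x. True}))"

definition has_type_I1_summand :: "'a::cstar_algebra itself \<Rightarrow> bool" where
  "has_type_I1_summand _ \<longleftrightarrow> (\<exists>z::'a. z \<noteq> 0 \<and> projection z \<and> (\<forall>x. z * x = x * z) \<and>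
     (\<forall>x y. (z * x) * (z * y) = (z * y) * (z * x)))"

end

theory Submission
  imports Defs
begin

text \<open>
  In the unit interval of an AW*-algebra the projections are the effects that cannot be enlarged without
  changing the set of effects disjoint from them, so an order isomorphism \<open>\<Phi>\<close> of unit intervals maps projections
  to projections. If \<open>\<Phi>\<close> fixes 1/2, then comparing greatest lower bounds and least upper bounds of 1/2 with
  projections shows that it preserves orthocomplements and hence splits along commuting projections. If \<open>e q e = e/2\<close>
  for projections \<open>e\<close>, \<open>q\<close>, the Schur complement of \<open>(1 + q)/2\<close> on \<open>e\<close> shows \<open>\<Phi> (2e/3) = 2 \<Phi> e / 3\<close>; such \<open>e\<close> have
  supremum 1 exactly because there is no type I1 summand, so \<open>\<Phi>\<close> fixes 2/3. Rescaling subintervals whose midpoint is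
  fixed gives more fixed scalars, which are dense, and a map fixing all scalars is determined by its values on
  projections. Applying this uniqueness to rescalings of \<open>\<Phi>\<close>, to its conjugates by square roots and by the Cayley type
  map \<open>2/(1 + a) - 1\<close> shows that \<open>\<Phi>\<close> is affine and respects inverses, hence extends to a Jordan isomorphism.
  On the full cone, midpoints are shown to be preserved by passing to inverses and letting the right end point of the
  interval tend to infinity; the remaining domains are directed unions of translated cones.
\<close>

text \<open>The normalisation at 1/2 cannot be dropped: \<open>a \<mapsto> 2 a / (1 + a)\<close> is
  an order automorphism of the unit interval that moves 1/2 to 2/3. On the cone a fractional map of
  this kind would need its pole outside every interval from 0 to \<open>n\<close>, and letting
  \<open>n\<close> grow excludes it. In a commutative algebra every increasing bijection of the real
  unit interval that fixes 1/2 acts pointwise as an order automorphism, so noncommutativity has to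
  enter. It does so in one place only, the supply of projections \<open>e\<close> with
  \<open>e q e = e / 2\<close>: the infimum of \<open>e\<close> and \<open>(1 + q) / 2\<close> is
  then \<open>e / (2 - 1/2)\<close>, which is the origin of 2/3. Positivity is defined by the
  spectrum, while the computations need squares. Functional calculus is replaced by square roots
  that commute with everything commuting with the given element, together with the annihilator
  projections of an AW*-algebra. The map is never differentiated or integrated: each rigidity
  statement follows by applying a result on all normalised isomorphisms to a map derived from the
  given one.\<close>

notation cle (infix "\<sqsubseteq>" 50)

section \<open>Involution and inverses\<close>

lemma adj_zero [simp]: "adj (0::'a::cstar_algebra) = 0"
  using adj_add[of "0::'a" 0] by simp

lemma adj_minus [simp]: "adj (- x) = - adj (x::'a::cstar_algebra)"
  using adj_add[of x "- x"] by (simp add: add_eq_0_iff)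

lemma adj_diff: "adj (x - y) = adj x - adj (y::'a::cstar_algebra)"
  using adj_add[of x "- y"] by simp

lemma adj_one [simp]: "adj (1::'a::cstar_algebra) = 1"
proof -
  have "adj (adj (1::'a) * 1) = adj 1 * 1"
    by (metis adj_adj adj_mult mult_1 mult_1_right)
  thus ?thesis
    by (metis adj_adj mult_1_right)
qed

lemma adj_scaleR: "adj (r *\<^sub>R x) = r *\<^sub>R adj (x::'a::cstar_algebra)"
  by (simp add: scaleR_cscale adj_cscale)

lemma adj_of_real [simp]: "adj (of_real r :: 'a::cstar_algebra) = of_real r"
  by (simp add: of_real_def adj_scaleR)

lemmas adj_simps = adj_adj adj_add adj_diff adj_mult adj_scaleR adj_cscale

lemma norm_adj [simp]: "norm (adj x) = norm (x::'a::cstar_algebra)"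
proof -
  have le: "norm y \<le> norm (adj y)" for y :: 'a
  proof (cases "y = 0")
    case False
    have "norm y * norm y \<le> norm (adj y) * norm y"
      using cstar_identity[of y] norm_mult_ineq[of "adj y" y] by (simp add: power2_eq_square)
    thus ?thesis using False by simp
  qed simp
  show ?thesis using le[of x] le[of "adj x"] by (simp add: adj_adj)
qed

lemma norm_selfadj_square:
  fixes x :: "'a::cstar_algebra"
  assumes "selfadj x" shows "norm (x * x) = (norm x)\<^sup>2"
  using cstar_identity[of x] assms by (simp add: selfadj_def)

lemma selfadj_0 [simp]: "selfadj (0::'a::cstar_algebra)"
  and selfadj_1 [simp]: "selfadj (1::'a::cstar_algebra)"
  and selfadj_of_real [simp]: "selfadj (of_real r ::'a::cstar_algebra)"
  by (auto simp: selfadj_def)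

lemma of_real_commute: "of_real r * x = x * of_real r" for x :: "'a::real_algebra_1"
  by (simp add: of_real_def)

lemma selfadj_add: "selfadj x \<Longrightarrow> selfadj y \<Longrightarrow> selfadj (x + y)"
  and selfadj_diff: "selfadj x \<Longrightarrow> selfadj y \<Longrightarrow> selfadj (x - y)"
  and selfadj_minus: "selfadj x \<Longrightarrow> selfadj (- x)"
  and selfadj_scaleR: "selfadj x \<Longrightarrow> selfadj (r *\<^sub>R x)"
  for x :: "'a::cstar_algebra"
  by (auto simp: selfadj_def adj_simps)

lemma selfadj_mult_commuting: "selfadj x \<Longrightarrow> selfadj y \<Longrightarrow> x * y = y * x \<Longrightarrow> selfadj (x * y)"
  for x :: "'a::cstar_algebra"
  by (auto simp: selfadj_def adj_simps)

lemma selfadj_adj_mult [simp]: "selfadj (adj x * x)" "selfadj (x * adj x)"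
  for x :: "'a::cstar_algebra"
  by (auto simp: selfadj_def adj_simps)

lemma selfadj_conj': "selfadj a \<Longrightarrow> selfadj c \<Longrightarrow> selfadj (c * a * c)"
  for a :: "'a::cstar_algebra"
  by (auto simp: selfadj_def adj_simps mult.assoc)

lemma selfadj_power: "selfadj x \<Longrightarrow> selfadj (x ^ n)" for x :: "'a::cstar_algebra"
proof (induction n)
  case (Suc n)
  thus ?case by (simp add: selfadj_mult_commuting power_commutes)
qed simp

lemmas selfadj_intros = selfadj_add selfadj_diff selfadj_minus selfadj_scaleR selfadj_conj'

definition cinv :: "'a::cstar_algebra \<Rightarrow> 'a" where
  "cinv x = (SOME y. x * y = 1 \<and> y * x = 1)"

lemma cinv:
  fixes x :: "'a::cstar_algebra"
  assumes "invertible_el x"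
  shows "x * cinv x = 1" "cinv x * x = 1"
  using someI_ex[of "\<lambda>y. x * y = 1 \<and> y * x = 1"] assms
  by (auto simp: invertible_el_def cinv_def)

lemma cinv_eq:
  fixes x :: "'a::cstar_algebra"
  assumes "x * y = 1" "y * x = 1"
  shows "invertible_el x" "cinv x = y"
proof -
  show inv: "invertible_el x" using assms by (auto simp: invertible_el_def)
  have "cinv x = (y * x) * cinv x" using assms by simp
  also have "\<dots> = y" using cinv[OF inv] by (simp add: mult.assoc)
  finally show "cinv x = y" .
qed

lemma invertible_cinv: "invertible_el x \<Longrightarrow> invertible_el (cinv x)" for x :: "'a::cstar_algebra"
  using cinv[of x] by (auto simp: invertible_el_def)

lemma cinv_cinv: "invertible_el x \<Longrightarrow> cinv (cinv x) = x" for x :: "'a::cstar_algebra"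
  using cinv[of x] cinv_eq(2)[of "cinv x" x] by auto

lemma invertible_mult:
  fixes x y :: "'a::cstar_algebra"
  assumes "invertible_el x" "invertible_el y"
  shows "invertible_el (x * y)" "cinv (x * y) = cinv y * cinv x"
proof -
  have "x * y * (cinv y * cinv x) = x * (y * cinv y) * cinv x"
    by (simp add: mult.assoc)
  moreover have "cinv y * cinv x * (x * y) = cinv y * (cinv x * x) * y"
    by (simp add: mult.assoc)
  ultimately show "invertible_el (x * y)" "cinv (x * y) = cinv y * cinv x"
    using assms cinv_eq[of "x * y" "cinv y * cinv x"] by (auto simp: cinv)
qed

lemma invertible_1 [simp]: "invertible_el (1::'a::cstar_algebra)" "cinv (1::'a) = 1"
  using cinv_eq[of "1::'a" 1] by auto

lemma cinv_commute:
  fixes x y :: "'a::cstar_algebra"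
  assumes "invertible_el x" "x * y = y * x"
  shows "cinv x * y = y * cinv x"
proof -
  have "cinv x * y = cinv x * (y * x) * cinv x"
    using cinv[OF assms(1)] by (simp add: mult.assoc)
  also have "\<dots> = (cinv x * x) * y * cinv x"
    by (simp add: assms(2)[symmetric] mult.assoc)
  finally show ?thesis using cinv[OF assms(1)] by simp
qed

lemma invertible_adj:
  fixes x :: "'a::cstar_algebra"
  assumes "invertible_el x"
  shows "invertible_el (adj x)" "cinv (adj x) = adj (cinv x)"
  using cinv_eq[of "adj x" "adj (cinv x)"] cinv[OF assms]
  by (metis adj_mult adj_one)+

lemma selfadj_cinv: "selfadj x \<Longrightarrow> invertible_el x \<Longrightarrow> selfadj (cinv x)"
  for x :: "'a::cstar_algebra"
  using invertible_adj[of x] by (simp add: selfadj_def)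

lemma invertible_scaleR:
  fixes x :: "'a::cstar_algebra"
  assumes "invertible_el x" "r \<noteq> 0"
  shows "invertible_el (r *\<^sub>R x)" "cinv (r *\<^sub>R x) = inverse r *\<^sub>R cinv x"
  using cinv_eq[of "r *\<^sub>R x" "inverse r *\<^sub>R cinv x"] cinv[OF assms(1)] assms(2)
  by auto

lemma invertible_of_real:
  assumes "r \<noteq> 0"
  shows "invertible_el (of_real r :: 'a::cstar_algebra)" "cinv (of_real r :: 'a) = of_real (inverse r)"
  using invertible_scaleR[of "1::'a" r] assms by (auto simp: of_real_def)

lemma cscale_diff_right: "cscale c (x - y) = cscale c x - cscale c (y::'a::cstar_algebra)"
  using cscale_add_right[of c "x - y" y] by simp

lemma cscale_zero_left [simp]: "cscale 0 (x::'a::cstar_algebra) = 0"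
  using cscale_add_left[of 0 0 x] by simp

lemma cscale_minus_left: "cscale (- c) x = - cscale c (x::'a::cstar_algebra)"
  using cscale_add_left[of c "- c" x] by (simp add: add_eq_0_iff)

lemma invertible_near_one:
  fixes x :: "'a::cstar_algebra"
  assumes "norm (1 - x) < 1"
  shows "invertible_el x"
proof -
  define y where "y = 1 - x"
  have ny: "norm y < 1" using assms by (simp add: y_def)
  have sm: "summable (\<lambda>n. y ^ n)"
    by (rule summable_comparison_test'[of "\<lambda>n. norm y ^ n" 0])
       (use ny in \<open>auto simp: norm_power_ineq\<close>)
  have smn: "summable (\<lambda>n. y ^ Suc n)" using sm by (subst summable_Suc_iff)
  define s where "s = (\<Sum>n. y ^ n)"
  have s1: "s = 1 + (\<Sum>n. y ^ Suc n)"
    using suminf_split_head[OF sm] by (simp add: s_def)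
  have "(\<Sum>n. y ^ Suc n) = y * s"
    unfolding s_def using suminf_mult[OF sm, of y] by simp
  moreover have "(\<Sum>n. y ^ Suc n) = s * y"
    unfolding s_def using suminf_mult2[OF sm, of y] by (simp add: power_commutes)
  ultimately have "s = 1 + y * s" "s = 1 + s * y" using s1 by auto
  hence "(1 - y) * s = 1" "s * (1 - y) = 1"
    by (simp_all add: algebra_simps)
  moreover have "x = 1 - y" by (simp add: y_def)
  ultimately show ?thesis unfolding invertible_el_def by blast
qed

lemma invertible_near_scalar:
  fixes x :: "'a::cstar_algebra"
  assumes "norm (x - cscale l 1) < cmod l"
  shows "invertible_el x"
proof -
  have l: "l \<noteq> 0" using assms by auto
  have "1 - cscale (1/l) x = cscale (- (1/l)) (x - cscale l 1)"
    using l by (simp add: cscale_diff_right cscale_minus_left cscale_cscale cscale_one del: minus_divide_left)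
  hence "norm (1 - cscale (1/l) x) < 1"
    using assms l by (simp add: norm_cscale norm_divide divide_less_eq)
  then obtain y where y: "cscale (1/l) x * y = 1" "y * cscale (1/l) x = 1"
    using invertible_near_one unfolding invertible_el_def by blast
  have "x * cscale (1/l) y = 1" "cscale (1/l) y * x = 1"
    using y by (simp_all add: mult_cscale_left mult_cscale_right)
  thus ?thesis unfolding invertible_el_def by blast
qed

lemma invertible_near_real:
  fixes x :: "'a::cstar_algebra"
  assumes "norm (of_real r - x) < r"
  shows "invertible_el x"
proof -
  have "r > 0" using assms by (meson norm_ge_zero order_le_less_trans)
  have "norm (x - cscale (complex_of_real r) 1) < cmod (complex_of_real r)"
    using assms \<open>r > 0\<close> scaleR_cscale[of r "1::'a", symmetric]
    by (simp add: norm_minus_commute scaleR_conv_of_real)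
  thus ?thesis by (rule invertible_near_scalar)
qed

lemma cscale_scaleR: "cscale c (r *\<^sub>R x) = r *\<^sub>R cscale c (x::'a::cstar_algebra)"
  by (simp add: scaleR_cscale cscale_cscale mult.commute)

lemma cscale_ii_ii: "cscale \<i> (cscale \<i> x) = - (x::'a::cstar_algebra)"
  by (simp add: cscale_cscale cscale_minus_left cscale_one)

lemma cscale_minus_right: "cscale c (- x) = - cscale c (x::'a::cstar_algebra)"
  using cscale_scaleR[of c "-1" x] by simp

lemma cscale_zero_right: "cscale c 0 = (0::'a::cstar_algebra)"
  using cscale_scaleR[of c 0 "0::'a"] by simp

definition re_part :: "'a::cstar_algebra \<Rightarrow> 'a" where "re_part x = (1/2) *\<^sub>R (x + adj x)"
definition im_part :: "'a::cstar_algebra \<Rightarrow> 'a" where "im_part x = (1/2) *\<^sub>R cscale \<i> (adj x - x)"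

lemma re_im_parts:
  fixes x :: "'a::cstar_algebra"
  shows "selfadj (re_part x)" "selfadj (im_part x)" "x = re_part x + cscale \<i> (im_part x)"
proof -
  show "selfadj (re_part x)" by (simp add: re_part_def selfadj_def adj_simps add.commute)
  show "selfadj (im_part x)"
    by (simp add: im_part_def selfadj_def adj_simps cscale_minus_left cscale_diff_right scaleR_diff_right)
  have "cscale \<i> (im_part x) = (1/2) *\<^sub>R (x - adj x)"
    by (simp add: im_part_def cscale_scaleR cscale_ii_ii)
  thus "x = re_part x + cscale \<i> (im_part x)" by (simp add: re_part_def flip: scaleR_add_right)
qed

lemma re_im_parts_eq:
  fixes h k :: "'a::cstar_algebra"
  assumes "selfadj h" "selfadj k"
  shows "re_part (h + cscale \<i> k) = h" "im_part (h + cscale \<i> k) = k"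
proof -
  have a: "adj (h + cscale \<i> k) = h - cscale \<i> k"
    using assms by (simp add: adj_simps selfadj_def cscale_minus_left)
  show "re_part (h + cscale \<i> k) = h" unfolding re_part_def a by (simp flip: scaleR_2)
  have "h - cscale \<i> k - (h + cscale \<i> k) = - (2 *\<^sub>R cscale \<i> k)" by (simp add: scaleR_2)
  hence "cscale \<i> (h - cscale \<i> k - (h + cscale \<i> k)) = 2 *\<^sub>R k"
    using cscale_scaleR[of \<i> "-2" "cscale \<i> k"] by (simp add: cscale_ii_ii)
  thus "im_part (h + cscale \<i> k) = k" unfolding im_part_def a by simp
qed

lemma selfadj_decomposition: "\<exists>h k. selfadj h \<and> selfadj k \<and> x = h + cscale \<i> k" for x :: "'a::cstar_algebra"
  using re_im_parts[of x] by blast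

section \<open>Positive elements\<close>

lemma bounded_linear_adj: "bounded_linear (adj :: 'a::cstar_algebra \<Rightarrow> 'a)"
  by (rule bounded_linear_intro[where K=1]) (auto simp: adj_simps)

text \<open>The equation for \<open>z\<close> is the fixed point equation
  \<open>z = (x + z * z) / 2\<close>, solved by iteration from 0. Replacing \<open>x\<close> by the
  scalar 1 gives the increasing majorant \<open>t\<close>, bounded by 1, so the iteration converges
  even for \<open>norm x = 1\<close>, where it need not be a contraction. The iterates commute with
  whatever commutes with \<open>x\<close>, and so does the limit.\<close>

lemma sqrt_near_one:
  fixes x :: "'a::cstar_algebra"
  assumes sa: "selfadj x" and nx: "norm x \<le> 1"
  shows "\<exists>z. selfadj z \<and> norm z \<le> 1 \<and> (1 - z) * (1 - z) = 1 - x \<and> (\<forall>c. c * x = x * c \<longrightarrow> c * z = z * c)"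
proof -
  define y where "y = rec_nat (0::'a) (\<lambda>_ y. (1/2) *\<^sub>R (x + y * y))"
  define t where "t = rec_nat (0::real) (\<lambda>_ s. (1/2) * (1 + s * s))"
  have y0: "y 0 = 0" and yS: "y (Suc n) = (1/2) *\<^sub>R (x + y n * y n)" for n
    by (simp_all add: y_def)
  have t0: "t 0 = 0" and tS: "t (Suc n) = (1/2) * (1 + t n * t n)" for n
    by (simp_all add: t_def)
  have t01: "0 \<le> t n \<and> t n \<le> 1" for n
  proof (induction n)
    case (Suc n)
    hence "t n * t n \<le> 1" "0 \<le> t n * t n" by (simp_all add: mult_le_one)
    thus ?case unfolding tS by simp
  qed (simp add: t0)
  have yt: "norm (y n) \<le> t n" for n
  proof (induction n)
    case (Suc n)
    have "norm (y n * y n) \<le> t n * t n"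
      by (rule order_trans[OF norm_mult_ineq]) (use Suc t01[of n] in \<open>auto intro: mult_mono\<close>)
    hence "norm (x + y n * y n) \<le> 1 + t n * t n"
      by (intro order_trans[OF norm_triangle_ineq]) (use nx in auto)
    thus ?case unfolding yS tS by simp
  qed (simp add: y0 t0)
  have comm: "c * y n = y n * c" if "c * x = x * c" for c n
  proof (induction n)
    case (Suc n)
    have "c * (y n * y n) = y n * y n * c"
      using Suc by (metis mult.assoc)
    thus ?case unfolding yS using that by (simp add: algebra_simps)
  qed (simp add: y0)
  have ycomm: "y m * y n = y n * y m" for m n
    using comm[of "y m" n] comm[of x m] by simp
  have ysa: "selfadj (y n)" for n
    by (induction n) (auto simp: y0 yS intro!: selfadj_intros selfadj_mult_commuting sa)
  \<comment> \<open>Because the iterates commute, a difference of their squares factors, and its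
    norm is controlled by the same factorisation for \<open>t\<close>.\<close>
  have step: "norm (y (Suc n) - y n) \<le> t (Suc n) - t n" for n
  proof (induction n)
    case 0
    show ?case using nx by (simp add: y0 t0 yS tS)
  next
    case (Suc n)
    have "(1/2) *\<^sub>R (x + y (Suc n) * y (Suc n)) - (1/2) *\<^sub>R (x + y n * y n)
        = (1/2) *\<^sub>R ((y (Suc n) + y n) * (y (Suc n) - y n))"
      using ycomm[of "Suc n" n] by (simp add: algebra_simps)
    hence "y (Suc (Suc n)) - y (Suc n) = (1/2) *\<^sub>R ((y (Suc n) + y n) * (y (Suc n) - y n))"
      by (simp only: yS[of "Suc n"] yS[of n, symmetric])
    hence "norm (y (Suc (Suc n)) - y (Suc n)) \<le> (1/2) * (norm (y (Suc n) + y n) * norm (y (Suc n) - y n))"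
      by (simp add: norm_mult_ineq)
    also have "\<dots> \<le> (1/2) * ((t (Suc n) + t n) * (t (Suc n) - t n))"
      using Suc yt[of n] yt[of "Suc n"] t01[of n] t01[of "Suc n"] norm_triangle_ineq[of "y (Suc n)" "y n"]
      by (intro mult_left_mono mult_mono) auto
    also have "\<dots> = t (Suc (Suc n)) - t (Suc n)"
      unfolding tS[of "Suc n"] by (subst (5) tS) (simp add: algebra_simps)
    finally show ?case .
  qed
  have tinc: "incseq t"
    by (intro incseq_SucI) (use order_trans[OF norm_ge_zero step] in simp)
  have "convergent t"
    using Bseq_monoseq_convergent[of t] incseq_imp_monoseq[OF tinc] t01 BseqI'[of t 1] by auto
  hence tC: "Cauchy t" by (rule convergent_Cauchy)
  have diff: "norm (y n - y m) \<le> t n - t m" if "m \<le> n" for m n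
    using that
  proof (induction n rule: dec_induct)
    case (step n)
    have "norm (y (Suc n) - y m) \<le> norm (y (Suc n) - y n) + norm (y n - y m)"
      using norm_triangle_ineq[of "y (Suc n) - y n" "y n - y m"] by simp
    thus ?case using step(3) \<open>\<And>n. norm (y (Suc n) - y n) \<le> t (Suc n) - t n\<close>[of n] by linarith
  qed simp
  have "Cauchy y"
  proof (rule metric_CauchyI)
    fix e :: real assume "e > 0"
    from metric_CauchyD[OF tC this] obtain M where M: "\<And>m n. m \<ge> M \<Longrightarrow> n \<ge> M \<Longrightarrow> dist (t m) (t n) < e"
      by blast
    have "dist (y m) (y n) < e" if "m \<ge> M" "n \<ge> M" for m n
    proof (cases "m \<le> n")
      case True
      thus ?thesis using diff[OF True] M[OF that] by (simp add: dist_norm norm_minus_commute)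
    next
      case False
      thus ?thesis using diff[of n m] M[OF that] by (simp add: dist_norm)
    qed
    thus "\<exists>M. \<forall>m\<ge>M. \<forall>n\<ge>M. dist (y m) (y n) < e" by blast
  qed
  then obtain z where z: "y \<longlonglongrightarrow> z"
    using Cauchy_convergent_iff convergent_def by blast
  have z2: "(\<lambda>n. y (Suc n)) \<longlonglongrightarrow> z" using z by (rule LIMSEQ_Suc)
  have "(\<lambda>n. (1/2) *\<^sub>R (x + y n * y n)) \<longlonglongrightarrow> (1/2) *\<^sub>R (x + z * z)"
    by (intro tendsto_intros z)
  hence zeq: "z = (1/2) *\<^sub>R (x + z * z)"
    by (rule LIMSEQ_unique[OF z2[unfolded yS]])
  have "2 *\<^sub>R z = x + z * z"
    using arg_cong[OF zeq, of "\<lambda>u. 2 *\<^sub>R u"] by (simp only: scaleR_scaleR) simp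
  hence "z + z = x + z * z" by (simp add: scaleR_2)
  hence "(1 - z) * (1 - z) = 1 - x" by (simp add: algebra_simps)
  moreover have "selfadj z"
    using LIMSEQ_unique[OF z bounded_linear.tendsto[OF bounded_linear_adj z, unfolded ysa[unfolded selfadj_def]]]
    by (simp add: selfadj_def)
  moreover have "norm z \<le> 1"
    by (rule tendsto_upperbound[OF tendsto_norm[OF z]]) (use order_trans[OF yt] t01 in auto)
  moreover have "c * z = z * c" if "c * x = x * c" for c
    using LIMSEQ_unique[OF tendsto_mult_left[OF z, of c] tendsto_mult_right[OF z, of c, folded comm[OF that]]] .
  ultimately show ?thesis by blast
qed

text \<open>The cone of elements whose spectrum lies in a disc \<open>|l - t| \<le> t\<close>. It turns out to be both the set of
  squares and the set of spectrally positive elements, without any appeal to the spectral radius formula.\<close>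

definition ncone :: "'a::cstar_algebra \<Rightarrow> bool" where
  "ncone a \<longleftrightarrow> selfadj a \<and> (\<exists>t\<ge>0. norm (of_real t - a) \<le> t)"

lemma ncone_selfadj: "ncone a \<Longrightarrow> selfadj a"
  by (simp add: ncone_def)

lemma ncone_add:
  fixes a b :: "'a::cstar_algebra"
  assumes "ncone a" "ncone b" shows "ncone (a + b)"
proof -
  obtain s t where "s \<ge> 0" "t \<ge> 0" and st: "norm (of_real s - a) \<le> s" "norm (of_real t - b) \<le> t"
    using assms by (auto simp: ncone_def)
  have "norm ((of_real s - a) + (of_real t - b)) \<le> s + t"
    by (rule order_trans[OF norm_triangle_ineq]) (use st in simp)
  hence "norm (of_real (s + t) - (a + b)) \<le> s + t" by (simp add: algebra_simps)
  thus ?thesis using assms \<open>s \<ge> 0\<close> \<open>t \<ge> 0\<close> unfolding ncone_def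
    by (metis add_nonneg_nonneg selfadj_add)
qed

lemma ncone_scaleR:
  fixes a :: "'a::cstar_algebra"
  assumes "ncone a" "r \<ge> 0" shows "ncone (r *\<^sub>R a)"
proof -
  obtain t where "t \<ge> 0" and t: "norm (of_real t - a) \<le> t"
    using assms by (auto simp: ncone_def)
  have "of_real (r * t) - r *\<^sub>R a = r *\<^sub>R (of_real t - a)"
    by (simp add: scaleR_conv_of_real algebra_simps)
  hence "norm (of_real (r * t) - r *\<^sub>R a) \<le> r * t"
    using t assms(2) by (simp add: mult_left_mono)
  thus ?thesis using assms \<open>t \<ge> 0\<close> unfolding ncone_def
    by (metis mult_nonneg_nonneg selfadj_scaleR)
qed

lemma ncone_of_real: "r \<ge> 0 \<Longrightarrow> ncone (of_real r)"
  unfolding ncone_def by (auto intro!: exI[of _ r])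

lemma ncone_one_diff: "selfadj b \<Longrightarrow> norm b \<le> 1 \<Longrightarrow> ncone (1 - b)"
  for b :: "'a::cstar_algebra"
  unfolding ncone_def by (auto intro!: exI[of _ 1] selfadj_intros)

text \<open>For \<open>t > 0\<close> membership says that \<open>a = t (1 - x)\<close> with
  \<open>norm x \<le> 1\<close>, which is the situation of \<open>sqrt_near_one\<close>.\<close>

lemma ncone_sqrt:
  fixes a :: "'a::cstar_algebra"
  assumes "ncone a"
  shows "\<exists>y. selfadj y \<and> ncone y \<and> y * y = a \<and> (\<forall>c. c * a = a * c \<longrightarrow> c * y = y * c)"
proof -
  obtain t where "t \<ge> 0" and t: "norm (of_real t - a) \<le> t" and sa: "selfadj a"
    using assms by (auto simp: ncone_def)
  show ?thesis
  proof (cases "t = 0")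
    case True
    hence "a = 0" using t by simp
    thus ?thesis using ncone_of_real[of 0, where 'a='a] by (intro exI[of _ 0]) auto
  next
    case False
    hence tp: "t > 0" using \<open>t \<ge> 0\<close> by simp
    define x where "x = 1 - (1/t) *\<^sub>R a"
    have "x = (1/t) *\<^sub>R (of_real t - a)"
      using tp by (simp add: x_def scaleR_diff_right of_real_def)
    hence nx: "norm x \<le> 1" using t tp by (simp add: divide_le_eq)
    have "selfadj x" unfolding x_def by (intro selfadj_intros sa) auto
    then obtain z where z: "selfadj z" "norm z \<le> 1" "(1 - z) * (1 - z) = 1 - x"
      and zc: "\<And>c. c * x = x * c \<Longrightarrow> c * z = z * c"
      using sqrt_near_one[OF _ nx] by blast
    define y where "y = sqrt t *\<^sub>R (1 - z)"
    have "y * y = t *\<^sub>R ((1 - z) * (1 - z))" using tp by (simp add: y_def)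
    also have "\<dots> = a" using z(3) tp by (simp add: x_def)
    finally have "y * y = a" .
    moreover have "ncone y" unfolding y_def
      by (intro ncone_scaleR ncone_one_diff z) (use tp in auto)
    moreover have "c * y = y * c" if "c * a = a * c" for c
      using zc[of c] that by (simp add: y_def x_def algebra_simps)
    ultimately show ?thesis using ncone_selfadj by blast
  qed
qed

text \<open>\<open>v\<close> and \<open>w\<close> are the real and imaginary part of a normal
  element, whose norm the C*-identity computes from \<open>v * v + w * w\<close>. With commuting
  square roots for \<open>v\<close> and \<open>w\<close> this yields the norm comparisons otherwise
  read off from functional calculus.\<close>

lemma norm_sum_squares:
  fixes v w :: "'a::cstar_algebra"
  assumes "selfadj v" "selfadj w" "v * w = w * v"
  shows "(norm (v + cscale \<i> w))\<^sup>2 = norm (v * v + w * w)"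
    and "norm v \<le> norm (v + cscale \<i> w)"
    and "norm w \<le> norm (v + cscale \<i> w)"
proof -
  define x where "x = v + cscale \<i> w"
  have ax: "adj x = v - cscale \<i> w"
    using assms by (simp add: x_def adj_simps selfadj_def cscale_minus_left)
  have "adj x * x = v * v + w * w"
    using assms(3)
    by (subst ax) (simp add: x_def algebra_simps mult_cscale_left mult_cscale_right cscale_diff_right cscale_ii_ii)
  thus "(norm (v + cscale \<i> w))\<^sup>2 = norm (v * v + w * w)"
    using cstar_identity[of x] by (simp add: x_def)
  have "2 *\<^sub>R v = x + adj x" unfolding ax by (simp add: x_def scaleR_2)
  hence "2 * norm v \<le> norm x + norm (adj x)"
    by (metis norm_scaleR norm_triangle_ineq abs_numeral)
  thus "norm v \<le> norm (v + cscale \<i> w)" by (simp add: x_def)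
  have "2 *\<^sub>R cscale \<i> w = x - adj x" unfolding ax by (simp add: x_def scaleR_2)
  hence "2 * norm (cscale \<i> w) \<le> norm x + norm (adj x)"
    by (metis norm_scaleR norm_triangle_ineq4 abs_numeral)
  thus "norm w \<le> norm (v + cscale \<i> w)" by (simp add: x_def norm_cscale)
qed

text \<open>A root \<open>w\<close> of \<open>1 - y * y\<close> makes \<open>y + i w\<close>
  unitary, and the imaginary part of an element of norm 1 has norm at most 1.\<close>

lemma norm_one_diff_square:
  fixes y :: "'a::cstar_algebra"
  assumes "selfadj y" "norm y \<le> 1"
  shows "norm (1 - y * y) \<le> 1"
proof -
  have "norm (y * y) \<le> 1" using assms by (simp add: norm_selfadj_square power_le_one)
  hence "ncone (1 - y * y)"
    using assms by (intro ncone_one_diff selfadj_mult_commuting) auto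
  then obtain w where w: "selfadj w" "w * w = 1 - y * y" and wc: "\<And>c. c * (1 - y * y) = (1 - y * y) * c \<Longrightarrow> c * w = w * c"
    using ncone_sqrt by blast
  have "y * w = w * y" by (rule wc) (simp add: algebra_simps)
  hence "norm w \<le> norm (y + cscale \<i> w)" "(norm (y + cscale \<i> w))\<^sup>2 = 1"
    using norm_sum_squares[of y w] assms w by auto
  hence "norm w \<le> 1" by (metis norm_ge_zero power2_eq_1_iff order_trans le_minus_one_simps(3) linear)
  thus ?thesis using norm_selfadj_square[OF w(1)] w(2) by (simp add: power_le_one)
qed

text \<open>The definition of \<open>ncone\<close> supplies only some radius; here every radius from
  \<open>norm a\<close> on works. A radius common to all nearby elements is what makes the cone
  closed.\<close>

lemma ncone_norm:
  fixes a :: "'a::cstar_algebra"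
  assumes "ncone a" "norm a \<le> r"
  shows "norm (of_real r - a) \<le> r"
proof (cases "r = 0")
  case True
  thus ?thesis using assms by simp
next
  case False
  hence r: "r > 0" using assms(2) norm_ge_zero[of a] by linarith
  obtain y where y: "selfadj y" "y * y = a" using ncone_sqrt[OF assms(1)] by blast
  define w where "w = (1 / sqrt r) *\<^sub>R y"
  have "(norm y)\<^sup>2 \<le> r" using norm_selfadj_square[OF y(1)] y(2) assms(2) by simp
  hence "norm y \<le> sqrt r" by (simp add: real_le_rsqrt)
  hence "norm w \<le> 1" using r by (simp add: w_def divide_le_eq)
  moreover have "selfadj w" unfolding w_def by (intro selfadj_intros y)
  ultimately have n1: "norm (1 - w * w) \<le> 1" by (rule norm_one_diff_square[rotated])
  have "w * w = (1/r) *\<^sub>R a" using r y(2) by (simp add: w_def)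
  hence "of_real r - a = r *\<^sub>R (1 - w * w)"
    using r by (simp add: scaleR_diff_right of_real_def)
  thus ?thesis using n1 r by simp
qed

lemma ncone_square:
  fixes y :: "'a::cstar_algebra"
  assumes "selfadj y" shows "ncone (y * y)"
proof (cases "y = 0")
  case True
  thus ?thesis using ncone_of_real[of 0, where 'a='a] by simp
next
  case False
  define w where "w = (1 / norm y) *\<^sub>R y"
  have w: "selfadj w" "norm w \<le> 1" unfolding w_def using False by (auto intro: selfadj_intros assms)
  have "ncone (w * w)"
    using norm_one_diff_square[OF w] w by (auto simp: ncone_def intro!: exI[of _ 1] selfadj_mult_commuting)
  hence "ncone ((norm y)\<^sup>2 *\<^sub>R (w * w))" by (rule ncone_scaleR) simp
  thus ?thesis using False by (simp add: w_def power2_eq_square)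
qed

lemma ncone_closed:
  fixes a :: "'a::cstar_algebra"
  assumes sa: "selfadj a" and lim: "\<And>e. e > 0 \<Longrightarrow> \<exists>b. ncone b \<and> norm (b - a) \<le> e"
  shows "ncone a"
proof -
  define r where "r = norm a + 1"
  have "norm (of_real r - a) \<le> r + e" if e: "0 < e" for e
  proof -
    obtain b where b: "ncone b" "norm (b - a) \<le> min e 1" using lim[of "min e 1"] e by auto
    have "norm b \<le> norm (b - a) + norm a" using norm_triangle_ineq[of "b - a" a] by simp
    hence "norm b \<le> r" using b by (simp add: r_def)
    hence "norm (of_real r - b) \<le> r" by (rule ncone_norm[OF b(1)])
    moreover have "norm (of_real r - a) \<le> norm (of_real r - b) + norm (b - a)"
      using norm_triangle_ineq[of "of_real r - b" "b - a"] by simp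
    ultimately show ?thesis using b by linarith
  qed
  hence "norm (of_real r - a) \<le> r" by (rule field_le_epsilon)
  moreover have "r \<ge> 0" by (simp add: r_def)
  ultimately show ?thesis using sa by (auto simp: ncone_def)
qed

text \<open>Commuting roots \<open>y\<close>, \<open>w\<close> of \<open>a\<close> and
  \<open>- a\<close> satisfy \<open>y * y + w * w = 0\<close>, so \<open>y + i w\<close> has norm
  0.\<close>

lemma ncone_antisym:
  fixes a :: "'a::cstar_algebra"
  assumes "ncone a" "ncone (- a)" shows "a = 0"
proof -
  obtain y w where y: "selfadj y" "y * y = a" "\<And>c. c * a = a * c \<Longrightarrow> c * y = y * c"
    and w: "selfadj w" "w * w = - a" "\<And>c. c * (- a) = (- a) * c \<Longrightarrow> c * w = w * c"
    using ncone_sqrt[OF assms(1)] ncone_sqrt[OF assms(2)] by metis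
  have "y * a = a * y" using y(2) by (metis mult.assoc)
  hence "y * w = w * y" using w(3)[of y] by simp
  hence "norm y \<le> norm (y + cscale \<i> w)" "(norm (y + cscale \<i> w))\<^sup>2 = 0"
    using norm_sum_squares[of y w] y(1,2) w(1,2) by auto
  hence "y = 0" by simp
  thus ?thesis using y(2) by simp
qed

lemma ncone_mult:
  fixes a b :: "'a::cstar_algebra"
  assumes "ncone a" "ncone b" "a * b = b * a" shows "ncone (a * b)"
proof -
  obtain y w where y: "selfadj y" "y * y = a" "\<And>c. c * a = a * c \<Longrightarrow> c * y = y * c"
    and w: "selfadj w" "w * w = b" "\<And>c. c * b = b * c \<Longrightarrow> c * w = w * c"
    using ncone_sqrt[OF assms(1)] ncone_sqrt[OF assms(2)] by metis
  have "b * y = y * b" using y(3) assms(3) by simp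
  hence yw: "y * w = w * y" using w(3) by simp
  have "a * b = y * (y * w) * w" by (simp add: y(2)[symmetric] w(2)[symmetric] mult.assoc)
  also have "\<dots> = (y * w) * (y * w)" by (metis yw mult.assoc)
  finally show ?thesis using ncone_square[OF selfadj_mult_commuting[OF y(1) w(1) yw]] by simp
qed

text \<open>With roots \<open>v\<close>, \<open>w\<close> of \<open>x\<close> and
  \<open>of_real r - x\<close>, the element \<open>v + i w\<close> has squared norm
  \<open>\<bar>r\<bar>\<close>, which bounds that of \<open>v\<close>.\<close>

lemma ncone_norm_le:
  fixes x :: "'a::cstar_algebra"
  assumes "ncone x" "ncone (of_real r - x)" shows "norm x \<le> r"
proof -
  obtain v w where v: "selfadj v" "v * v = x" "\<And>c. c * x = x * c \<Longrightarrow> c * v = v * c"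
    and w: "selfadj w" "w * w = of_real r - x" "\<And>c. c * (of_real r - x) = (of_real r - x) * c \<Longrightarrow> c * w = w * c"
    using ncone_sqrt[OF assms(1)] ncone_sqrt[OF assms(2)] by metis
  have "v * x = x * v" using v(2) by (metis mult.assoc)
  hence "v * w = w * v" by (intro w(3)) (simp add: algebra_simps of_real_def)
  hence "norm v \<le> norm (v + cscale \<i> w)" "(norm (v + cscale \<i> w))\<^sup>2 = \<bar>r\<bar>"
    using norm_sum_squares[of v w] v(1,2) w(1,2) by auto
  hence "(norm v)\<^sup>2 \<le> \<bar>r\<bar>" by (metis norm_ge_zero power_mono)
  hence n: "norm x \<le> \<bar>r\<bar>" using norm_selfadj_square[OF v(1)] v(2) by simp
  have "r \<ge> 0"
  proof (rule ccontr)
    assume "\<not> r \<ge> 0"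
    have "ncone (of_real r :: 'a)" using ncone_add[OF assms] by simp
    moreover have "ncone (- of_real r :: 'a)" using ncone_of_real[of "- r"] \<open>\<not> r \<ge> 0\<close> by simp
    ultimately show False using ncone_antisym \<open>\<not> r \<ge> 0\<close> by fastforce
  qed
  thus ?thesis using n by simp
qed

lemma ncone_invertible:
  fixes h :: "'a::cstar_algebra"
  assumes "ncone h" "e > 0"
  shows "invertible_el (of_real e + h)"
proof -
  obtain t where "t \<ge> 0" "norm (of_real t - h) \<le> t" using assms by (auto simp: ncone_def)
  hence "norm (of_real (e + t) - (of_real e + h)) < e + t" using assms by simp
  thus ?thesis by (rule invertible_near_real)
qed

lemma ncone_cinv:
  fixes h :: "'a::cstar_algebra"
  assumes "ncone h" "invertible_el h"
  shows "ncone (cinv h)"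
proof -
  obtain y where y: "selfadj y" "y * y = h" "\<And>c. c * h = h * c \<Longrightarrow> c * y = y * c"
    using ncone_sqrt[OF assms(1)] by metis
  have c: "cinv h * y = y * cinv h" by (rule y(3)) (simp add: cinv[OF assms(2)])
  have "selfadj (y * cinv h)"
    using selfadj_mult_commuting[OF y(1) selfadj_cinv[OF ncone_selfadj[OF assms(1)] assms(2)]] c by simp
  hence "ncone ((y * cinv h) * (y * cinv h))" by (rule ncone_square)
  moreover have "(y * cinv h) * (y * cinv h) = (cinv h * h) * cinv h"
    using c y(2) by (metis mult.assoc)
  ultimately show ?thesis by (simp add: cinv[OF assms(2)])
qed

text \<open>With \<open>h = |a|\<close> and \<open>u = h - a\<close> one has \<open>u u = 2 h u\<close>, so \<open>u\<close> is the limit of the elements \<open>u u / (2 (h + e))\<close>.\<close>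

lemma ncone_abs_diff:
  fixes a h :: "'a::cstar_algebra"
  assumes sa: "selfadj a" and h: "ncone h" "h * h = a * a" "h * a = a * h"
  shows "ncone (h - a)"
proof -
  define u where "u = h - a"
  have su: "selfadj u" unfolding u_def by (intro selfadj_intros sa ncone_selfadj h)
  have hu: "h * u = u * h" using h by (simp add: u_def algebra_simps)
  have uu: "u * u = 2 *\<^sub>R (h * u)"
    using h(2,3) by (simp add: u_def algebra_simps scaleR_2)
  show "ncone u"
  proof (rule ncone_closed[OF su])
    fix e :: real assume e: "e > 0"
    define d where "d = e / 2"
    have d: "d > 0" using e by (simp add: d_def)
    define c where "c = cinv (of_real d + h)"
    have inv: "invertible_el (of_real d + h)" by (rule ncone_invertible[OF h(1) d])
    have hd: "ncone (of_real d + h)" by (intro ncone_add ncone_of_real h) (use d in simp)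
    have nc: "ncone c" unfolding c_def by (rule ncone_cinv[OF hd inv])
    have cu: "c * u = u * c" unfolding c_def
      by (rule cinv_commute[OF inv]) (simp add: algebra_simps hu scaleR_conv_of_real[symmetric] of_real_def)
    have ch: "c * h = h * c" unfolding c_def
      by (rule cinv_commute[OF inv]) (simp add: algebra_simps of_real_def)
    have hc: "h * c = 1 - d *\<^sub>R c"
      using cinv(1)[OF inv] by (simp add: c_def algebra_simps scaleR_conv_of_real)
    \<comment> \<open>\<open>h * c\<close> is \<open>h / (h + d)\<close>, which lies between 0 and
      1.\<close>
    have "norm (h * c) \<le> 1"
    proof (rule ncone_norm_le)
      show "ncone (h * c)" by (rule ncone_mult) (use h nc ch in auto)
      show "ncone (of_real 1 - h * c)" unfolding hc using ncone_scaleR[OF nc, of d] d by simp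
    qed
    have suc: "selfadj (u * c)" using selfadj_mult_commuting[OF su ncone_selfadj[OF nc]] cu by simp
    have eq: "u * c * (u * c) = 2 *\<^sub>R (h * c * (u * c))"
    proof -
      have "u * c * (u * c) = (u * u) * (c * c)" by (metis cu mult.assoc)
      also have "\<dots> = 2 *\<^sub>R (h * (u * c) * c)" by (simp add: uu mult.assoc)
      also have "h * (u * c) * c = h * c * (u * c)" by (metis cu mult.assoc)
      finally show ?thesis .
    qed
    have "(norm (u * c))\<^sup>2 = norm (u * c * (u * c))" using norm_selfadj_square[OF suc] by simp
    also have "\<dots> \<le> 2 * (norm (h * c) * norm (u * c))" unfolding eq by (simp add: norm_mult_ineq)
    also have "\<dots> \<le> 2 * norm (u * c)"
      using \<open>norm (h * c) \<le> 1\<close> mult_right_mono[of "norm (h*c)" 1 "norm (u*c)"] by simp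
    finally have nuc: "norm (u * c) \<le> 2"
      by (cases "norm (u * c) = 0") (simp_all add: power2_eq_square)
    \<comment> \<open>Since \<open>u * u = 2 h u\<close>, the element \<open>b\<close> is
      \<open>h u / (h + d)\<close> and differs from \<open>u\<close> by
      \<open>d u / (h + d)\<close>. The bound 2 on \<open>u * c\<close> and \<open>d = e / 2\<close>
      keep the difference within \<open>e\<close>.\<close>
    define b where "b = (1/2) *\<^sub>R (u * u * c)"
    have "u * u * c = c * (u * u)" by (metis cu mult.assoc)
    hence "ncone b" unfolding b_def
      by (intro ncone_scaleR ncone_mult[OF ncone_square[OF su] nc]) simp_all
    moreover have "b - u = - (d *\<^sub>R (u * c))"
    proof -
      have "b = h * u * c" by (simp add: b_def uu)
      also have "\<dots> = u * (h * c)" by (simp add: hu mult.assoc)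
      finally show ?thesis by (simp add: hc algebra_simps)
    qed
    hence "norm (b - u) \<le> d * 2" using nuc d by simp
    ultimately show "\<exists>b. ncone b \<and> norm (b - u) \<le> e" using d_def by auto
  qed
qed

lemma selfadj_parts_ncone:
  fixes a :: "'a::cstar_algebra"
  assumes sa: "selfadj a"
  shows "\<exists>u v. ncone u \<and> ncone v \<and> a = u - v \<and> u * v = 0 \<and> v * u = 0 \<and>
    (\<forall>c. c * a = a * c \<longrightarrow> c * u = u * c \<and> c * v = v * c)"
proof -
  obtain h where h: "ncone h" "h * h = a * a" and hc: "\<And>c. c * (a * a) = (a * a) * c \<Longrightarrow> c * h = h * c"
    using ncone_sqrt[OF ncone_square[OF sa]] by blast
  have ha: "h * a = a * h" using hc[of a] by (simp add: mult.assoc)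
  define u where "u = (1/2) *\<^sub>R (h + a)"
  define v where "v = (1/2) *\<^sub>R (h - a)"
  have "ncone (h - (- a))" by (rule ncone_abs_diff) (use h ha sa in \<open>auto intro: selfadj_intros\<close>)
  hence "ncone u" unfolding u_def by (intro ncone_scaleR) auto
  moreover have "ncone v" unfolding v_def
    by (intro ncone_scaleR ncone_abs_diff) (use h ha sa in auto)
  moreover have "a = u - v"
    by (simp add: u_def v_def flip: scaleR_diff_right)
  moreover have "u * v = 0" "v * u = 0" using ha h(2) by (simp_all add: u_def v_def algebra_simps)
  moreover have "c * u = u * c \<and> c * v = v * c" if "c * a = a * c" for c
  proof -
    have "c * (a * a) = (a * a) * c" using that by (metis mult.assoc)
    hence "c * h = h * c" by (rule hc)
    thus ?thesis using that by (simp add: u_def v_def algebra_simps)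
  qed
  ultimately show ?thesis by blast
qed

section \<open>Agreement of the cone with spectral positivity\<close>

lemma cscale_real_one: "cscale (complex_of_real r) 1 = (of_real r :: 'a::cstar_algebra)"
  by (simp add: of_real_def scaleR_cscale)

text \<open>The disc is centred far out on the imaginary axis: the translate \<open>d + i t\<close>
  has squared norm at most \<open>norm d ^ 2 + t ^ 2\<close>, which is below
  \<open>(y + t) ^ 2\<close> for suitable \<open>t\<close>.\<close>

lemma selfadj_spec_real:
  fixes a :: "'a::cstar_algebra"
  assumes sa: "selfadj a" and im: "Im l \<noteq> 0"
  shows "invertible_el (a - cscale l 1)"
proof -
  define d where "d = a - of_real (Re l)"
  define y where "y = Im l"
  \<comment> \<open>Solves \<open>(y + t) ^ 2 = y ^ 2 + norm d ^ 2 + t ^ 2\<close>, which leaves the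
    margin \<open>y ^ 2\<close>.\<close>
  define t where "t = (norm d)\<^sup>2 / (2 * y)"
  have y: "y \<noteq> 0" using im by (simp add: y_def)
  have sd: "selfadj d" unfolding d_def by (intro selfadj_intros sa) simp
  have i1: "cscale (\<i> * of_real r) 1 = cscale \<i> (of_real r :: 'a)" for r
    using cscale_cscale[of \<i> "of_real r" "1::'a"] by (simp only: cscale_real_one)
  have "cscale (of_real (Re l) + \<i> * of_real y) 1 = of_real (Re l) + cscale \<i> (of_real y :: 'a)"
    by (simp only: cscale_add_left cscale_real_one i1)
  hence cl: "cscale l 1 = of_real (Re l) + cscale \<i> (of_real y :: 'a)"
    using complex_eq[of l] by (simp only: y_def)
  have "cscale (- \<i> * of_real (y + t)) 1 = - cscale \<i> (of_real y) - cscale \<i> (of_real t :: 'a)"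
    using cscale_minus_left[of "\<i> * of_real (y + t)" "1::'a"] unfolding i1
    by (simp add: cscale_add_right)
  hence eq: "a - cscale l 1 - cscale (- \<i> * of_real (y + t)) 1 = d + cscale \<i> (of_real t)"
    unfolding cl d_def by (simp add: algebra_simps)
  have "(norm (d + cscale \<i> (of_real t)))\<^sup>2 = norm (d * d + of_real t * of_real t)"
    by (rule norm_sum_squares) (use sd in \<open>auto simp: of_real_commute\<close>)
  also have "\<dots> \<le> (norm d)\<^sup>2 + t\<^sup>2"
    by (rule order_trans[OF norm_triangle_ineq])
       (simp add: norm_selfadj_square[OF sd] power2_eq_square flip: of_real_mult)
  also have "\<dots> < (y + t)\<^sup>2"
    using y by (simp add: power2_sum t_def)
  finally have "norm (d + cscale \<i> (of_real t)) < \<bar>y + t\<bar>"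
    by (metis abs_ge_zero power2_abs power2_less_imp_less)
  hence "norm (a - cscale l 1 - cscale (- \<i> * of_real (y + t)) 1) < cmod (- \<i> * of_real (y + t))"
    unfolding eq by (simp add: norm_mult del: of_real_add)
  thus ?thesis by (rule invertible_near_scalar)
qed

lemma positiveI:
  fixes a :: "'a::cstar_algebra"
  assumes sa: "selfadj a" and inv: "\<And>r. r > 0 \<Longrightarrow> invertible_el (of_real r + a)"
  shows "positive a"
  unfolding positive_def
proof (intro conjI ballI sa)
  fix l assume l: "l \<in> spec a"
  show im: "Im l = 0" using selfadj_spec_real[OF sa] l by (auto simp: spec_def)
  show "Re l \<ge> 0"
  proof (rule ccontr)
    assume "\<not> Re l \<ge> 0"
    hence "invertible_el (of_real (- Re l) + a)" by (intro inv) simp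
    moreover have "l = complex_of_real (Re l)" using im by (simp add: complex_eq_iff)
    hence "cscale l 1 = (of_real (Re l) :: 'a)" by (metis cscale_real_one)
    ultimately show False using l by (simp add: spec_def)
  qed
qed

lemma ncone_imp_positive: "ncone a \<Longrightarrow> positive a"
  by (intro positiveI ncone_selfadj ncone_invertible)

text \<open>For \<open>0 \<le> b \<le> 1\<close> one has
  \<open>1 - b ^ (n + 1) = (1 - b) (1 + b + ... + b ^ n)\<close>, where each of the
  \<open>n + 1\<close> summands is at least \<open>b ^ n\<close>. The induction proves the resulting
  lower bound inside the cone.\<close>

lemma ncone_decay:
  fixes b :: "'a::cstar_algebra"
  assumes b: "ncone b" "norm b \<le> 1"
  shows "norm ((1 - b) * b ^ n) \<le> 1 / real (n + 1)"
proof -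
  have sb: "selfadj b" using b ncone_selfadj by blast
  have n1: "ncone (1 - b)" by (rule ncone_one_diff) (use sb b in auto)
  have pw: "ncone (b ^ n)" for n
  proof (induction n)
    case 0
    show ?case using ncone_of_real[of 1, where 'a='a] by simp
  next
    case (Suc n)
    thus ?case using ncone_mult[OF b(1) Suc] by (simp add: power_commutes)
  qed
  have cm: "(1 - b) * b ^ n = b ^ n * (1 - b)" for n by (simp add: algebra_simps power_commutes)
  have Q: "ncone (1 - b ^ (n + 1) - real (n + 1) *\<^sub>R ((1 - b) * b ^ n))" for n
  proof (induction n)
    case 0
    show ?case using ncone_of_real[of 0, where 'a='a] by simp
  next
    case (Suc n)
    have sq: "ncone ((1 - b) * (1 - b) * b ^ n)"
      by (rule ncone_mult[OF ncone_mult[OF n1 n1] pw]) (metis, metis cm mult.assoc)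
    have eq: "1 - b ^ (Suc n + 1) - real (Suc n + 1) *\<^sub>R ((1 - b) * b ^ Suc n)
      = (1 - b ^ (n + 1) - real (n + 1) *\<^sub>R ((1 - b) * b ^ n)) + real (n + 1) *\<^sub>R ((1 - b) * (1 - b) * b ^ n)"
      by (simp add: algebra_simps scaleR_left.add scaleR_2)
    show ?case unfolding eq by (intro ncone_add Suc ncone_scaleR sq) simp
  qed
  have "norm (real (n + 1) *\<^sub>R ((1 - b) * b ^ n)) \<le> 1"
  proof (rule ncone_norm_le)
    show "ncone (real (n + 1) *\<^sub>R ((1 - b) * b ^ n))"
      by (intro ncone_scaleR ncone_mult n1 pw cm) simp
    have "ncone ((1 - b ^ (n + 1) - real (n + 1) *\<^sub>R ((1 - b) * b ^ n)) + b ^ (n + 1))"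
      by (intro ncone_add Q pw)
    thus "ncone (of_real 1 - real (n + 1) *\<^sub>R ((1 - b) * b ^ n))" by simp
  qed
  hence "real (n + 1) * norm ((1 - b) * b ^ n) \<le> 1" by (simp only: norm_scaleR abs_of_nat)
  thus ?thesis by (simp only: le_divide_eq) (simp add: mult.commute)
qed

text \<open>If the negative part \<open>v\<close> is nonzero, the spectrum omits
  \<open>- norm v\<close>, so \<open>a + of_real r\<close> has an inverse \<open>c\<close>. Since
  \<open>a * v = - (v * v)\<close>, this gives \<open>b ^ n = r c (1 - b) b ^ n\<close>, which tends
  to 0 by \<open>ncone_decay\<close>, although \<open>b\<close> is self-adjoint of norm 1.\<close>

lemma positive_imp_ncone:
  fixes a :: "'a::cstar_algebra"
  assumes pos: "positive a" shows "ncone a"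
proof -
  have sa: "selfadj a" using pos by (simp add: positive_def)
  obtain u v where uv: "ncone u" "ncone v" "a = u - v" "u * v = 0" "v * u = 0"
    using selfadj_parts_ncone[OF sa] by blast
  have "v = 0"
  proof (rule ccontr)
    assume v: "v \<noteq> 0"
    define r where "r = norm v"
    have r: "r > 0" using v by (simp add: r_def)
    define b where "b = (1/r) *\<^sub>R v"
    have b: "ncone b" "norm b = 1" using ncone_scaleR[OF uv(2), of "1/r"] r by (auto simp: b_def r_def)
    have "\<not> complex_of_real (- r) \<in> spec a" using pos r unfolding positive_def by force
    hence "invertible_el (a - cscale (complex_of_real (- r)) 1)" by (simp add: spec_def)
    hence "invertible_el (a + of_real r)" unfolding cscale_real_one by simp
    then obtain c where c: "c * (a + of_real r) = 1" unfolding invertible_el_def by blast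
    have "a * v = - (v * v)" by (simp add: uv(3) left_diff_distrib uv(4))
    hence "(a + of_real r) * b = r *\<^sub>R ((1 - b) * b)"
      using r by (simp add: b_def algebra_simps of_real_def)
    hence "(a + of_real r) * b ^ n = r *\<^sub>R ((1 - b) * b ^ n)" if "n > 0" for n
      using that by (cases n) (simp_all flip: mult.assoc)
    hence bn: "b ^ n = r *\<^sub>R (c * ((1 - b) * b ^ n))" if "n > 0" for n
      using that c by (metis mult.assoc mult_1 mult_scaleR_right)
    have sb: "selfadj b" using b ncone_selfadj by blast
    \<comment> \<open>The C*-identity preserves norm 1 under repeated squaring, which is why the
      exponents are powers of two.\<close>
    have nb: "norm (b ^ (2 ^ k)) = 1" for k
    proof (induction k)
      case (Suc k)
      have "b ^ (2 ^ Suc k) = b ^ (2 ^ k) * b ^ (2 ^ k)" by (simp add: power_add[symmetric] mult_2)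
      thus ?case using norm_selfadj_square[OF selfadj_power[OF sb], of "2 ^ k"] Suc by simp
    qed (simp add: b)
    have "1 \<le> (r * norm c) / real (2 ^ k + 1)" for k
    proof -
      have "1 = norm (r *\<^sub>R (c * ((1 - b) * b ^ (2 ^ k))))" using bn[of "2^k"] nb[of k] by simp
      also have "\<dots> \<le> r * (norm c * norm ((1 - b) * b ^ (2 ^ k)))"
        using r by (simp add: norm_mult_ineq)
      also have "\<dots> \<le> r * (norm c * (1 / real (2 ^ k + 1)))"
        using r ncone_decay[of b "2 ^ k"] b by (intro mult_left_mono) auto
      finally show ?thesis by simp
    qed
    hence big: "1 + 2 ^ k \<le> r * norm c" for k :: nat
      using le_divide_eq_1_pos[of "2 ^ k + 1" "r * norm c"] by (simp add: add_pos_pos)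
    obtain k :: nat where "r * norm c < 2 ^ k" using real_arch_pow[of 2] by auto
    thus False using big[of k] by linarith
  qed
  thus ?thesis using uv by simp
qed

lemma positive_iff_ncone: "positive a \<longleftrightarrow> ncone a"
  using ncone_imp_positive positive_imp_ncone by blast

lemma positive_selfadj: "positive a \<Longrightarrow> selfadj a"
  by (simp add: positive_def)

lemma positive_of_real [simp]: "positive (of_real r :: 'a::cstar_algebra) \<longleftrightarrow> r \<ge> 0"
proof
  assume "positive (of_real r :: 'a)"
  show "r \<ge> 0"
  proof (rule ccontr)
    assume "\<not> r \<ge> 0"
    hence "ncone (- of_real r :: 'a)" using ncone_of_real[of "- r"] by simp
    hence "(of_real r :: 'a) = 0" using \<open>positive (of_real r :: 'a)\<close> ncone_antisym positive_iff_ncone by blast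
    thus False using \<open>\<not> r \<ge> 0\<close> by simp
  qed
qed (simp add: positive_iff_ncone ncone_of_real)

lemma positive_0 [simp]: "positive (0 :: 'a::cstar_algebra)"
  and positive_1 [simp]: "positive (1 :: 'a::cstar_algebra)"
  using positive_of_real[of 0, where 'a='a] positive_of_real[of 1, where 'a='a] by auto

lemma positive_add: "positive a \<Longrightarrow> positive b \<Longrightarrow> positive (a + b)"
  by (simp add: positive_iff_ncone ncone_add)

lemma positive_scaleR: "positive a \<Longrightarrow> r \<ge> 0 \<Longrightarrow> positive (r *\<^sub>R a)"
  by (simp add: positive_iff_ncone ncone_scaleR)

lemma positive_square: "selfadj a \<Longrightarrow> positive (a * a)"
  by (simp add: positive_iff_ncone ncone_square)

lemma positive_mult: "positive a \<Longrightarrow> positive b \<Longrightarrow> a * b = b * a \<Longrightarrow> positive (a * b)"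
  by (simp add: positive_iff_ncone ncone_mult)

text \<open>The commutation clause is part of the choice, so commutation with roots is available
  without an argument about uniqueness.\<close>

definition psqrt :: "'a::cstar_algebra \<Rightarrow> 'a" where
  "psqrt a = (SOME y. positive y \<and> y * y = a \<and> (\<forall>c. c * a = a * c \<longrightarrow> c * y = y * c))"

lemma psqrt:
  assumes "positive a"
  shows "positive (psqrt a)" "psqrt a * psqrt a = a" "c * a = a * c \<Longrightarrow> c * psqrt a = psqrt a * c"
proof -
  have "\<exists>y. positive y \<and> y * y = a \<and> (\<forall>c. c * a = a * c \<longrightarrow> c * y = y * c)"
    using ncone_sqrt[of a] assms by (auto simp: positive_iff_ncone)
  from someI_ex[OF this] show "positive (psqrt a)" "psqrt a * psqrt a = a"
    "c * a = a * c \<Longrightarrow> c * psqrt a = psqrt a * c"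
    unfolding psqrt_def by blast+
qed

lemma selfadj_psqrt: "positive a \<Longrightarrow> selfadj (psqrt a)"
  using psqrt(1) positive_selfadj by blast

lemma positive_iff_invertible:
  fixes a :: "'a::cstar_algebra"
  shows "positive a \<longleftrightarrow> selfadj a \<and> (\<forall>r>0. invertible_el (of_real r + a))"
  using ncone_invertible positive_iff_ncone positive_selfadj positiveI by blast

text \<open>The inverse \<open>(1 + b c a) / r\<close>, with \<open>c\<close> the inverse of
  \<open>r - a b\<close>, is suggested by comparing the geometric series of \<open>a b\<close> and
  \<open>b a\<close>.\<close>

lemma invertible_swap:
  fixes a b :: "'a::cstar_algebra"
  assumes "r \<noteq> 0" "invertible_el (of_real r - a * b)"
  shows "invertible_el (of_real r - b * a)"
proof -
  define c where "c = cinv (of_real r - a * b)"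
  have c: "a * b * c = r *\<^sub>R c - 1" "c * (a * b) = r *\<^sub>R c - 1"
    using cinv[OF assms(2)] by (simp_all add: c_def algebra_simps scaleR_conv_of_real of_real_commute)
  define d where "d = (1/r) *\<^sub>R (1 + b * c * a)"
  have "(b * a) * (b * c * a) = b * (a * b * c) * a" by (simp add: mult.assoc)
  also have "\<dots> = r *\<^sub>R (b * c * a) - b * a" by (simp only: c(1)) (simp add: algebra_simps)
  finally have 1: "(b * a) * (b * c * a) = r *\<^sub>R (b * c * a) - b * a" .
  have "(b * c * a) * (b * a) = b * (c * (a * b)) * a" by (simp add: mult.assoc)
  also have "\<dots> = r *\<^sub>R (b * c * a) - b * a" by (simp only: c(2)) (simp add: algebra_simps)
  finally have 2: "(b * c * a) * (b * a) = r *\<^sub>R (b * c * a) - b * a" .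
  have "(of_real r - b * a) * (1 + b * c * a) = of_real r"
    using 1 by (simp add: algebra_simps scaleR_conv_of_real)
  moreover have "(1 + b * c * a) * (of_real r - b * a) = of_real r"
    using 2 by (simp add: algebra_simps scaleR_conv_of_real of_real_commute)
  ultimately have "(of_real r - b * a) * d = 1" "d * (of_real r - b * a) = 1"
    using assms(1) by (simp_all add: d_def of_real_def)
  thus ?thesis unfolding invertible_el_def by blast
qed

text \<open>For the negative part \<open>v\<close> of \<open>adj x * x\<close> and
  \<open>w = x * v\<close>, the element \<open>adj w * w\<close> is \<open>- (v * v * v)\<close>.
  Exchanging the factors preserves the nonzero spectrum, so \<open>- (w * adj w)\<close> is positive
  too. But \<open>adj w * w + w * adj w\<close> is half of \<open>h * h + k * k\<close> with
  \<open>h\<close>, \<open>k\<close> self-adjoint, so \<open>adj w * w\<close> is also positive.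
  Hence it is 0, and so is \<open>v\<close>.\<close>

lemma positive_adj_mult: "positive (adj x * x)" for x :: "'a::cstar_algebra"
proof -
  obtain u v where uv: "ncone u" "ncone v" "adj x * x = u - v" "u * v = 0" "v * u = 0"
    using selfadj_parts_ncone[OF selfadj_adj_mult(1)[of x]] by blast
  define w where "w = x * v"
  have sv: "selfadj v" using uv(2) ncone_selfadj by blast
  have "adj w * w = v * (adj x * x) * v" using sv by (simp add: w_def adj_simps selfadj_def mult.assoc)
  also have "\<dots> = - (v * v * v)" unfolding uv(3) using uv(4,5) by (simp add: algebra_simps)
  finally have ww: "adj w * w = - (v * v * v)" .
  have pv: "positive v" using uv(2) by (simp add: positive_iff_ncone)
  have pvvv: "positive (v * v * v)"
    by (intro positive_mult positive_square sv pv) (simp add: mult.assoc)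
  have "positive (- (w * adj w))"
    unfolding positive_iff_invertible
  proof (intro conjI allI impI)
    show "selfadj (- (w * adj w))" by (intro selfadj_minus selfadj_adj_mult)
    fix r :: real assume "r > 0"
    hence "invertible_el (of_real r - adj w * w)"
      using pvvv unfolding ww positive_iff_invertible by simp
    thus "invertible_el (of_real r + - (w * adj w))" using invertible_swap[of r "adj w" w] \<open>r > 0\<close> by simp
  qed
  moreover define h where "h = w + adj w"
  moreover define k where "k = cscale \<i> (w - adj w)"
  have "selfadj h" by (simp add: h_def selfadj_def adj_simps)
  have "selfadj k"
    by (simp add: k_def selfadj_def adj_simps cscale_minus_left cscale_diff_right)
  have "h * h + k * k = 2 *\<^sub>R (w * adj w + adj w * w)"
    unfolding h_def k_def
    by (simp add: mult_cscale_left mult_cscale_right cscale_diff_right cscale_ii_ii algebra_simps scaleR_2)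
  hence "adj w * w = (1/2) *\<^sub>R (h * h + k * k) + (- (w * adj w))" by simp
  ultimately have "positive (adj w * w)"
    using \<open>selfadj h\<close> \<open>selfadj k\<close>
    by (metis positive_add positive_scaleR positive_square zero_le_divide_1_iff zero_le_numeral)
  hence "v * v * v = 0" using pvvv ww ncone_antisym positive_iff_ncone by metis
  hence "v * v * (v * v) = 0" by (metis mult.assoc mult_zero_left)
  hence "v * v = 0" using norm_selfadj_square[OF selfadj_mult_commuting[OF sv sv refl]] by simp
  hence "v = 0" using norm_selfadj_square[OF sv] by simp
  thus ?thesis using uv by (simp add: positive_iff_ncone)
qed

lemma positive_conj:
  fixes a :: "'a::cstar_algebra"
  assumes "positive a" shows "positive (adj c * a * c)"
proof -
  have "adj c * a * c = adj (psqrt a * c) * (psqrt a * c)"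
    using psqrt(2)[OF assms] selfadj_psqrt[OF assms] by (simp add: adj_simps selfadj_def mult.assoc[symmetric])
       (simp add: mult.assoc)
  thus ?thesis by (simp only: positive_adj_mult)
qed

lemma positive_conj': "positive a \<Longrightarrow> selfadj c \<Longrightarrow> positive (c * a * c)"
  for a :: "'a::cstar_algebra"
  using positive_conj[of a c] by (simp add: selfadj_def)

lemma positive_zero_corner:
  fixes x :: "'a::cstar_algebra"
  assumes "positive x" "adj c * x * c = 0" shows "x * c = 0"
proof -
  have "adj (psqrt x * c) * (psqrt x * c) = adj c * x * c"
    using psqrt(2)[OF assms(1)] selfadj_psqrt[OF assms(1)] by (simp add: adj_simps selfadj_def mult.assoc[symmetric])
       (simp add: mult.assoc)
  hence "psqrt x * c = 0" using assms(2) cstar_identity[of "psqrt x * c"] by simp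
  thus ?thesis using psqrt(2)[OF assms(1)] by (metis mult.assoc mult_zero_right)
qed

subsection \<open>The order\<close>

lemma cle_refl [simp]: "a \<sqsubseteq> (a::'a::cstar_algebra)"
  by (simp add: cle_def)

lemma cle_0_iff: "0 \<sqsubseteq> (a::'a::cstar_algebra) \<longleftrightarrow> positive a"
  by (simp add: cle_def)

lemma cle_trans [trans]: "a \<sqsubseteq> b \<Longrightarrow> b \<sqsubseteq> c \<Longrightarrow> a \<sqsubseteq> (c::'a::cstar_algebra)"
  using positive_add[of "b - a" "c - b"] by (simp add: cle_def)

lemma cle_antisym: "a \<sqsubseteq> b \<Longrightarrow> b \<sqsubseteq> a \<Longrightarrow> a = (b::'a::cstar_algebra)"
  using ncone_antisym[of "b - a"] by (simp add: cle_def positive_iff_ncone)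

lemma cle_add: "a \<sqsubseteq> b \<Longrightarrow> c \<sqsubseteq> d \<Longrightarrow> a + c \<sqsubseteq> b + (d::'a::cstar_algebra)"
  using positive_add[of "b - a" "d - c"] by (simp add: cle_def algebra_simps)

lemma cle_add_cancel [simp]: "a + c \<sqsubseteq> b + c \<longleftrightarrow> a \<sqsubseteq> b" "c + a \<sqsubseteq> c + b \<longleftrightarrow> a \<sqsubseteq> b"
  "a - c \<sqsubseteq> b - c \<longleftrightarrow> a \<sqsubseteq> b" "c - a \<sqsubseteq> c - b \<longleftrightarrow> b \<sqsubseteq> a" for a :: "'a::cstar_algebra"
  by (simp_all add: cle_def algebra_simps)

lemma cle_minus_cancel [simp]: "- a \<sqsubseteq> - b \<longleftrightarrow> b \<sqsubseteq> (a::'a::cstar_algebra)"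
  by (simp add: cle_def)

lemma cle_scaleR: "a \<sqsubseteq> b \<Longrightarrow> r \<ge> 0 \<Longrightarrow> r *\<^sub>R a \<sqsubseteq> r *\<^sub>R (b::'a::cstar_algebra)"
  using positive_scaleR[of "b - a" r] by (simp add: cle_def scaleR_diff_right)

lemma cle_scaleR_cancel [simp]: "r > 0 \<Longrightarrow> r *\<^sub>R a \<sqsubseteq> r *\<^sub>R b \<longleftrightarrow> a \<sqsubseteq> (b::'a::cstar_algebra)"
  using cle_scaleR[of a b r] cle_scaleR[of "r *\<^sub>R a" "r *\<^sub>R b" "1/r"] by auto

lemma cle_scaleR_left: "positive a \<Longrightarrow> r \<le> s \<Longrightarrow> r *\<^sub>R a \<sqsubseteq> s *\<^sub>R (a::'a::cstar_algebra)"
  using positive_scaleR[of a "s - r"] by (simp add: cle_def scaleR_diff_left)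

lemma cle_conj: "a \<sqsubseteq> b \<Longrightarrow> adj c * a * c \<sqsubseteq> adj c * b * (c::'a::cstar_algebra)"
  using positive_conj[of "b - a" c] by (simp add: cle_def algebra_simps)

lemma cle_conj': "a \<sqsubseteq> b \<Longrightarrow> selfadj c \<Longrightarrow> c * a * c \<sqsubseteq> c * b * (c::'a::cstar_algebra)"
  using cle_conj[of a b c] by (simp add: selfadj_def)

lemma cle_of_real [simp]: "of_real r \<sqsubseteq> (of_real s :: 'a::cstar_algebra) \<longleftrightarrow> r \<le> s"
  using positive_of_real[of "s - r", where 'a='a] by (simp add: cle_def del: positive_of_real)

lemma positive_mono: "positive a \<Longrightarrow> a \<sqsubseteq> b \<Longrightarrow> positive (b::'a::cstar_algebra)"
  using cle_trans cle_0_iff by blast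

lemma cle_selfadj: "a \<sqsubseteq> b \<Longrightarrow> selfadj a \<Longrightarrow> selfadj (b::'a::cstar_algebra)"
  using selfadj_add[of a "b - a"] positive_selfadj[of "b - a"] by (simp add: cle_def)

lemma cle_selfadj': "a \<sqsubseteq> b \<Longrightarrow> selfadj b \<Longrightarrow> selfadj (a::'a::cstar_algebra)"
  using selfadj_diff[of b "b - a"] positive_selfadj[of "b - a"] by (simp add: cle_def)

lemma cle_norm: "selfadj a \<Longrightarrow> norm a \<le> r \<Longrightarrow> a \<sqsubseteq> of_real r" for a :: "'a::cstar_algebra"
proof -
  assume a: "selfadj a" "norm a \<le> r"
  hence "r \<ge> 0" using norm_ge_zero[of a] by linarith
  hence "ncone (of_real r - a)"
    using a by (auto simp: ncone_def intro!: exI[of _ r] selfadj_diff)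
  thus ?thesis by (simp add: cle_def positive_iff_ncone)
qed

lemma cle_norm': "selfadj a \<Longrightarrow> norm a \<le> r \<Longrightarrow> - of_real r \<sqsubseteq> a" for a :: "'a::cstar_algebra"
  using cle_norm[of "- a" r] cle_minus_cancel[of a "- of_real r"] by (simp add: selfadj_minus)

lemma norm_le_of_cle: "positive a \<Longrightarrow> a \<sqsubseteq> of_real r \<Longrightarrow> norm a \<le> r" for a :: "'a::cstar_algebra"
  using ncone_norm_le[of a r] by (simp add: cle_def positive_iff_ncone)

text \<open>\<open>(r - a) (r + a)\<close> is a product of commuting positive elements, which bounds
  \<open>a * a\<close> by the square of \<open>r\<close>.\<close>

lemma norm_le_of_cle_selfadj:
  fixes a :: "'a::cstar_algebra"
  assumes "- of_real r \<sqsubseteq> a" "a \<sqsubseteq> of_real r" shows "norm a \<le> r"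
proof -
  have sa: "selfadj a" using cle_selfadj'[OF assms(2)] by simp
  have "of_real (- r) \<sqsubseteq> (of_real r :: 'a)" using cle_trans[OF assms] by simp
  hence r: "r \<ge> 0" by (simp only: cle_of_real)
  have "(of_real r - a) * (of_real r + a) = (of_real r + a) * (of_real r - a)"
    by (simp add: algebra_simps of_real_def)
  hence "positive ((of_real r - a) * (of_real r + a))"
    using assms by (intro positive_mult) (simp_all add: cle_def add.commute)
  moreover have "(of_real r - a) * (of_real r + a) = of_real (r\<^sup>2) - a * a"
    by (simp add: algebra_simps power2_eq_square of_real_def)
  ultimately have "norm (a * a) \<le> r\<^sup>2"
    using norm_le_of_cle[OF positive_square[OF sa], of "r\<^sup>2"] by (simp add: cle_def)
  thus ?thesis using norm_selfadj_square[OF sa] r power2_le_imp_le by metis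
qed

lemma selfadj_positive_shift: "selfadj x \<Longrightarrow> positive (x + of_real (norm x))" for x :: "'a::cstar_algebra"
  using cle_norm'[of x "norm x"] by (simp add: cle_def)

lemma eq_0_of_cle_small:
  fixes d :: "'a::cstar_algebra"
  assumes "\<And>e. e > 0 \<Longrightarrow> - of_real e \<sqsubseteq> d \<and> d \<sqsubseteq> of_real e"
  shows "d = 0"
proof -
  have "norm d \<le> 0 + e" if "e > 0" for e using norm_le_of_cle_selfadj[of e d] assms[OF that] by simp
  hence "norm d \<le> 0" by (rule field_le_epsilon)
  thus ?thesis by simp
qed

subsection \<open>Positive invertible elements\<close>

text \<open>From an invertible \<open>a\<close>, conjugating
  \<open>cinv a \<sqsubseteq> of_real r\<close> by the root of \<open>a\<close> gives
  \<open>1 \<sqsubseteq> r a\<close>. In the form of a scalar lower bound, upward closure is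
  immediate.\<close>

lemma PINV_iff: "a \<in> PINV \<longleftrightarrow> (\<exists>d>0. of_real d \<sqsubseteq> (a::'a::cstar_algebra))"
proof
  assume "\<exists>d>0. of_real d \<sqsubseteq> a"
  then obtain d where d: "d > 0" "of_real d \<sqsubseteq> a" by blast
  have "positive (a - of_real d)" using d by (simp add: cle_def)
  hence "invertible_el (of_real d + (a - of_real d))" using d positive_iff_invertible by blast
  moreover have "positive a" using positive_mono[OF _ d(2)] d(1) by simp
  ultimately show "a \<in> PINV" by (simp add: PINV_def)
next
  assume "a \<in> PINV"
  hence a: "positive a" "invertible_el a" by (auto simp: PINV_def)
  have sc: "selfadj (cinv a)" using a selfadj_cinv positive_selfadj by blast
  define r where "r = norm (cinv a) + 1"
  have r: "r > 0" by (simp add: r_def add_nonneg_pos)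
  define y where "y = psqrt a"
  note y = psqrt[OF a(1), folded y_def]
  have "cinv a * y = y * cinv a" by (rule y(3)) (simp add: cinv[OF a(2)])
  hence "y * cinv a * y = y * y * cinv a" by (metis mult.assoc)
  hence e1: "y * cinv a * y = 1" using y(2) cinv[OF a(2)] by simp
  have "y * cinv a * y \<sqsubseteq> y * of_real r * y"
    by (rule cle_conj'[OF cle_norm]) (use sc positive_selfadj[OF y(1)] in \<open>auto simp: r_def\<close>)
  also have "y * of_real r * y = r *\<^sub>R a" using y(2) by (simp add: of_real_def)
  finally have "(1/r) *\<^sub>R 1 \<sqsubseteq> (1/r) *\<^sub>R (r *\<^sub>R a)" unfolding e1 using r by (intro cle_scaleR) auto
  thus "\<exists>d>0. of_real d \<sqsubseteq> a" using r by (intro exI[of _ "1/r"]) (simp add: of_real_def)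
qed

lemma PINV_mono: "a \<in> PINV \<Longrightarrow> a \<sqsubseteq> b \<Longrightarrow> b \<in> PINV" for a :: "'a::cstar_algebra"
  unfolding PINV_iff using cle_trans by blast

lemma PINV_positive: "a \<in> PINV \<Longrightarrow> positive a" and PINV_invertible: "a \<in> PINV \<Longrightarrow> invertible_el a"
  and PINV_selfadj: "a \<in> PINV \<Longrightarrow> selfadj a"
  by (auto simp: PINV_def positive_selfadj)

lemma PINV_of_real: "r > 0 \<Longrightarrow> of_real r \<in> (PINV :: 'a::cstar_algebra set)"
  unfolding PINV_iff using cle_refl by blast

lemma PINV_1 [simp]: "1 \<in> (PINV :: 'a::cstar_algebra set)"
  using PINV_of_real[of 1, where 'a='a] by simp

lemma PINV_add: "a \<in> PINV \<Longrightarrow> positive b \<Longrightarrow> a + b \<in> PINV" for a :: "'a::cstar_algebra"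
  using PINV_mono[of a "a + b"] by (simp add: cle_def)

lemma PINV_scaleR: "a \<in> PINV \<Longrightarrow> r > 0 \<Longrightarrow> r *\<^sub>R a \<in> PINV" for a :: "'a::cstar_algebra"
  by (simp add: PINV_def positive_scaleR invertible_scaleR)

lemma PINV_cinv: "a \<in> PINV \<Longrightarrow> cinv a \<in> PINV" for a :: "'a::cstar_algebra"
  by (simp add: PINV_def positive_iff_ncone ncone_cinv invertible_cinv)

lemma PINV_conj:
  fixes a :: "'a::cstar_algebra"
  assumes "a \<in> PINV" "c \<in> PINV" shows "c * a * c \<in> PINV"
  using assms by (simp add: PINV_def positive_conj' positive_selfadj invertible_mult)

lemma PINV_psqrt:
  fixes a :: "'a::cstar_algebra"
  assumes "a \<in> PINV" shows "psqrt a \<in> PINV"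
proof -
  define y where "y = psqrt a"
  note y = psqrt[OF PINV_positive[OF assms], folded y_def]
  have "cinv a * y = y * cinv a" by (rule y(3)) (simp add: cinv[OF PINV_invertible[OF assms]])
  hence "y * (y * cinv a) = 1" "(y * cinv a) * y = 1"
    using y(2) cinv[OF PINV_invertible[OF assms]] by (metis mult.assoc)+
  thus ?thesis using y(1) by (auto simp: PINV_def invertible_el_def y_def)
qed

lemma cinv_psqrt_conj:
  fixes a :: "'a::cstar_algebra"
  assumes "a \<in> PINV" shows "cinv (psqrt a) * a * cinv (psqrt a) = 1"
    and "cinv (psqrt a) * cinv (psqrt a) = cinv a"
proof -
  define y where "y = psqrt a"
  have y: "y * y = a" "invertible_el y"
    using psqrt(2)[OF PINV_positive[OF assms]] PINV_invertible[OF PINV_psqrt[OF assms]] by (auto simp: y_def)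
  have "cinv y * a * cinv y = (cinv y * y) * (y * cinv y)" by (simp add: y(1)[symmetric] mult.assoc)
  thus "cinv (psqrt a) * a * cinv (psqrt a) = 1" using cinv[OF y(2)] by (simp add: y_def)
  show "cinv (psqrt a) * cinv (psqrt a) = cinv a"
    using invertible_mult(2)[OF y(2) y(2)] y(1) by (simp add: y_def)
qed

lemma cinv_le_one:
  fixes k :: "'a::cstar_algebra"
  assumes "1 \<sqsubseteq> k" shows "cinv k \<sqsubseteq> 1"
proof -
  have k: "k \<in> PINV" using PINV_mono[OF _ assms] by simp
  have "cinv (psqrt k) * 1 * cinv (psqrt k) \<sqsubseteq> cinv (psqrt k) * k * cinv (psqrt k)"
    by (rule cle_conj'[OF assms]) (rule PINV_selfadj[OF PINV_cinv[OF PINV_psqrt[OF k]]])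
  thus ?thesis using cinv_psqrt_conj[OF k] by simp
qed

text \<open>Conjugation by \<open>cinv (psqrt a)\<close> turns \<open>a\<close> into 1 and reduces
  the claim to \<open>cinv_le_one\<close>.\<close>

lemma cinv_antimono:
  fixes a b :: "'a::cstar_algebra"
  assumes a: "a \<in> PINV" and ab: "a \<sqsubseteq> b"
  shows "cinv b \<sqsubseteq> cinv a"
proof -
  have b: "b \<in> PINV" by (rule PINV_mono[OF a ab])
  define c where "c = cinv (psqrt a)"
  have cP: "c \<in> PINV" unfolding c_def by (intro PINV_cinv PINV_psqrt a)
  note ci = PINV_invertible[OF cP]
  have "c * a * c \<sqsubseteq> c * b * c" by (rule cle_conj'[OF ab PINV_selfadj[OF cP]])
  hence "cinv (c * b * c) \<sqsubseteq> 1" using cinv_psqrt_conj(1)[OF a] by (intro cinv_le_one) (simp add: c_def)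
  hence "cinv c * (cinv b * cinv c) \<sqsubseteq> 1"
    using invertible_mult[OF ci] invertible_mult(2)[OF invertible_mult(1)[OF ci PINV_invertible[OF b]] ci] PINV_invertible[OF b]
    by simp
  from cle_conj'[OF this PINV_selfadj[OF cP]]
  have "(c * cinv c) * cinv b * (cinv c * c) \<sqsubseteq> c * c" by (simp add: mult.assoc)
  thus ?thesis using cinv[OF ci] cinv_psqrt_conj(2)[OF a] by (simp add: c_def)
qed

lemma cinv_cle_iff:
  fixes a b :: "'a::cstar_algebra"
  assumes "a \<in> PINV" "b \<in> PINV"
  shows "cinv b \<sqsubseteq> cinv a \<longleftrightarrow> a \<sqsubseteq> b"
  using cinv_antimono[of a b] cinv_antimono[of "cinv b" "cinv a"] assms
  by (auto simp: PINV_cinv cinv_cinv PINV_invertible)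

subsection \<open>Projections\<close>

lemma projection_selfadj: "projection p \<Longrightarrow> selfadj p"
  and projection_idem: "projection p \<Longrightarrow> p * p = p"
  by (auto simp: projection_def selfadj_def)

lemma projection_idem_left: "projection p \<Longrightarrow> p * (p * x) = p * x" for p :: "'a::cstar_algebra"
  by (simp add: projection_idem flip: mult.assoc)

lemma projection_compl: "projection p \<Longrightarrow> projection (1 - p)" for p :: "'a::cstar_algebra"
  by (simp add: projection_def adj_simps algebra_simps)

lemma projection_0_1 [simp]: "projection (0 :: 'a::cstar_algebra)" "projection (1 :: 'a::cstar_algebra)"
  by (auto simp: projection_def)

lemma projection_positive: "projection p \<Longrightarrow> positive p" for p :: "'a::cstar_algebra"
  using positive_square[OF projection_selfadj, of p] by (simp add: projection_idem)

lemma projection_le_one: "projection p \<Longrightarrow> p \<sqsubseteq> 1" for p :: "'a::cstar_algebra"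
  using projection_positive[OF projection_compl] by (simp add: cle_def)

text \<open>The compression of \<open>x\<close> to \<open>1 - p\<close> lies between 0 and the
  compression of \<open>p\<close>, which is 0; a positive element with a vanishing corner is
  annihilated there.\<close>

lemma le_projection:
  fixes x p :: "'a::cstar_algebra"
  assumes "positive x" "x \<sqsubseteq> p" "projection p"
  shows "p * x = x" "x * p = x"
proof -
  have sc: "selfadj (1 - p)" using projection_selfadj[OF projection_compl[OF assms(3)]] .
  have "(1 - p) * x * (1 - p) \<sqsubseteq> (1 - p) * p * (1 - p)" by (rule cle_conj'[OF assms(2) sc])
  also have "\<dots> = 0" using projection_idem[OF assms(3)] by (simp add: algebra_simps)
  finally have "(1 - p) * x * (1 - p) = 0"
    using positive_conj'[OF assms(1) sc] by (intro cle_antisym) (simp_all add: cle_0_iff)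
  hence "x * (1 - p) = 0" using positive_zero_corner[OF assms(1), of "1 - p"] sc by (simp add: selfadj_def)
  thus xp: "x * p = x" by (simp add: algebra_simps)
  show "p * x = x"
    using arg_cong[OF xp, of adj] positive_selfadj[OF assms(1)] projection_selfadj[OF assms(3)]
    by (simp add: adj_simps selfadj_def)
qed

lemma le_scaleR_projection:
  fixes x p :: "'a::cstar_algebra"
  assumes "x \<sqsubseteq> of_real t" "p * x = x" "x * p = x" "projection p"
  shows "x \<sqsubseteq> t *\<^sub>R p"
  using cle_conj'[OF assms(1) projection_selfadj[OF assms(4)]] assms(2,3) projection_idem[OF assms(4)]
  by (simp add: of_real_def)

lemma projection_le_iff:
  fixes p q :: "'a::cstar_algebra"
  assumes "projection p" "projection q"
  shows "p \<sqsubseteq> q \<longleftrightarrow> q * p = p"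
proof
  assume "p \<sqsubseteq> q"
  thus "q * p = p" using le_projection(1)[OF projection_positive] assms by blast
next
  assume qp: "q * p = p"
  have pq: "p * q = p" using arg_cong[OF qp, of adj] assms by (simp add: adj_simps projection_def)
  show "p \<sqsubseteq> q"
    using le_scaleR_projection[of p 1 q] projection_le_one[OF assms(1)] qp pq assms by simp
qed

section \<open>Projections in AW*-algebras\<close>

lemma AW_star_annihilator:
  fixes b :: "'a::cstar_algebra"
  assumes "AW_star TYPE('a)"
  shows "\<exists>p. projection p \<and> b * p = 0 \<and> (\<forall>x. b * x = 0 \<longrightarrow> p * x = x)"
proof -
  obtain p where p: "projection p" "{a. \<forall>c\<in>{b}. c * a = 0} = {p * x | x. True}"
    using assms[unfolded AW_star_def, rule_format, of "{b}"] by auto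
  have iff: "b * a = 0 \<longleftrightarrow> (\<exists>x. a = p * x)" for a
    using set_eq_iff[THEN iffD1, OF p(2), rule_format, of a] by simp
  have "b * (p * 1) = 0" using iff by blast
  moreover have "p * x = x" if "b * x = 0" for x
    using that projection_idem_left[OF p(1)] iff by force
  ultimately show ?thesis using p(1) by auto
qed

text \<open>The annihilator projection \<open>p\<close> of the positive part \<open>u\<close> of
  \<open>a - r\<close> contains the negative part, and \<open>1 - p\<close> is the support of
  \<open>u\<close>. It serves as the spectral projection of \<open>a\<close> for the values above
  \<open>r\<close>.\<close>

lemma spectral_projection:
  fixes a :: "'a::cstar_algebra"
  assumes AW: "AW_star TYPE('a)" and sa: "selfadj a"
  shows "\<exists>e. projection e \<and> of_real r * e \<sqsubseteq> a * e \<and> a * (1 - e) \<sqsubseteq> of_real r * (1 - e)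
    \<and> (\<forall>c. c * a = a * c \<longrightarrow> c * e = e * c)"
proof -
  define b where "b = a - of_real r"
  have sb: "selfadj b" unfolding b_def by (intro selfadj_intros sa) simp
  obtain u v where uv: "ncone u" "ncone v" "b = u - v" "u * v = 0" "v * u = 0"
    and cm: "\<And>c. c * b = b * c \<Longrightarrow> c * u = u * c"
    using selfadj_parts_ncone[OF sb] by blast
  obtain p where p: "projection p" "u * p = 0" "\<And>x. u * x = 0 \<Longrightarrow> p * x = x"
    using AW_star_annihilator[OF AW] by metis
  have pv: "p * v = v" using p(3) uv(4) by blast
  have vp: "v * p = v"
    using arg_cong[OF pv, of adj] ncone_selfadj[OF uv(2)] p(1) by (simp add: adj_simps selfadj_def projection_def)
  have "b * (1 - p) = u" "b * p = - v" by (simp_all add: uv(3) p(2) vp left_diff_distrib right_diff_distrib)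
  hence "positive (b * (1 - p))" "positive (- (b * p))" using uv by (simp_all add: positive_iff_ncone)
  hence "of_real r * (1 - p) \<sqsubseteq> a * (1 - p)" "a * p \<sqsubseteq> of_real r * p"
    by (simp_all add: cle_def b_def left_diff_distrib)
  moreover have "c * (1 - p) = (1 - p) * c" if c: "c * a = a * c" for c
  proof -
    \<comment> \<open>An element commuting with \<open>a\<close> maps the annihilator of
      \<open>u\<close> into itself; its adjoint does the same, so both commute with
      \<open>p\<close>.\<close>
    have pcp: "p * c * p = c * p" if c: "c * a = a * c" for c
    proof -
      have "c * b = b * c" using c by (simp add: b_def algebra_simps of_real_def)
      hence "u * (c * p) = 0" using cm[of c] p(2) by (metis mult.assoc mult_zero_right)
      thus ?thesis using p(3) by (simp add: mult.assoc)
    qed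
    have "adj c * a = a * adj c" using arg_cong[OF c, of adj] sa by (simp add: adj_simps selfadj_def)
    from arg_cong[OF pcp[OF this], of adj] have "p * c * p = p * c"
      using p(1) by (simp add: adj_simps projection_def mult.assoc)
    thus ?thesis using pcp[OF c] by (simp add: algebra_simps)
  qed
  ultimately show ?thesis using projection_compl[OF p(1)] by (intro exI[of _ "1 - p"]) auto
qed

text \<open>Cutting at half the norm cannot give \<open>e = 0\<close>, since then \<open>a\<close>
  would be at most \<open>norm a / 2\<close>. In the arguments below this replaces a nonzero
  positive element by a nonzero projection.\<close>

lemma positive_dominates_projection:
  fixes a :: "'a::cstar_algebra"
  assumes AW: "AW_star TYPE('a)" and a: "positive a" "a \<noteq> 0"
  shows "\<exists>e d. projection e \<and> e \<noteq> 0 \<and> d > 0 \<and> d *\<^sub>R e \<sqsubseteq> a * e \<and> d *\<^sub>R e \<sqsubseteq> a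
    \<and> (\<forall>c. c * a = a * c \<longrightarrow> c * e = e * c)"
proof -
  define d where "d = norm a / 2"
  have d: "d > 0" using a(2) by (simp add: d_def)
  obtain e where e: "projection e" "of_real d * e \<sqsubseteq> a * e" "a * (1 - e) \<sqsubseteq> of_real d * (1 - e)"
    and ec: "\<And>c. c * a = a * c \<Longrightarrow> c * e = e * c"
    using spectral_projection[OF AW positive_selfadj[OF a(1)]] by blast
  have "e \<noteq> 0"
  proof
    assume "e = 0"
    hence "norm a \<le> d" using norm_le_of_cle[OF a(1)] e(3) by simp
    thus False using d by (simp add: d_def)
  qed
  moreover have "a * (1 - e) = (1 - e) * a" using ec[of a] by (simp add: algebra_simps)
  hence "positive (a * (1 - e))"
    by (intro positive_mult a projection_positive projection_compl e)
  hence "a * e \<sqsubseteq> a" by (simp add: cle_def algebra_simps)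
  ultimately show ?thesis using e d ec cle_trans by (metis scaleR_conv_of_real)
qed

text \<open>Polar decomposition of a nonzero element of \<open>p A (1 - p)\<close> yields a 2x2 matrix unit system in which
  \<open>e\<close> is a diagonal unit; \<open>q\<close> is the rank one projection at 45 degrees.\<close>

lemma halving_projection:
  fixes p x :: "'a::cstar_algebra"
  assumes AW: "AW_star TYPE('a)" and p: "projection p" and nz: "p * x * (1 - p) \<noteq> 0"
  shows "\<exists>e q. projection e \<and> e \<noteq> 0 \<and> e \<sqsubseteq> p \<and> projection q \<and> e * q * e = (1/2) *\<^sub>R e"
proof -
  define y where "y = p * x * (1 - p)"
  have pp: "p * p = p" by (rule projection_idem[OF p])
  have py: "p * y = y" and yp: "y * p = 0" using pp by (simp_all add: y_def right_diff_distrib left_diff_distrib mult.assoc projection_idem_left[OF p])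
  have ayp: "adj y * p = adj y" using arg_cong[OF py, of adj] p by (simp add: adj_simps projection_def)
  define a where "a = y * adj y"
  have pa: "positive a" using positive_adj_mult[of "adj y"] by (simp add: a_def adj_simps)
  have "norm a = (norm y)\<^sup>2" using cstar_identity[of "adj y"] by (simp add: a_def adj_adj)
  hence "a \<noteq> 0" using nz by (auto simp: y_def)
  then obtain e d where e: "projection e" "e \<noteq> 0" "d > 0" "d *\<^sub>R e \<sqsubseteq> a * e" "d *\<^sub>R e \<sqsubseteq> a"
    and ec: "\<And>c. c * a = a * c \<Longrightarrow> c * e = e * c"
    using positive_dominates_projection[OF AW pa] by metis
  have ee: "e * e = e" and ae: "adj e = e" using e(1) by (auto simp: projection_def)
  have "p * a = a" "a * p = a" using py ayp by (simp_all add: a_def mult.assoc flip: mult.assoc[of p])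
  have ea: "a * e = e * a" by (rule ec) simp
  have "(1 - p) * (d *\<^sub>R e) * (1 - p) \<sqsubseteq> (1 - p) * a * (1 - p)"
    by (rule cle_conj'[OF e(5) projection_selfadj[OF projection_compl[OF p]]])
  moreover have "(1 - p) * a * (1 - p) = 0" using \<open>a * p = a\<close> by (simp add: right_diff_distrib mult.assoc)
  ultimately have "d *\<^sub>R ((1 - p) * e * (1 - p)) \<sqsubseteq> d *\<^sub>R 0" by simp
  hence "(1 - p) * e * (1 - p) \<sqsubseteq> 0" using e(3) by (simp only: cle_scaleR_cancel)
  hence "adj (1 - p) * e * (1 - p) = 0"
    using positive_conj[OF projection_positive[OF e(1)], of "1 - p"] p
    by (intro cle_antisym) (auto simp: cle_0_iff projection_def adj_simps)
  hence "e * (1 - p) = 0" by (rule positive_zero_corner[OF projection_positive[OF e(1)]])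
  hence ep: "e * p = e" by (simp add: algebra_simps)
  have pe: "p * e = e" using arg_cong[OF ep, of adj] ae p by (simp add: adj_simps projection_def)
  \<comment> \<open>Filling up with \<open>1 - e\<close> makes \<open>a * e\<close> invertible in
    the whole algebra, so its inverse root can be formed without passing to the corner of
    \<open>e\<close>.\<close>
  define h where "h = a * e + (1 - e)"
  define m where "m = min d 1"
  have m: "m > 0" "m \<le> d" "m \<le> 1" using e(3) by (auto simp: m_def)
  have "m *\<^sub>R e \<sqsubseteq> a * e" using cle_scaleR_left[OF projection_positive[OF e(1)] m(2)] e(4) cle_trans by blast
  moreover have "m *\<^sub>R (1 - e) \<sqsubseteq> 1 - e"
    using cle_scaleR_left[OF projection_positive[OF projection_compl[OF e(1)]] m(3)] by simp
  ultimately have "m *\<^sub>R e + m *\<^sub>R (1 - e) \<sqsubseteq> h" unfolding h_def by (rule cle_add)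
  hence "of_real m \<sqsubseteq> h" by (simp add: of_real_def algebra_simps)
  hence hP: "h \<in> PINV" using m(1) PINV_iff by blast
  have eh: "e * h = h * e" using ea ee by (simp add: h_def algebra_simps)
  have he: "h * e = e * a * e" using ea ee by (simp add: h_def algebra_simps)
  define r where "r = cinv (psqrt h)"
  have rP: "r \<in> PINV" unfolding r_def by (intro PINV_cinv PINV_psqrt hP)
  have er: "r * e = e * r" unfolding r_def
    by (rule cinv_commute[OF PINV_invertible[OF PINV_psqrt[OF hP]]])
       (use psqrt(3)[OF PINV_positive[OF hP] eh] in simp)
  have ar: "adj r = r" using PINV_selfadj[OF rP] by (simp add: selfadj_def)
  have rhr: "r * h * r = 1" using cinv_psqrt_conj(1)[OF hP] by (simp add: r_def)
  \<comment> \<open>The partial isometry in the polar decomposition of \<open>e * y\<close>: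
    \<open>v * adj v = e\<close>, and \<open>v * v = 0\<close> because \<open>y * p = 0\<close>
    while \<open>e\<close> lies under \<open>p\<close>.\<close>
  define v where "v = r * e * y"
  define f where "f = adj v * v"
  have av: "adj v = adj y * e * r" by (simp add: v_def adj_simps ar ae mult.assoc)
  have "v * adj v = r * (e * (y * adj y) * e) * r" unfolding av by (simp add: v_def mult.assoc)
  also have "\<dots> = r * (h * e) * r" using he by (simp add: a_def)
  also have "\<dots> = e * (r * h * r)" using er eh by (metis mult.assoc)
  finally have vv: "v * adj v = e" using rhr by simp
  have ev: "e * v = v" using er ee by (metis v_def mult.assoc)
  have ve: "v * e = 0" using yp pe by (metis v_def mult.assoc mult_zero_right mult_zero_left)
  have v2: "v * v = 0" using ev ve by (metis mult.assoc mult_zero_left)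
  have ave: "adj v * e = adj v" and eav: "e * adj v = 0"
    using arg_cong[OF ev, of adj] arg_cong[OF ve, of adj] by (simp_all add: adj_simps ae)
  have av2: "adj v * adj v = 0" using arg_cong[OF v2, of adj] by (simp add: adj_simps)
  have t1: "e * f = 0" "f * e = 0"
    using eav ve by (metis f_def mult.assoc mult_zero_left, metis f_def mult.assoc mult_zero_right)
  have t2: "v * f = v" "f * v = 0"
    using vv ev v2 by (metis f_def mult.assoc, metis f_def mult.assoc mult_zero_right)
  have t3: "adj v * f = 0" "f * adj v = adj v"
    using vv ave av2 by (metis f_def mult.assoc mult_zero_left, metis f_def mult.assoc)
  have t4: "f * f = f" unfolding f_def using vv ev by (metis mult.assoc)
  have af: "adj f = f" by (simp add: f_def adj_simps)
  define q where "q = (1/2) *\<^sub>R (e + v + adj v + f)"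
  have "(e + v + adj v + f) * (e + v + adj v + f) = 2 *\<^sub>R (e + v + adj v + f)"
    using ee ev eav t1 ve v2 vv t2 ave av2 t3 t4
    by (simp add: distrib_left distrib_right f_def[symmetric] scaleR_2)
  hence "q * q = q" by (simp add: q_def)
  moreover have "adj q = q" by (simp add: q_def adj_simps ae af ac_simps)
  ultimately have "projection q" by (simp add: projection_def)
  moreover have "e * q * e = (1/2) *\<^sub>R e"
    using ee ev eav t1 ve by (simp add: q_def distrib_left distrib_right mult.assoc)
  moreover have "e \<sqsubseteq> p" using projection_le_iff[OF e(1) p] pe by simp
  ultimately show ?thesis using e by blast
qed

text \<open>Shifting \<open>x\<close> to a positive element and cutting by \<open>e\<close> gives
  \<open>X\<close>. Its spectral projection for the top of the spectrum, within
  \<open>\<epsilon>\<close> of \<open>norm X\<close>, is nonzero, and there \<open>x\<close> is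
  \<open>\<epsilon>\<close>-close to the scalar \<open>norm X - norm x\<close>.\<close>

lemma near_scalar_projection:
  fixes x e :: "'a::cstar_algebra"
  assumes AW: "AW_star TYPE('a)" and e: "projection e" "e \<noteq> 0"
    and x: "selfadj x" "x * e = e * x" and eps: "\<epsilon> > 0"
  shows "\<exists>f s. projection f \<and> f \<noteq> 0 \<and> f \<sqsubseteq> e \<and> norm ((x - of_real s) * f) \<le> \<epsilon>"
proof -
  define X where "X = (x + of_real (norm x)) * e"
  have ee: "e * e = e" by (rule projection_idem[OF e(1)])
  have "positive (x + of_real (norm x))" by (rule selfadj_positive_shift[OF x(1)])
  hence pX: "positive X" unfolding X_def
    by (rule positive_mult[OF _ projection_positive[OF e(1)]]) (use x(2) in \<open>simp add: algebra_simps of_real_def\<close>)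
  have "(x + of_real (norm x)) * e = e * (x + of_real (norm x))"
    using x(2) by (simp add: algebra_simps of_real_def)
  hence eX: "e * X = X" and Xe: "X * e = X"
    using ee by (metis X_def mult.assoc)+
  show ?thesis
  proof (cases "X = 0")
    case True
    have "norm ((x - of_real (- norm x)) * e) \<le> \<epsilon>" using True eps by (simp add: X_def)
    thus ?thesis using e cle_refl by blast
  next
    case False
    define N where "N = norm X"
    \<comment> \<open>The minimum with \<open>N\<close> keeps the cut \<open>N - d\<close>
      nonnegative.\<close>
    define d where "d = min \<epsilon> N"
    have N: "N > 0" "d > 0" "d \<le> N" "d \<le> \<epsilon>" using False eps by (auto simp: N_def d_def)
    obtain g where g: "projection g" "of_real (N - d) * g \<sqsubseteq> X * g" "X * (1 - g) \<sqsubseteq> of_real (N - d) * (1 - g)"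
      and gc: "\<And>c. c * X = X * c \<Longrightarrow> c * g = g * c"
      using spectral_projection[OF AW positive_selfadj[OF pX]] by blast
    have eg: "e * g = g * e" by (rule gc) (simp add: eX Xe)
    have Xg: "X * g = g * X" by (rule gc) simp
    define f where "f = g * e"
    have gg: "g * g = g" by (rule projection_idem[OF g(1)])
    have pf: "projection f" using eg e(1) g(1) unfolding projection_def f_def
      by (simp add: adj_simps) (metis mult.assoc)
    have fe: "e * f = f" using eg ee by (metis f_def mult.assoc)
    have "f \<sqsubseteq> e" using projection_le_iff[OF pf e(1)] fe by simp
    moreover have "f \<noteq> 0"
    proof
      assume f0: "f = 0"
      have "X * (1 - g) * e = X" using f0 Xe by (simp add: f_def algebra_simps mult.assoc)
      moreover have "(1 - g) * e = e" using f0 by (simp add: f_def algebra_simps)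
      moreover have "e * (X * (1 - g)) * e \<sqsubseteq> e * (of_real (N - d) * (1 - g)) * e"
        by (rule cle_conj'[OF g(3) projection_selfadj[OF e(1)]])
      ultimately have "X \<sqsubseteq> (N - d) *\<^sub>R e"
        using eX ee by (simp add: mult.assoc of_real_def)
      also have "(N - d) *\<^sub>R e \<sqsubseteq> (N - d) *\<^sub>R 1"
        by (rule cle_scaleR[OF projection_le_one[OF e(1)]]) (use N in simp)
      finally have "norm X \<le> N - d" by (intro norm_le_of_cle[OF pX]) (simp add: of_real_def)
      thus False using N by (simp add: N_def)
    qed
    moreover have "norm ((x - of_real (N - norm x)) * f) \<le> \<epsilon>"
    proof -
      have eq: "(x - of_real (N - norm x)) * f = X * f - N *\<^sub>R f"
        using fe by (simp add: X_def algebra_simps of_real_def)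
      have Xf: "X * f = e * (X * g) * e" using eX by (simp add: f_def flip: mult.assoc)
      have "e * (of_real (N - d) * g) * e \<sqsubseteq> e * (X * g) * e"
        by (rule cle_conj'[OF g(2) projection_selfadj[OF e(1)]])
      moreover have "e * (of_real (N - d) * g) * e = (N - d) *\<^sub>R f"
        using eg ee by (simp add: of_real_def f_def) (metis mult.assoc)
      ultimately have 1: "(N - d) *\<^sub>R f \<sqsubseteq> X * f" unfolding Xf by simp
      have fXf: "X * f = f * X * f"
      proof -
        have "f * X = X * f" using Xg eX Xe by (metis f_def mult.assoc eg)
        thus ?thesis using projection_idem[OF pf] by (metis mult.assoc)
      qed
      have "f * X * f \<sqsubseteq> f * of_real N * f"
        by (rule cle_conj'[OF cle_norm projection_selfadj[OF pf]]) (use pX positive_selfadj in \<open>auto simp: N_def\<close>)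
      hence 2: "X * f \<sqsubseteq> N *\<^sub>R f" using fXf projection_idem[OF pf] by (simp add: of_real_def)
      have df: "d *\<^sub>R f \<sqsubseteq> of_real \<epsilon>"
      proof -
        have "d *\<^sub>R f \<sqsubseteq> d *\<^sub>R 1" by (rule cle_scaleR[OF projection_le_one[OF pf]]) (use N in simp)
        also have "\<dots> = of_real d" by (simp add: of_real_def)
        also have "of_real d \<sqsubseteq> (of_real \<epsilon> :: 'a)" using N by simp
        finally show ?thesis .
      qed
      show ?thesis unfolding eq
      proof (rule norm_le_of_cle_selfadj)
        have "X * f - N *\<^sub>R f \<sqsubseteq> 0" using 2 by (simp add: cle_def)
        also have "0 \<sqsubseteq> (of_real \<epsilon> :: 'a)" using eps by (simp add: cle_0_iff)
        finally show "X * f - N *\<^sub>R f \<sqsubseteq> of_real \<epsilon>" .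
        have "- of_real \<epsilon> \<sqsubseteq> - (d *\<^sub>R f)" using df by simp
        also have "- (d *\<^sub>R f) \<sqsubseteq> X * f - N *\<^sub>R f" using 1 by (simp add: cle_def algebra_simps)
        finally show "- of_real \<epsilon> \<sqsubseteq> X * f - N *\<^sub>R f" .
      qed
    qed
    ultimately show ?thesis using pf by blast
  qed
qed

text \<open>If the commutator \<open>k\<close> does not vanish on \<open>w\<close>, then
  \<open>adj k * k\<close> cut to \<open>w\<close> dominates \<open>d e\<close> for a nonzero
  \<open>e\<close> below \<open>w\<close>. On some smaller \<open>f\<close> the element
  \<open>x\<close> is almost scalar, so \<open>k * f\<close> is small; compressing the lower bound
  to \<open>f\<close> is contradictory.\<close>

lemma commutative_if_projections_central:
  fixes w :: "'a::cstar_algebra"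
  assumes AW: "AW_star TYPE('a)" and w: "projection w"
    and cen: "\<And>p x. projection p \<Longrightarrow> p \<sqsubseteq> w \<Longrightarrow> p * x = x * p"
    and x: "selfadj x" and y: "selfadj y"
  shows "(w * x) * (w * y) = (w * y) * (w * x)"
proof (rule ccontr)
  assume ne: "(w * x) * (w * y) \<noteq> (w * y) * (w * x)"
  have wc: "w * z = z * w" for z by (rule cen[OF w cle_refl])
  have ww: "w * w = w" by (rule projection_idem[OF w])
  define k where "k = x * y - y * x"
  have wst: "(w * s) * (w * t) = w * (s * t)" for s t
  proof -
    have "(w * s) * (w * t) = w * (s * w) * t" by (simp add: mult.assoc)
    also have "\<dots> = w * (w * s) * t" by (simp only: wc[of s])
    finally show ?thesis by (simp add: mult.assoc projection_idem_left[OF w])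
  qed
  have "w * k = (w * x) * (w * y) - (w * y) * (w * x)"
    unfolding k_def right_diff_distrib wst ..
  hence wk: "w * k \<noteq> 0" using ne by simp
  have ak: "adj k = - k" using x y by (simp add: k_def adj_simps selfadj_def)
  define K where "K = w * (adj k * k)"
  have "adj (k * w) * (k * w) = w * ((adj k * k) * w)"
    using w by (simp add: adj_simps projection_def mult.assoc)
  also have "\<dots> = K" unfolding wc[of "adj k * k", symmetric] projection_idem_left[OF w] K_def ..
  finally have "K = adj (k * w) * (k * w)" ..
  hence pK: "positive K" "K \<noteq> 0" using positive_adj_mult[of "k * w"] cstar_identity[of "k * w"] wk wc by auto
  obtain e d where e: "projection e" "e \<noteq> 0" "d > 0" "d *\<^sub>R e \<sqsubseteq> K"
    using positive_dominates_projection[OF AW pK] by metis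
  have "(1 - w) * (d *\<^sub>R e) * (1 - w) \<sqsubseteq> (1 - w) * K * (1 - w)"
    by (rule cle_conj'[OF e(4) projection_selfadj[OF projection_compl[OF w]]])
  moreover have "(1 - w) * K = 0" using ww by (simp add: K_def left_diff_distrib flip: mult.assoc)
  ultimately have "d *\<^sub>R ((1 - w) * e * (1 - w)) \<sqsubseteq> d *\<^sub>R 0" by simp
  hence "(1 - w) * e * (1 - w) \<sqsubseteq> 0" using e(3) by (simp only: cle_scaleR_cancel)
  moreover have "(1 - w) * e * (1 - w) = (1 - w) * e"
    by (simp add: right_diff_distrib left_diff_distrib mult.assoc wc[of e, symmetric] projection_idem_left[OF w])
  moreover have "positive ((1 - w) * e * (1 - w))"
    by (intro positive_conj' projection_positive e(1) projection_selfadj projection_compl w)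
  ultimately have "(1 - w) * e = 0" using cle_antisym cle_0_iff by metis
  hence we: "w * e = e" by (simp add: algebra_simps)
  have ew: "e \<sqsubseteq> w" using projection_le_iff[OF e(1) w] we by simp
  \<comment> \<open>Makes \<open>norm (k * f)\<close> at most two thirds of \<open>sqrt d\<close>;
    the added 1 avoids division by zero when \<open>y = 0\<close>.\<close>
  define \<epsilon> where "\<epsilon> = sqrt d / 3 / (norm y + 1)"
  have eps: "\<epsilon> > 0" unfolding \<epsilon>_def using e(3) by (intro divide_pos_pos) (auto intro: add_nonneg_pos)
  obtain f s where f: "projection f" "f \<noteq> 0" "f \<sqsubseteq> e" "norm ((x - of_real s) * f) \<le> \<epsilon>"
    using near_scalar_projection[OF AW e(1,2) x cen[OF e(1) ew, of x, symmetric] eps] by blast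
  have fw: "f \<sqsubseteq> w" using f(3) ew cle_trans by blast
  have fc: "f * z = z * f" for z by (rule cen[OF f(1) fw])
  have ff: "f * f = f" by (rule projection_idem[OF f(1)])
  have wf: "w * f = f" and ef: "e * f = f"
    using projection_le_iff[OF f(1)] w fw e(1) f(3) by auto
  define x' where "x' = (x - of_real s) * f"
  have kf: "k * f = x' * y - y * x'"
    using fc[of y] by (simp add: k_def x'_def algebra_simps of_real_def)
  have nf: "norm f = 1"
  proof -
    have "norm f = (norm f)\<^sup>2" using norm_selfadj_square[OF projection_selfadj[OF f(1)]] ff by simp
    thus ?thesis using f(2) by (simp add: power2_eq_square)
  qed
  have "norm (k * f) \<le> norm (x' * y) + norm (y * x')" unfolding kf by (rule norm_triangle_ineq4)
  also have "\<dots> \<le> norm x' * norm y + norm y * norm x'" by (intro add_mono norm_mult_ineq)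
  also have "\<dots> = 2 * (norm x' * norm y)" by simp
  also have "\<dots> \<le> 2 * (\<epsilon> * (norm y + 1))"
    using f(4) eps by (intro mult_left_mono mult_mono) (auto simp: x'_def)
  also have "\<dots> = 2 / 3 * sqrt d"
    using norm_ge_zero[of y] by (simp add: \<epsilon>_def add_nonneg_eq_0_iff del: divide_divide_eq_left)
  finally have "(norm (k * f))\<^sup>2 \<le> (2 / 3 * sqrt d)\<^sup>2" by (intro power_mono) auto
  hence small: "(norm (k * f))\<^sup>2 \<le> 4/9 * d" using e(3) by (simp add: power_mult_distrib power_divide)
  have "f * (d *\<^sub>R e) * f \<sqsubseteq> f * K * f"
    by (rule cle_conj'[OF e(4) projection_selfadj[OF f(1)]])
  moreover have "f * (d *\<^sub>R e) * f = d *\<^sub>R f" using ef ff by (simp add: mult.assoc)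
  moreover have "f * w = f" using wf fc[of w] by simp
  hence "f * K * f = f * (adj k * k) * f" by (simp add: K_def flip: mult.assoc)
  hence "f * K * f = adj (k * f) * (k * f)"
    using f(1) by (simp add: adj_simps projection_def mult.assoc)
  ultimately have "d *\<^sub>R f \<sqsubseteq> adj (k * f) * (k * f)" by metis
  also have "\<dots> \<sqsubseteq> of_real ((norm (k * f))\<^sup>2)"
    by (rule cle_norm) (auto simp: cstar_identity)
  finally have "norm (d *\<^sub>R f) \<le> (norm (k * f))\<^sup>2"
    by (intro norm_le_of_cle positive_scaleR projection_positive f(1)) (use e(3) in auto)
  hence "d \<le> (norm (k * f))\<^sup>2" using e(3) nf by simp
  thus False using small e(3) by simp
qed

text \<open>A nonzero \<open>p x (1 - p)\<close> with \<open>p\<close> below \<open>1 - z\<close>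
  would yield a nonzero \<open>e\<close> below both \<open>z\<close> and \<open>1 - z\<close>. So
  all projections below \<open>1 - z\<close> are central, and \<open>1 - z\<close> would cut out a
  commutative summand unless it is 0.\<close>

lemma no_type_I1_halvable:
  fixes z :: "'a::cstar_algebra"
  assumes AW: "AW_star TYPE('a)" and noI1: "\<not> has_type_I1_summand TYPE('a)"
    and z: "projection z"
    and halv: "\<And>e q. projection e \<Longrightarrow> projection q \<Longrightarrow> e * q * e = (1/2) *\<^sub>R e \<Longrightarrow> e \<sqsubseteq> z"
  shows "z = 1"
proof (rule ccontr)
  assume "z \<noteq> 1"
  define w where "w = 1 - z"
  have w: "projection w" "w \<noteq> 0" using projection_compl[OF z] \<open>z \<noteq> 1\<close> by (auto simp: w_def)
  have cen: "p * x = x * p" if p: "projection p" "p \<sqsubseteq> w" for p x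
  proof -
    have 0: "p * x * (1 - p) = 0" for x
    proof (rule ccontr)
      assume "p * x * (1 - p) \<noteq> 0"
      then obtain e q where e: "projection e" "e \<noteq> 0" "e \<sqsubseteq> p" "projection q" "e * q * e = (1/2) *\<^sub>R e"
        using halving_projection[OF AW p(1)] by blast
      have "z * e = e" using halv[OF e(1,4,5)] projection_le_iff[OF e(1) z] by simp
      moreover have "w * e = e" using cle_trans[OF e(3) p(2)] projection_le_iff[OF e(1) w(1)] by simp
      ultimately show False using e(2) by (simp add: w_def algebra_simps)
    qed
    have 1: "p * x = p * x * p" for x
      using 0[of x] unfolding right_diff_distrib mult_1_right by (rule eq_iff_diff_eq_0[THEN iffD2])
    have "p * adj x = p * adj x * p" by (rule 1)
    from arg_cong[OF this, of adj] have "x * p = p * x * p"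
      using p(1) unfolding projection_def by (simp only: adj_simps mult.assoc)
    thus ?thesis using 1 by metis
  qed
  have sac: "(w * x) * (w * y) = (w * y) * (w * x)" if "selfadj x" "selfadj y" for x y
    using commutative_if_projections_central[OF AW w(1) cen that] .
  have "(w * x) * (w * y) = (w * y) * (w * x)" for x y
  proof -
    obtain h k h' k' where "selfadj h" "selfadj k" "x = h + cscale \<i> k" "selfadj h'" "selfadj k'" "y = h' + cscale \<i> k'"
      using selfadj_decomposition by metis
    thus ?thesis using sac[of h h'] sac[of h k'] sac[of k h'] sac[of k k']
      by (simp add: distrib_left distrib_right mult_cscale_left mult_cscale_right cscale_add_right cscale_ii_ii
          add.assoc add.commute add.left_commute)
  qed
  hence "has_type_I1_summand TYPE('a)"
    unfolding has_type_I1_summand_def using w cen[OF w(1) cle_refl] by blast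
  thus False using noI1 by contradiction
qed

section \<open>Order isomorphisms of the unit interval\<close>

lemma EFF_iff: "a \<in> EFF \<longleftrightarrow> positive a \<and> a \<sqsubseteq> 1"
  by (auto simp: EFF_def cle_0_iff positive_selfadj)

lemma EFF_positive: "a \<in> EFF \<Longrightarrow> positive a" and EFF_le_one: "a \<in> EFF \<Longrightarrow> a \<sqsubseteq> 1"
  by (auto simp: EFF_iff)

lemma EFF_of_real [simp]: "of_real r \<in> (EFF :: 'a::cstar_algebra set) \<longleftrightarrow> 0 \<le> r \<and> r \<le> 1"
  using cle_of_real[of r 1, where 'a='a] by (simp add: EFF_iff)

lemma EFF_0_1 [simp]: "0 \<in> (EFF :: 'a::cstar_algebra set)" "1 \<in> (EFF :: 'a::cstar_algebra set)"
  by (simp_all add: EFF_iff cle_def)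

lemma EFF_compl [simp]: "1 - a \<in> EFF \<longleftrightarrow> a \<in> (EFF :: 'a::cstar_algebra set)"
  by (auto simp: EFF_iff cle_def)

lemma projection_EFF: "projection p \<Longrightarrow> p \<in> EFF" for p :: "'a::cstar_algebra"
  by (simp add: EFF_iff projection_positive projection_le_one)

lemma EFF_mono: "positive x \<Longrightarrow> x \<sqsubseteq> a \<Longrightarrow> a \<in> EFF \<Longrightarrow> x \<in> EFF"
  unfolding EFF_iff using cle_trans by blast

lemma EFF_scaleR:
  fixes a :: "'a::cstar_algebra"
  assumes "a \<in> EFF" "0 \<le> r" "r \<le> 1" shows "r *\<^sub>R a \<in> EFF"
proof (rule EFF_mono[OF _ _ assms(1)])
  show "positive (r *\<^sub>R a)" using assms by (simp add: EFF_positive positive_scaleR)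
  show "r *\<^sub>R a \<sqsubseteq> a" using cle_scaleR_left[OF EFF_positive[OF assms(1)] assms(3)] by simp
qed

lemma positive_mult_projection:
  fixes a p :: "'a::cstar_algebra"
  assumes "positive a" "projection p" "a * p = p * a"
  shows "positive (a * p)" "a * p \<sqsubseteq> a"
proof -
  show "positive (a * p)" by (intro positive_mult projection_positive assms)
  have "positive (a * (1 - p))"
    by (intro positive_mult projection_positive projection_compl assms) (simp add: algebra_simps assms(3))
  thus "a * p \<sqsubseteq> a" by (simp add: cle_def algebra_simps)
qed

text \<open>A relation, since two effects need not have an infimum among the effects. Being purely
  order theoretic, it is transported by every order isomorphism.\<close>

definition eff_inf :: "'a::cstar_algebra \<Rightarrow> 'a \<Rightarrow> 'a \<Rightarrow> bool" where
  "eff_inf m a b \<longleftrightarrow> m \<in> EFF \<and> m \<sqsubseteq> a \<and> m \<sqsubseteq> b \<and> (\<forall>x\<in>EFF. x \<sqsubseteq> a \<longrightarrow> x \<sqsubseteq> b \<longrightarrow> x \<sqsubseteq> m)"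

definition eff_sup :: "'a::cstar_algebra \<Rightarrow> 'a \<Rightarrow> 'a \<Rightarrow> bool" where
  "eff_sup m a b \<longleftrightarrow> m \<in> EFF \<and> a \<sqsubseteq> m \<and> b \<sqsubseteq> m \<and> (\<forall>x\<in>EFF. a \<sqsubseteq> x \<longrightarrow> b \<sqsubseteq> x \<longrightarrow> m \<sqsubseteq> x)"

lemma eff_inf_unique: "eff_inf m a b \<Longrightarrow> eff_inf n a b \<Longrightarrow> m = n"
  unfolding eff_inf_def by (blast intro: cle_antisym)

lemma eff_sup_unique: "eff_sup m a b \<Longrightarrow> eff_sup n a b \<Longrightarrow> m = n"
  unfolding eff_sup_def by (blast intro: cle_antisym)

lemma eff_sup_dual: "eff_inf (1 - m) (1 - a) (1 - b) \<Longrightarrow> eff_sup m a b"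
  for a :: "'a::cstar_algebra"
  unfolding eff_inf_def eff_sup_def
proof (intro conjI ballI impI; (elim conjE)?)
  fix x :: 'a
  assume x: "x \<in> EFF" "a \<sqsubseteq> x" "b \<sqsubseteq> x"
    and *: "\<forall>x\<in>EFF. x \<sqsubseteq> 1 - a \<longrightarrow> x \<sqsubseteq> 1 - b \<longrightarrow> x \<sqsubseteq> 1 - m"
  show "m \<sqsubseteq> x" using *[rule_format, of "1 - x"] x by simp
qed simp_all

text \<open>For \<open>x \<sqsubseteq> p\<close> the compression of \<open>x\<close> to
  \<open>p\<close> is \<open>x\<close> itself, so compressing \<open>x \<sqsubseteq> a\<close> gives
  \<open>x \<sqsubseteq> a * p\<close>.\<close>

lemma eff_inf_commuting:
  fixes a p :: "'a::cstar_algebra"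
  assumes "projection p" "a \<in> EFF" "a * p = p * a"
  shows "eff_inf (a * p) a p"
proof -
  note ap = positive_mult_projection[OF EFF_positive[OF assms(2)] assms(1,3)]
  have conj: "p * a * p = a * p" using assms(3) projection_idem[OF assms(1)] by (metis mult.assoc)
  have "p * a * p \<sqsubseteq> p * 1 * p"
    by (rule cle_conj'[OF EFF_le_one[OF assms(2)] projection_selfadj[OF assms(1)]])
  hence "a * p \<sqsubseteq> p" using conj projection_idem[OF assms(1)] by simp
  moreover have "x \<sqsubseteq> a * p" if x: "x \<in> EFF" "x \<sqsubseteq> a" "x \<sqsubseteq> p" for x
  proof -
    have "p * x * p \<sqsubseteq> p * a * p" by (rule cle_conj'[OF x(2) projection_selfadj[OF assms(1)]])
    thus ?thesis using le_projection[OF EFF_positive[OF x(1)] x(3) assms(1)] conj by simp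
  qed
  ultimately show ?thesis using ap EFF_mono[OF ap assms(2)] by (simp add: eff_inf_def)
qed

lemma eff_sup_commuting:
  fixes a p :: "'a::cstar_algebra"
  assumes "projection p" "a \<in> EFF" "a * p = p * a"
  shows "eff_sup (a * p + (1 - p)) a (1 - p)"
proof (rule eff_sup_dual)
  have "eff_inf ((1 - a) * p) (1 - a) p"
    by (rule eff_inf_commuting) (use assms in \<open>simp_all add: algebra_simps\<close>)
  thus "eff_inf (1 - (a * p + (1 - p))) (1 - a) (1 - (1 - p))" by (simp add: algebra_simps)
qed

text \<open>Makes \<open>(1 + p) / 2\<close> recognisable from the order once 1/2 is.\<close>

lemma eff_sup_half:
  fixes p :: "'a::cstar_algebra"
  assumes p: "projection p" shows "eff_sup ((1/2) *\<^sub>R (1 + p)) (of_real (1/2)) p"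
proof -
  have "eff_sup (of_real (1/2) * (1 - p) + (1 - (1 - p))) (of_real (1/2)) (1 - (1 - p))"
    by (rule eff_sup_commuting[OF projection_compl[OF p]]) (simp_all only: EFF_of_real of_real_commute, simp)
  moreover have "of_real (1/2) * (1 - p) + (1 - (1 - p)) = (1/2) *\<^sub>R (1 + p)"
  proof -
    have "(1/2) *\<^sub>R p + (1/2) *\<^sub>R p = p" by (simp flip: scaleR_left.add)
    thus ?thesis by (simp add: of_real_def scaleR_add_right scaleR_diff_right) (metis add_diff_cancel_left' diff_add_eq)
  qed
  ultimately show ?thesis by simp
qed

lemma mid_EFF:
  fixes p :: "'a::cstar_algebra"
  shows "projection p \<Longrightarrow> (1/2) *\<^sub>R (1 + p) \<in> EFF"
  using eff_sup_half[of p] by (simp add: eff_sup_def)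

definition eff_disjoint :: "'a::cstar_algebra \<Rightarrow> 'a \<Rightarrow> bool" where
  "eff_disjoint a b \<longleftrightarrow> (\<forall>x\<in>EFF. x \<sqsubseteq> a \<longrightarrow> x \<sqsubseteq> b \<longrightarrow> x = 0)"

text \<open>An effect which is not a projection can be enlarged by a small multiple of a spectral projection
  without losing comparability up to a factor 2, hence without changing the set of disjoint effects.\<close>

lemma projection_iff_maximal:
  fixes a :: "'a::cstar_algebra"
  assumes AW: "AW_star TYPE('a)" and a: "a \<in> EFF"
  shows "projection a \<longleftrightarrow>
    (\<forall>b\<in>EFF. a \<sqsubseteq> b \<longrightarrow> (\<forall>x\<in>EFF. eff_disjoint x a \<longrightarrow> eff_disjoint x b) \<longrightarrow> b = a)"
proof
  assume p: "projection a"
  show "\<forall>b\<in>EFF. a \<sqsubseteq> b \<longrightarrow> (\<forall>x\<in>EFF. eff_disjoint x a \<longrightarrow> eff_disjoint x b) \<longrightarrow> b = a"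
  proof (intro ballI impI, rule ccontr)
    fix b assume b: "b \<in> EFF" "a \<sqsubseteq> b" and D: "\<forall>x\<in>EFF. eff_disjoint x a \<longrightarrow> eff_disjoint x b" and ne: "b \<noteq> a"
    have "positive (b - a)" "b - a \<noteq> 0" using b ne by (auto simp: cle_def)
    then obtain e d where e: "projection e" "e \<noteq> 0" "d > 0" "d *\<^sub>R e \<sqsubseteq> b - a"
      using positive_dominates_projection[OF AW] by metis
    have "b - a \<sqsubseteq> 1 - a" using EFF_le_one[OF b(1)] by simp
    hence le: "d *\<^sub>R e \<sqsubseteq> 1 - a" using e(4) cle_trans by blast
    have pe: "positive (d *\<^sub>R e)" using e by (simp add: positive_scaleR projection_positive)
    have "(1 - a) * (d *\<^sub>R e) = d *\<^sub>R e" by (rule le_projection(1)[OF pe le projection_compl[OF p]])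
    hence ae: "a * e = 0" using e(3) by (simp add: algebra_simps)
    \<comment> \<open>Orthogonality of \<open>e\<close> and the projection \<open>a\<close> makes
      them disjoint, whereas a multiple of \<open>e\<close> lies below \<open>b\<close>.\<close>
    have "eff_disjoint e a"
      unfolding eff_disjoint_def
    proof (intro ballI impI)
      fix x assume x: "x \<in> EFF" "x \<sqsubseteq> e" "x \<sqsubseteq> a"
      have "a * x = x" "e * x = x"
        using le_projection(1)[OF EFF_positive[OF x(1)]] x p e(1) by auto
      thus "x = 0" using ae by (metis mult.assoc mult_zero_left)
    qed
    hence "eff_disjoint e b" using D projection_EFF[OF e(1)] by blast
    moreover define m where "m = min d 1"
    have m: "m > 0" "m \<le> d" "m \<le> 1" using e(3) by (auto simp: m_def)
    have "m *\<^sub>R e \<in> EFF" using EFF_scaleR[OF projection_EFF[OF e(1)]] m by simp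
    moreover have "m *\<^sub>R e \<sqsubseteq> e" using cle_scaleR_left[OF projection_positive[OF e(1)] m(3)] by simp
    moreover have "m *\<^sub>R e \<sqsubseteq> d *\<^sub>R e" using cle_scaleR_left[OF projection_positive[OF e(1)] m(2)] .
    hence "m *\<^sub>R e \<sqsubseteq> b - a" using e(4) cle_trans by blast
    hence "m *\<^sub>R e \<sqsubseteq> b" using positive_add[of "b - a - m *\<^sub>R e" a] EFF_positive[OF a] by (simp add: cle_def algebra_simps)
    ultimately have "m *\<^sub>R e = 0" unfolding eff_disjoint_def by blast
    thus False using m e(2) by simp
  qed
next
  assume max: "\<forall>b\<in>EFF. a \<sqsubseteq> b \<longrightarrow> (\<forall>x\<in>EFF. eff_disjoint x a \<longrightarrow> eff_disjoint x b) \<longrightarrow> b = a"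
  have pa: "positive a" and p1: "positive (1 - a)" using a by (auto simp: EFF_iff cle_def)
  have pos: "positive (a * (1 - a))" by (intro positive_mult pa p1) (simp add: algebra_simps)
  show "projection a"
  proof (rule ccontr)
    assume "\<not> projection a"
    hence "a * (1 - a) \<noteq> 0"
      using positive_selfadj[OF pa] by (auto simp: projection_def selfadj_def algebra_simps)
    then obtain e d where e: "projection e" "e \<noteq> 0" "d > 0" "d *\<^sub>R e \<sqsubseteq> a * (1 - a)"
      using positive_dominates_projection[OF AW pos] by metis
    have aa: "positive (a * a)" "positive ((1 - a) * (1 - a))"
      using positive_square positive_selfadj pa p1 by blast+
    have "a * (1 - a) \<sqsubseteq> a" using aa(1) by (simp add: cle_def algebra_simps)
    hence da: "d *\<^sub>R e \<sqsubseteq> a" using e(4) cle_trans by blast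
    have "a * (1 - a) \<sqsubseteq> 1 - a" using aa(2) by (simp add: cle_def algebra_simps)
    hence d1: "d *\<^sub>R e \<sqsubseteq> 1 - a" using e(4) cle_trans by blast
    define b where "b = a + d *\<^sub>R e"
    have pe: "positive (d *\<^sub>R e)" using e by (simp add: positive_scaleR projection_positive)
    have b: "b \<in> EFF" unfolding EFF_iff b_def
      using positive_add[OF pa pe] d1 by (simp add: cle_def algebra_simps)
    have ab: "a \<sqsubseteq> b" using pe by (simp add: b_def cle_def)
    \<comment> \<open>The factor 2 suffices: half of a common minorant of \<open>x\<close> and
      \<open>b\<close> is a common minorant of \<open>x\<close> and \<open>a\<close>.\<close>
    have b2: "b \<sqsubseteq> 2 *\<^sub>R a" using da by (simp add: b_def cle_def scaleR_2)
    have "eff_disjoint x b" if x: "x \<in> EFF" "eff_disjoint x a" for x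
      unfolding eff_disjoint_def
    proof (intro ballI impI)
      fix y assume y: "y \<in> EFF" "y \<sqsubseteq> x" "y \<sqsubseteq> b"
      have "(1/2) *\<^sub>R y \<sqsubseteq> (1/2) *\<^sub>R (2 *\<^sub>R a)" using cle_trans[OF y(3) b2] by (intro cle_scaleR) auto
      moreover have "(1/2) *\<^sub>R y \<sqsubseteq> 1 *\<^sub>R y" using cle_scaleR_left[OF EFF_positive[OF y(1)], of "1/2" 1] by simp
      ultimately have "(1/2) *\<^sub>R y = 0"
        using x(2) EFF_scaleR[OF y(1), of "1/2"] y(2) cle_trans unfolding eff_disjoint_def by fastforce
      thus "y = 0" by simp
    qed
    hence "b = a" using max b ab by blast
    thus False using e by (simp add: b_def)
  qed
qed

text \<open>The greatest effect below \<open>p\<close> and \<open>g = (1 + q) / 2\<close> is the inverse of \<open>p g\<^sup>-\<^sup>1 p\<close> in the corner of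
  \<open>p\<close>, where \<open>g\<^sup>-\<^sup>1 = 2 - q\<close>.\<close>

lemma eff_inf_two_projections:
  fixes p q :: "'a::cstar_algebra"
  assumes p: "projection p" and q: "projection q"
  shows "\<exists>y. eff_inf y ((1/2) *\<^sub>R (1 + q)) p \<and> y * p = y \<and> y * (2 - p * q * p) = p"
proof -
  have pp: "p * p = p" and qq: "q * q = q" and sp: "selfadj p" and sq: "selfadj q"
    using p q projection_idem projection_selfadj by auto
  define h where "h = 2 - p * q * p"
  define k where "k = 2 - q"
  define g where "g = (1/2) *\<^sub>R (1 + q)"
  have "p * q * p \<sqsubseteq> p * 1 * p" by (rule cle_conj'[OF projection_le_one[OF q] sp])
  also have "p * 1 * p \<sqsubseteq> 1" using pp projection_le_one[OF p] by simp
  finally have "positive (1 - p * q * p)" by (simp add: cle_def)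
  moreover have "h - 1 = 1 - p * q * p" "k - 1 = 1 - q"
    unfolding h_def k_def one_add_one[symmetric] by simp_all
  ultimately have h1: "1 \<sqsubseteq> h" and k1: "1 \<sqsubseteq> k"
    using projection_le_one[OF q] by (simp_all add: cle_def)
  have hP: "h \<in> PINV" and kP: "k \<in> PINV" using PINV_mono[OF PINV_1] h1 k1 by auto
  have "(1 + q) * k = 2 *\<^sub>R 1" "k * (1 + q) = 2 *\<^sub>R 1"
    unfolding k_def one_add_one[where 'a='a, symmetric] scaleR_2 distrib_left distrib_right left_diff_distrib right_diff_distrib
    using qq by (simp_all del: one_add_one)
  hence gk: "g * k = 1" "k * g = 1" by (simp_all add: g_def)
  have cik: "cinv k = g" using cinv_eq(2)[OF gk(2,1)] .
  have p2: "p * 2 = 2 * p" unfolding one_add_one[where 'a='a, symmetric] distrib_left distrib_right by simp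
  have ph: "p * h = h * p" and pkp: "p * k * p = p * h"
    by (simp_all add: h_def k_def left_diff_distrib right_diff_distrib p2 mult.assoc pp projection_idem_left[OF p])
  define c where "c = cinv h"
  have hc: "h * c = 1" "c * h = 1" using cinv[OF PINV_invertible[OF hP]] by (auto simp: c_def)
  have pc: "c * p = p * c" unfolding c_def by (rule cinv_commute[OF PINV_invertible[OF hP]]) (use ph in simp)
  have cP: "positive c" unfolding c_def by (intro PINV_positive PINV_cinv hP)
  define y where "y = p * c"
  have yp: "y * p = y" and py: "p * y = y" using pc pp by (metis y_def mult.assoc)+
  have yh: "y * h = p" using hc by (simp add: y_def mult.assoc)
  have hy: "h * y = p" using hc ph by (metis y_def mult.assoc mult_1)
  have pcp: "p * c * p = y" using yp by (simp add: y_def)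
  have posy: "positive y" using positive_conj'[OF cP sp] pcp by simp
  have "p * c * p \<sqsubseteq> p * 1 * p" by (rule cle_conj'[OF _ sp]) (simp add: c_def cinv_le_one h1)
  hence yp': "y \<sqsubseteq> p" using pcp pp by simp
  define s where "s = psqrt k"
  have ss: "s * s = k" and sP: "s \<in> PINV"
    using psqrt(2)[OF PINV_positive[OF kP]] PINV_psqrt[OF kP] by (auto simp: s_def)
  have cs: "cinv s * k * cinv s = 1" "cinv s * cinv s = g"
    using cinv_psqrt_conj[OF kP] cik by (auto simp: s_def)
  have sgs: "s * g * s = 1"
  proof -
    have "s * g * s = (s * cinv s) * (cinv s * s)" by (simp add: cs(2)[symmetric] mult.assoc)
    thus ?thesis using cinv[OF PINV_invertible[OF sP]] by simp
  qed
  have sels: "selfadj s" by (rule PINV_selfadj[OF sP])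
  have yky: "y * k * y = y"
  proof -
    have "y * k * y = y * (p * k * p) * y" using yp py by (metis mult.assoc)
    thus ?thesis using pkp ph yp yh py by (metis mult.assoc)
  qed
  \<comment> \<open>As \<open>g\<close> is the inverse of \<open>s * s\<close>, the bound
    \<open>y \<sqsubseteq> g\<close> means \<open>s * y * s \<sqsubseteq> 1\<close>; and
    \<open>y * k * y = y\<close> makes \<open>s * y * s\<close> a projection.\<close>
  have "s * y * s * (s * y * s) = s * (y * k * y) * s" by (simp add: ss[symmetric] mult.assoc)
  moreover have "adj (s * y * s) = s * y * s"
    using selfadj_conj'[OF positive_selfadj[OF posy] sels] by (simp add: selfadj_def)
  ultimately have "projection (s * y * s)" using yky by (simp add: projection_def)
  hence "s * y * s \<sqsubseteq> 1" by (rule projection_le_one)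
  from cle_conj'[OF this PINV_selfadj[OF PINV_cinv[OF sP]]]
  have "(cinv s * s) * y * (s * cinv s) \<sqsubseteq> cinv s * cinv s" by (simp add: mult.assoc)
  hence yg: "y \<sqsubseteq> g" using cinv[OF PINV_invertible[OF sP]] cs(2) by simp
  have "x \<sqsubseteq> y" if x: "x \<in> EFF" "x \<sqsubseteq> g" "x \<sqsubseteq> p" for x
  proof -
    have px: "p * x = x" "x * p = x" using le_projection[OF EFF_positive[OF x(1)] x(3) p] by auto
    define z where "z = psqrt x"
    have zz: "z * z = x" and sz: "selfadj z" using psqrt(2)[OF EFF_positive[OF x(1)]] selfadj_psqrt[OF EFF_positive[OF x(1)]]
      by (auto simp: z_def)
    have "s * x * s \<sqsubseteq> 1" using cle_conj'[OF x(2) sels] sgs by simp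
    moreover have "adj (z * s) * (z * s) = s * x * s"
      using sz sels by (simp add: adj_simps selfadj_def zz[symmetric] mult.assoc)
    ultimately have "norm (adj (z * s) * (z * s)) \<le> 1"
      using norm_le_of_cle[of "adj (z * s) * (z * s)" 1] positive_adj_mult[of "z * s"] by simp
    \<comment> \<open>The C*-identity moves the bound from \<open>s * x * s\<close> to the product
      in the other order, \<open>z * k * z\<close>.\<close>
    hence "norm (adj (adj (z * s)) * adj (z * s)) \<le> 1" by (simp only: cstar_identity norm_adj)
    moreover have "adj (adj (z * s)) * adj (z * s) = z * k * z"
      using sz sels by (simp add: adj_simps selfadj_def ss[symmetric] mult.assoc)
    ultimately have "z * k * z \<sqsubseteq> 1"
      using cle_norm[of "z * k * z" 1] selfadj_conj'[OF PINV_selfadj[OF kP] sz] by simp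
    from cle_conj'[OF this sz] have "x * k * x \<sqsubseteq> x" by (simp add: zz[symmetric] mult.assoc)
    moreover have "x * k * x = x * h * x"
    proof -
      have "x * k * x = x * (p * k * p) * x" using px by (metis mult.assoc)
      thus ?thesis using pkp px by (metis mult.assoc)
    qed
    ultimately have xhx: "x * h * x \<sqsubseteq> x" by simp
    define t where "t = psqrt h"
    have tt: "t * t = h" and tP: "t \<in> PINV" and tp: "p * t = t * p"
      using psqrt(2)[OF PINV_positive[OF hP]] PINV_psqrt[OF hP] psqrt(3)[OF PINV_positive[OF hP] ph]
      by (simp_all add: t_def)
    have st: "selfadj t" by (rule PINV_selfadj[OF tP])
    \<comment> \<open>\<open>x * h * x \<sqsubseteq> x\<close> becomes
      \<open>m * m \<sqsubseteq> m\<close>, which forces \<open>norm m \<le> 1\<close> and hence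
      \<open>m \<sqsubseteq> p\<close>. Undoing the conjugation by \<open>t\<close> gives
      \<open>x \<sqsubseteq> p * c\<close>.\<close>
    define m where "m = t * x * t"
    have posm: "positive m" unfolding m_def by (rule positive_conj'[OF EFF_positive[OF x(1)] st])
    have "m * m = t * (x * h * x) * t" by (simp add: m_def tt[symmetric] mult.assoc)
    hence mm: "m * m \<sqsubseteq> m" using cle_conj'[OF xhx st] by (simp add: m_def)
    have "m * m \<sqsubseteq> of_real (norm m)"
      by (rule cle_trans[OF mm]) (rule cle_norm[OF positive_selfadj[OF posm] order_refl])
    hence "(norm m)\<^sup>2 \<le> norm m"
      using norm_le_of_cle[OF positive_square[OF positive_selfadj[OF posm]]] norm_selfadj_square[OF positive_selfadj[OF posm]]
      by metis
    hence "norm m \<le> 1" by (cases "norm m = 0") (simp_all add: power2_eq_square)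
    hence "m \<sqsubseteq> 1 *\<^sub>R p"
      using cle_norm[OF positive_selfadj[OF posm]]
      by (intro le_scaleR_projection p) (metis of_real_1, (metis m_def px tp mult.assoc)+)
    from cle_conj'[OF this PINV_selfadj[OF PINV_cinv[OF tP]]]
    have "(cinv t * t) * x * (t * cinv t) \<sqsubseteq> cinv t * p * cinv t" by (simp add: m_def mult.assoc)
    moreover have "cinv t * p * cinv t = y"
    proof -
      have "cinv t * p = p * cinv t" by (rule cinv_commute[OF PINV_invertible[OF tP]]) (use tp in simp)
      moreover have "cinv t * cinv t = c" using cinv_psqrt_conj(2)[OF hP] by (simp add: t_def c_def)
      ultimately show ?thesis by (simp add: y_def mult.assoc)
    qed
    ultimately show "x \<sqsubseteq> y" using cinv[OF PINV_invertible[OF tP]] by simp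
  qed
  hence "eff_inf y g p"
    using yg yp' EFF_mono[OF posy yp' projection_EFF[OF p]] by (simp add: eff_inf_def)
  thus ?thesis using yp yh by (auto simp: g_def h_def)
qed

section \<open>Order isomorphisms of intervals\<close>

lemma order_iso_onI:
  fixes f :: "'a::cstar_algebra \<Rightarrow> 'b::cstar_algebra"
  assumes "\<And>a. a \<in> S \<Longrightarrow> f a \<in> T" "\<And>b. b \<in> T \<Longrightarrow> \<exists>a\<in>S. f a = b"
    and "\<And>a b. a \<in> S \<Longrightarrow> b \<in> S \<Longrightarrow> a \<sqsubseteq> b \<longleftrightarrow> f a \<sqsubseteq> f b"
  shows "order_iso_on f S T"
  unfolding order_iso_on_def bij_betw_def
proof (intro conjI inj_onI)
  fix x y assume "x \<in> S" "y \<in> S" "f x = f y"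
  thus "x = y" using assms(3)[of x y] assms(3)[of y x] cle_antisym by simp
qed (use assms in auto)

lemma order_iso_onD:
  fixes f :: "'a::cstar_algebra \<Rightarrow> 'b::cstar_algebra"
  assumes "order_iso_on f S T"
  shows "a \<in> S \<Longrightarrow> f a \<in> T" "b \<in> T \<Longrightarrow> \<exists>a\<in>S. f a = b"
    and "a \<in> S \<Longrightarrow> c \<in> S \<Longrightarrow> f a \<sqsubseteq> f c \<longleftrightarrow> a \<sqsubseteq> c"
    and "a \<in> S \<Longrightarrow> c \<in> S \<Longrightarrow> f a = f c \<Longrightarrow> a = c"
  using assms unfolding order_iso_on_def bij_betw_def inj_on_def by auto

lemma order_iso_on_comp:
  assumes "order_iso_on f S T" "order_iso_on g T U"
  shows "order_iso_on (\<lambda>x. g (f x)) S U"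
proof (rule order_iso_onI)
  fix b assume "b \<in> U"
  then obtain y where "y \<in> T" "g y = b" using order_iso_onD(2)[OF assms(2)] by blast
  moreover from this obtain x where "x \<in> S" "f x = y" using order_iso_onD(2)[OF assms(1)] by blast
  ultimately show "\<exists>a\<in>S. g (f a) = b" by blast
qed (simp_all add: order_iso_onD(1,3)[OF assms(1)] order_iso_onD(1,3)[OF assms(2)])

definition ival :: "'a::cstar_algebra \<Rightarrow> 'a \<Rightarrow> 'a set" where
  "ival a b = {x. a \<sqsubseteq> x \<and> x \<sqsubseteq> b}"

lemma EFF_ival: "EFF = ival 0 1"
  by (auto simp: ival_def EFF_iff cle_0_iff)

lemma order_iso_on_restrict:
  assumes f: "order_iso_on f S T" and "a \<in> S" "b \<in> S" "ival a b \<subseteq> S" "ival (f a) (f b) \<subseteq> T"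
  shows "order_iso_on f (ival a b) (ival (f a) (f b))"
proof (rule order_iso_onI)
  fix x assume "x \<in> ival a b"
  thus "f x \<in> ival (f a) (f b)" using order_iso_onD(3)[OF f] assms by (auto simp: ival_def subset_iff)
next
  fix y assume y: "y \<in> ival (f a) (f b)"
  then obtain x where x: "x \<in> S" "f x = y" using order_iso_onD(2)[OF f] assms by blast
  hence "x \<in> ival a b" using order_iso_onD(3)[OF f] assms y by (auto simp: ival_def)
  thus "\<exists>x\<in>ival a b. f x = y" using x by blast
qed (use order_iso_onD(3)[OF f] assms in blast)

lemma order_iso_on_affine:
  fixes a b c :: "'a::cstar_algebra"
  assumes r: "r > 0"
  shows "order_iso_on (\<lambda>x. c + r *\<^sub>R x) (ival a b) (ival (c + r *\<^sub>R a) (c + r *\<^sub>R b))"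
proof (rule order_iso_onI)
  fix y assume y: "y \<in> ival (c + r *\<^sub>R a) (c + r *\<^sub>R b)"
  define x where "x = (1/r) *\<^sub>R (y - c)"
  have yx: "c + r *\<^sub>R x = y" using r by (simp add: x_def)
  have "x \<in> ival a b" using y r unfolding yx[symmetric] by (simp add: ival_def)
  thus "\<exists>x\<in>ival a b. c + r *\<^sub>R x = y" using yx by blast
qed (use r in \<open>auto simp: ival_def\<close>)

lemma conj_cle_iff:
  fixes k :: "'a::cstar_algebra"
  assumes "k \<in> PINV"
  shows "k * a * k \<sqsubseteq> k * b * k \<longleftrightarrow> a \<sqsubseteq> b"
proof
  assume "k * a * k \<sqsubseteq> k * b * k"
  from cle_conj'[OF this PINV_selfadj[OF PINV_cinv[OF assms]]]
  have "(cinv k * k) * a * (k * cinv k) \<sqsubseteq> (cinv k * k) * b * (k * cinv k)" by (simp add: mult.assoc)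
  thus "a \<sqsubseteq> b" using cinv[OF PINV_invertible[OF assms]] by simp
qed (rule cle_conj'[OF _ PINV_selfadj[OF assms]])

lemma conj_cinv:
  fixes k :: "'a::cstar_algebra"
  assumes "k \<in> PINV" shows "k * (cinv k * y * cinv k) * k = y" "cinv k * (k * y * k) * cinv k = y"
proof -
  note k = cinv[OF PINV_invertible[OF assms]]
  have "k * (cinv k * y * cinv k) * k = (k * cinv k) * y * (cinv k * k)"
    "cinv k * (k * y * k) * cinv k = (cinv k * k) * y * (k * cinv k)" by (simp_all only: mult.assoc)
  thus "k * (cinv k * y * cinv k) * k = y" "cinv k * (k * y * k) * cinv k = y" using k by simp_all
qed

lemma order_iso_on_conj:
  fixes a b k :: "'a::cstar_algebra"
  assumes k: "k \<in> PINV"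
  shows "order_iso_on (\<lambda>x. k * x * k) (ival a b) (ival (k * a * k) (k * b * k))"
proof (rule order_iso_onI)
  fix y assume y: "y \<in> ival (k * a * k) (k * b * k)"
  define x where "x = cinv k * y * cinv k"
  have yx: "k * x * k = y" unfolding x_def by (rule conj_cinv[OF k])
  have "x \<in> ival a b" using y unfolding yx[symmetric] by (simp add: ival_def conj_cle_iff[OF k])
  thus "\<exists>x\<in>ival a b. k * x * k = y" using yx by blast
qed (auto simp: ival_def conj_cle_iff[OF k])

text \<open>What is proved for \<open>\<Phi>\<close> is reused for maps derived from it: its dual
  under \<open>a \<mapsto> 1 - a\<close>, its rescaled restrictions to scalar subintervals, its
  conjugates by square roots and by \<open>hinv\<close>. Each has only to be shown an order
  isomorphism of the effects that fixes 1/2.\<close>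

locale eff_iso =
  fixes \<Phi> :: "'a::cstar_algebra \<Rightarrow> 'b::cstar_algebra"
  assumes AWA: "AW_star TYPE('a)" and AWB: "AW_star TYPE('b)"
    and noI1: "\<not> has_type_I1_summand TYPE('a)"
    and iso: "order_iso_on \<Phi> EFF EFF"
    and half: "\<Phi> (of_real (1/2)) = of_real (1/2)"
begin

lemmas in_EFF = order_iso_onD(1)[OF iso]
  and surj = order_iso_onD(2)[OF iso]
  and le_iff = order_iso_onD(3)[OF iso]
  and inj = order_iso_onD(4)[OF iso]

lemma zero: "\<Phi> 0 = 0"
proof -
  obtain a where a: "a \<in> EFF" "\<Phi> a = 0" using surj[of 0] by auto
  have "\<Phi> 0 \<sqsubseteq> \<Phi> a" using le_iff[of 0 a] a by (simp add: cle_0_iff EFF_positive)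
  thus ?thesis using a in_EFF[of 0] by (intro cle_antisym) (simp_all add: cle_0_iff EFF_positive)
qed

lemma one: "\<Phi> 1 = 1"
proof -
  obtain a where a: "a \<in> EFF" "\<Phi> a = 1" using surj[of 1] by auto
  have "\<Phi> a \<sqsubseteq> \<Phi> 1" using le_iff[of a 1] a by (simp add: EFF_le_one)
  thus ?thesis using a in_EFF[of 1] by (intro cle_antisym) (simp_all add: EFF_le_one)
qed

lemma eff_inf_image:
  assumes "eff_inf m a b" "a \<in> EFF" "b \<in> EFF" shows "eff_inf (\<Phi> m) (\<Phi> a) (\<Phi> b)"
  unfolding eff_inf_def
proof (intro conjI ballI impI)
  fix y assume y: "y \<in> EFF" "y \<sqsubseteq> \<Phi> a" "y \<sqsubseteq> \<Phi> b"
  then obtain x where "x \<in> EFF" "\<Phi> x = y" using surj by blast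
  thus "y \<sqsubseteq> \<Phi> m" using y le_iff assms unfolding eff_inf_def by metis
qed (use assms le_iff in_EFF in \<open>auto simp: eff_inf_def\<close>)

lemma eff_sup_image:
  assumes "eff_sup m a b" "a \<in> EFF" "b \<in> EFF" shows "eff_sup (\<Phi> m) (\<Phi> a) (\<Phi> b)"
  unfolding eff_sup_def
proof (intro conjI ballI impI)
  fix y assume y: "y \<in> EFF" "\<Phi> a \<sqsubseteq> y" "\<Phi> b \<sqsubseteq> y"
  then obtain x where "x \<in> EFF" "\<Phi> x = y" using surj by blast
  thus "\<Phi> m \<sqsubseteq> y" using y le_iff assms unfolding eff_sup_def by metis
qed (use assms le_iff in_EFF in \<open>auto simp: eff_sup_def\<close>)

lemma eff_disjoint_iff:
  assumes "a \<in> EFF" "b \<in> EFF"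
  shows "eff_disjoint (\<Phi> a) (\<Phi> b) \<longleftrightarrow> eff_disjoint a b"
  unfolding eff_disjoint_def
proof (intro iffI ballI impI)
  fix x assume *: "\<forall>x\<in>EFF. x \<sqsubseteq> \<Phi> a \<longrightarrow> x \<sqsubseteq> \<Phi> b \<longrightarrow> x = 0" and x: "x \<in> EFF" "x \<sqsubseteq> a" "x \<sqsubseteq> b"
  have "\<Phi> x = 0" using *[rule_format, OF in_EFF[OF x(1)]] le_iff x assms by simp
  thus "x = 0" using inj[of x 0] x zero by simp
next
  fix y assume *: "\<forall>x\<in>EFF. x \<sqsubseteq> a \<longrightarrow> x \<sqsubseteq> b \<longrightarrow> x = 0" and y: "y \<in> EFF" "y \<sqsubseteq> \<Phi> a" "y \<sqsubseteq> \<Phi> b"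
  then obtain x where x: "x \<in> EFF" "\<Phi> x = y" using surj by blast
  thus "y = 0" using * y le_iff assms zero by metis
qed

lemma projection_iff:
  assumes a: "a \<in> EFF" shows "projection (\<Phi> a) \<longleftrightarrow> projection a"
proof -
  have "\<Phi> ` EFF = EFF" using iso by (simp add: order_iso_on_def bij_betw_def)
  hence img: "(\<forall>y\<in>EFF. Q y) \<longleftrightarrow> (\<forall>x\<in>EFF. Q (\<Phi> x))" for Q by (metis ball_simps(9))
  have eq_iff: "\<Phi> b = \<Phi> c \<longleftrightarrow> b = c" if "b \<in> EFF" "c \<in> EFF" for b c using inj that by blast
  have "projection (\<Phi> a) \<longleftrightarrow> (\<forall>b\<in>EFF. \<Phi> a \<sqsubseteq> b \<longrightarrow> (\<forall>x\<in>EFF. eff_disjoint x (\<Phi> a) \<longrightarrow> eff_disjoint x b) \<longrightarrow> b = \<Phi> a)"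
    by (rule projection_iff_maximal[OF AWB in_EFF[OF a]])
  also have "\<dots> \<longleftrightarrow> (\<forall>b\<in>EFF. \<Phi> a \<sqsubseteq> \<Phi> b \<longrightarrow> (\<forall>x\<in>EFF. eff_disjoint (\<Phi> x) (\<Phi> a) \<longrightarrow> eff_disjoint (\<Phi> x) (\<Phi> b)) \<longrightarrow> \<Phi> b = \<Phi> a)"
    by (simp only: img)
  also have "\<dots> \<longleftrightarrow> (\<forall>b\<in>EFF. a \<sqsubseteq> b \<longrightarrow> (\<forall>x\<in>EFF. eff_disjoint x a \<longrightarrow> eff_disjoint x b) \<longrightarrow> b = a)"
    using a by (simp add: le_iff eff_disjoint_iff eq_iff cong: ball_cong_simp)
  also have "\<dots> \<longleftrightarrow> projection a" by (rule projection_iff_maximal[OF AWA a, symmetric])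
  finally show ?thesis .
qed

lemma projection_image: "projection p \<Longrightarrow> projection (\<Phi> p)"
  using projection_iff projection_EFF by blast

lemma half_projection:
  assumes p: "projection p" shows "\<Phi> ((1/2) *\<^sub>R p) = (1/2) *\<^sub>R \<Phi> p"
proof -
  have "eff_inf (of_real (1/2) * p) (of_real (1/2)) p"
    by (rule eff_inf_commuting[OF p]) (simp_all only: EFF_of_real of_real_commute, simp)
  from eff_inf_image[OF this] have 1: "eff_inf (\<Phi> ((1/2) *\<^sub>R p)) (of_real (1/2)) (\<Phi> p)"
    unfolding half by (simp add: projection_EFF[OF p] scaleR_conv_of_real del: of_real_divide)
  have "eff_inf (of_real (1/2) * \<Phi> p) (of_real (1/2)) (\<Phi> p)"
    by (rule eff_inf_commuting[OF projection_image[OF p]]) (simp_all only: EFF_of_real of_real_commute, simp)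
  from eff_inf_unique[OF 1 this] show ?thesis by (simp add: scaleR_conv_of_real)
qed

lemma mid_projection:
  assumes p: "projection p" shows "\<Phi> ((1/2) *\<^sub>R (1 + p)) = (1/2) *\<^sub>R (1 + \<Phi> p)"
proof -
  have "eff_sup (\<Phi> ((1/2) *\<^sub>R (1 + p))) (of_real (1/2)) (\<Phi> p)"
    using eff_sup_image[OF eff_sup_half[OF p]] half by (simp add: projection_EFF[OF p] del: of_real_divide)
  thus ?thesis using eff_sup_half[OF projection_image[OF p]] eff_sup_unique by blast
qed

text \<open>\<open>(1 + p) / 2\<close> and \<open>1 - p\<close> have infimum
  \<open>(1 - p) / 2\<close>, and this relation passes to the images \<open>P\<close> and
  \<open>Q\<close>. The infimum of \<open>(1 + P) / 2\<close> and \<open>Q\<close> is the inverse of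
  \<open>2 - Q P Q\<close> in the corner of \<open>Q\<close>; it equals \<open>Q / 2\<close> only if
  \<open>Q P Q = 0\<close>.\<close>

lemma orthogonal_image:
  assumes p: "projection p" shows "\<Phi> p * \<Phi> (1 - p) = 0"
proof -
  define P where "P = \<Phi> p"
  define Q where "Q = \<Phi> (1 - p)"
  have P: "projection P" and Q: "projection Q"
    using projection_image p projection_compl[OF p] by (auto simp: P_def Q_def)
  have "(1/2) *\<^sub>R (1 + p) * (1 - p) = (1/2) *\<^sub>R (1 - p)" "(1 - p) * ((1/2) *\<^sub>R (1 + p)) = (1/2) *\<^sub>R (1 - p)"
    using projection_idem[OF p] by (simp_all add: algebra_simps)
  hence "eff_inf ((1/2) *\<^sub>R (1 - p)) ((1/2) *\<^sub>R (1 + p)) (1 - p)"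
    using eff_inf_commuting[OF projection_compl[OF p] mid_EFF[OF p]] by simp
  from eff_inf_image[OF this mid_EFF[OF p] projection_EFF[OF projection_compl[OF p]]]
  have 1: "eff_inf ((1/2) *\<^sub>R Q) ((1/2) *\<^sub>R (1 + P)) Q"
    unfolding half_projection[OF projection_compl[OF p]] mid_projection[OF p] P_def Q_def .
  obtain y where "eff_inf y ((1/2) *\<^sub>R (1 + P)) Q" and y: "y * (2 - Q * P * Q) = Q"
    using eff_inf_two_projections[OF Q P] by blast
  hence "y = (1/2) *\<^sub>R Q" using 1 eff_inf_unique by blast
  hence "(1/2) *\<^sub>R (Q * (2 - Q * P * Q)) = Q" using y by simp
  hence "Q * (2 - Q * P * Q) = Q + Q" by (metis field_sum_of_halves scaleR_left.add scaleR_one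
        scaleR_add_right scaleR_half_double)
  moreover have "Q * 2 = Q + Q" unfolding one_add_one[where 'a='b, symmetric] by (simp add: distrib_left del: one_add_one)
  ultimately have "Q * P * Q = 0"
    using projection_idem_left[OF Q] by (simp add: right_diff_distrib mult.assoc)
  hence "norm (adj (P * Q) * (P * Q)) = 0"
    using P Q projection_idem_left[OF P] by (simp add: adj_simps projection_def mult.assoc)
  thus ?thesis by (simp add: cstar_identity P_def Q_def)
qed

text \<open>The sum of the orthogonal images is a projection, hence the image of some effect. That
  effect lies above both \<open>p\<close> and \<open>1 - p\<close>, and therefore is 1.\<close>

lemma compl_image:
  assumes p: "projection p" shows "\<Phi> (1 - p) = 1 - \<Phi> p"
proof -
  define P where "P = \<Phi> p"
  define Q where "Q = \<Phi> (1 - p)"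
  have P: "projection P" and Q: "projection Q"
    using projection_image p projection_compl[OF p] by (auto simp: P_def Q_def)
  have PQ: "P * Q = 0" using orthogonal_image[OF p] by (simp add: P_def Q_def)
  have QP: "Q * P = 0" using arg_cong[OF PQ, of adj] P Q by (simp add: adj_simps projection_def)
  have "projection (P + Q)" using P Q PQ QP by (simp add: projection_def adj_simps algebra_simps)
  hence PQE: "P + Q \<in> EFF" by (rule projection_EFF)
  then obtain x where x: "x \<in> EFF" "\<Phi> x = P + Q" using surj by blast
  have "P \<sqsubseteq> P + Q" "Q \<sqsubseteq> P + Q" using projection_positive P Q by (auto simp: cle_def)
  hence "p \<sqsubseteq> x" "1 - p \<sqsubseteq> x"
    using x le_iff[of p x] le_iff[of "1 - p" x] projection_EFF[OF p] projection_EFF[OF projection_compl[OF p]]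
    by (auto simp: P_def Q_def)
  hence "1 - x \<sqsubseteq> 1 - p" "1 - x \<sqsubseteq> p" by (simp, simp add: cle_def algebra_simps)
  moreover have "positive (1 - x)" using x(1) by (simp add: EFF_iff cle_def)
  ultimately have "(1 - p) * (1 - x) = 1 - x" "p * (1 - x) = 1 - x"
    using le_projection(1) p projection_compl[OF p] by blast+
  hence "1 - x = 0" by (simp only: left_diff_distrib) simp
  hence "x = 1" by simp
  hence "P + Q = 1" using x one by simp
  thus ?thesis by (simp add: P_def Q_def algebra_simps)
qed

text \<open>The elements \<open>y = \<Phi> (a p)\<close> and \<open>w = \<Phi> (a p + (1 - p))\<close> squeeze \<open>\<Phi> a\<close>, and they coincide on the corner
  of \<open>\<Phi> p\<close>.\<close>

lemma commuting_image:
  assumes p: "projection p" and a: "a \<in> EFF" and ap: "a * p = p * a"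
  shows "\<Phi> a * \<Phi> p = \<Phi> (a * p)" "\<Phi> p * \<Phi> a = \<Phi> (a * p)"
proof -
  define P where "P = \<Phi> p"
  define y where "y = \<Phi> (a * p)"
  define w where "w = \<Phi> (a * p + (1 - p))"
  have P: "projection P" using projection_image p by (auto simp: P_def)
  note pp = projection_idem[OF p] and pE = projection_EFF[OF p] and p'E = projection_EFF[OF projection_compl[OF p]]
  have i1: "eff_inf (a * p) a p" by (rule eff_inf_commuting[OF p a ap])
  have s1: "eff_sup (a * p + (1 - p)) a (1 - p)" by (rule eff_sup_commuting[OF p a ap])
  have E1: "a * p + (1 - p) \<in> EFF" using s1 by (simp add: eff_sup_def)
  have "(a * p + (1 - p)) * p = a * p" "p * (a * p + (1 - p)) = a * p"
    using pp ap by (simp_all add: algebra_simps projection_idem_left[OF p])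
  hence i2: "eff_inf (a * p) (a * p + (1 - p)) p" using eff_inf_commuting[OF p E1] by simp
  have ya: "eff_inf y (\<Phi> a) P" using eff_inf_image[OF i1 a pE] by (simp add: y_def P_def)
  have wa: "eff_sup w (\<Phi> a) (1 - P)"
    using eff_sup_image[OF s1 a p'E] compl_image[OF p] by (simp add: w_def P_def)
  have yw: "eff_inf y w P" using eff_inf_image[OF i2 E1 pE] by (simp add: y_def w_def P_def)
  have wE: "w \<in> EFF" and Pw: "1 - P \<sqsubseteq> w" and aw: "\<Phi> a \<sqsubseteq> w" using wa by (auto simp: eff_sup_def)
  have "positive (1 - w)" "1 - w \<sqsubseteq> P" using wE Pw by (auto simp: EFF_iff cle_def algebra_simps)
  hence "P * (1 - w) = 1 - w" "(1 - w) * P = 1 - w" using le_projection P by blast+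
  hence wP: "w * P = P * w" by (simp add: algebra_simps)
  have "y = w * P" by (rule eff_inf_unique[OF yw eff_inf_commuting[OF P wE wP]])
  define d where "d = \<Phi> a - y"
  have d: "positive d" using ya by (simp add: d_def eff_inf_def cle_def)
  have yP: "y * P = y" "P * y = y"
    using ya le_projection[of y P] P by (auto simp: eff_inf_def EFF_iff)
  have "P * (\<Phi> a - y) * P \<sqsubseteq> P * (w - y) * P"
    by (rule cle_conj'[OF _ projection_selfadj[OF P]]) (use aw in simp)
  also have "P * (w - y) * P = 0"
    using \<open>y = w * P\<close> wP yP by (simp add: right_diff_distrib left_diff_distrib mult.assoc)
  finally have "adj P * d * P = 0"
    using positive_conj'[OF d projection_selfadj[OF P]] P
    by (intro cle_antisym) (auto simp: d_def cle_0_iff projection_def)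
  hence dP: "d * P = 0" by (rule positive_zero_corner[OF d])
  thus "\<Phi> a * \<Phi> p = \<Phi> (a * p)" using yP by (simp add: d_def algebra_simps P_def y_def)
  have "adj (d * P) = P * d" using positive_selfadj[OF d] P by (simp add: adj_simps selfadj_def projection_def)
  hence "P * d = 0" using dP by simp
  thus "\<Phi> p * \<Phi> a = \<Phi> (a * p)" using yP by (simp add: d_def algebra_simps P_def y_def)
qed

text \<open>Both \<open>q\<close> and \<open>1 - q\<close> compress to \<open>e / 2\<close>, so \<open>\<Phi> (2 e / 3)\<close> is the corner inverse of both
  \<open>2 - P Q P\<close> and \<open>2 - P (1 - Q) P\<close>, whose sum is \<open>4 - P\<close>.\<close>

lemma two_thirds_halvable:
  assumes e: "projection e" and q: "projection q" and eqe: "e * q * e = (1/2) *\<^sub>R e"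
  shows "\<Phi> ((2/3) *\<^sub>R e) = (2/3) *\<^sub>R \<Phi> e"
proof -
  define P where "P = \<Phi> e"
  define Y where "Y = \<Phi> ((2/3) *\<^sub>R e)"
  have P: "projection P" using projection_image e by (auto simp: P_def)
  have *: "Y * P = Y \<and> Y * (2 - P * \<Phi> r * P) = P" if r: "projection r" and ere: "e * r * e = (1/2) *\<^sub>R e" for r
  proof -
    obtain y where y: "eff_inf y ((1/2) *\<^sub>R (1 + r)) e" "y * e = y" "y * (2 - e * r * e) = e"
      using eff_inf_two_projections[OF e r] by blast
    have "y * 2 - (1/2) *\<^sub>R y = e" using y(2,3) ere by (simp add: right_diff_distrib)
    moreover have "y * 2 = 2 *\<^sub>R y" unfolding one_add_one[where 'a='a, symmetric] by (simp add: distrib_left scaleR_2 del: one_add_one)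
    ultimately have "(3/2) *\<^sub>R y = e" by (simp flip: scaleR_left_diff_distrib)
    hence "y = (2/3) *\<^sub>R e" by auto
    hence "eff_inf Y ((1/2) *\<^sub>R (1 + \<Phi> r)) P"
      using eff_inf_image[OF y(1) mid_EFF[OF r] projection_EFF[OF e]] mid_projection[OF r] by (simp add: Y_def P_def)
    moreover obtain z where z: "eff_inf z ((1/2) *\<^sub>R (1 + \<Phi> r)) P" "z * P = z" "z * (2 - P * \<Phi> r * P) = P"
      using eff_inf_two_projections[OF P projection_image[OF r]] by blast
    ultimately show ?thesis using eff_inf_unique by blast
  qed
  have "e * (1 - q) * e = (1/2) *\<^sub>R e"
  proof -
    have "e * (1 - q) * e = e - (1/2) *\<^sub>R e" using eqe projection_idem[OF e] by (simp add: right_diff_distrib left_diff_distrib)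
    also have "\<dots> = (1 - 1/2) *\<^sub>R e" unfolding scaleR_left_diff_distrib by simp
    finally show ?thesis by simp
  qed
  from *[OF q eqe] *[OF projection_compl[OF q] this]
  have YP: "Y * P = Y" and 1: "Y * (2 - P * \<Phi> q * P) = P" and 2: "Y * (2 - P * (1 - \<Phi> q) * P) = P"
    by (auto simp: compl_image[OF q])
  have y2: "Y * 2 = 2 *\<^sub>R Y" unfolding one_add_one[where 'a='b, symmetric] by (simp add: distrib_left scaleR_2 del: one_add_one)
  have "P + P = Y * (2 - P * \<Phi> q * P) + Y * (2 - P * (1 - \<Phi> q) * P)" using 1 2 by simp
  also have "\<dots> = Y * 2 + Y * 2 - Y * (P * P)"
    by (simp add: right_diff_distrib left_diff_distrib mult.assoc projection_idem[OF P])
  also have "\<dots> = 4 *\<^sub>R Y - Y" using YP y2 projection_idem[OF P] by (simp flip: scaleR_left.add)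
  also have "\<dots> = 3 *\<^sub>R Y" using scaleR_left_diff_distrib[of 4 1 Y] by simp
  finally have "2 *\<^sub>R P = 3 *\<^sub>R Y" by (simp add: scaleR_2)
  hence "(1/3) *\<^sub>R (2 *\<^sub>R P) = Y" by simp
  thus ?thesis by (simp add: P_def Y_def)
qed

text \<open>The annihilator projection \<open>R\<close> of \<open>m - 2/3\<close> is the image of a
  projection \<open>z\<close>. By \<open>two_thirds_halvable\<close>, \<open>z\<close> lies above
  every \<open>e\<close> that can be halved, and \<open>no_type_I1_halvable\<close> gives
  \<open>z = 1\<close>.\<close>

lemma two_thirds: "\<Phi> (of_real (2/3)) = of_real (2/3)"
proof -
  define m where "m = \<Phi> (of_real (2/3))"
  have c23: "of_real (2/3) \<in> (EFF :: 'a set)" by (simp only: EFF_of_real) simp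
  obtain R where R: "projection R" "(m - of_real (2/3)) * R = 0" "\<And>x. (m - of_real (2/3)) * x = 0 \<Longrightarrow> R * x = x"
    using AW_star_annihilator[OF AWB] by blast
  obtain z where z: "z \<in> EFF" "\<Phi> z = R" using surj[OF projection_EFF[OF R(1)]] by blast
  have pz: "projection z" using projection_iff[OF z(1)] z(2) R(1) by simp
  have "z = 1"
  proof (rule no_type_I1_halvable[OF AWA noI1 pz])
    fix e q :: 'a assume e: "projection e" and q: "projection q" "e * q * e = (1/2) *\<^sub>R e"
    have "m * \<Phi> e = \<Phi> (of_real (2/3) * e)"
      unfolding m_def by (rule commuting_image(1)[OF e c23 of_real_commute])
    also have "\<dots> = of_real (2/3) * \<Phi> e"
      using two_thirds_halvable[OF e q] by (simp only: scaleR_conv_of_real)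
    finally have "R * \<Phi> e = \<Phi> e" by (intro R(3)) (simp add: left_diff_distrib)
    hence "\<Phi> e \<sqsubseteq> \<Phi> z" using projection_le_iff[OF projection_image[OF e] R(1)] z(2) by simp
    thus "e \<sqsubseteq> z" using le_iff[OF projection_EFF[OF e] z(1)] by simp
  qed
  hence "R = 1" using z(2) one by simp
  thus ?thesis using R(2) by (simp add: m_def)
qed

end

section \<open>Density of the fixed scalars\<close>

lemma ival_of_real_subset:
  assumes "0 \<le> s" "t \<le> 1"
  shows "ival (of_real s) (of_real t) \<subseteq> (EFF :: 'c::cstar_algebra set)"
proof
  fix x :: 'c assume x: "x \<in> ival (of_real s) (of_real t)"
  have "0 \<sqsubseteq> (of_real s :: 'c)" "of_real t \<sqsubseteq> (1 :: 'c)"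
    using assms cle_of_real[of t 1, where 'a='c] by (simp_all add: cle_0_iff)
  thus "x \<in> EFF" using x unfolding EFF_ival ival_def using cle_trans by blast
qed

lemma one_minus_of_real: "1 - of_real r = (of_real (1 - r) :: 'c::real_algebra_1)"
  by simp

context eff_iso
begin

lemma dual: "eff_iso (\<lambda>a. 1 - \<Phi> (1 - a))"
proof (intro eff_iso.intro AWA AWB noI1)
  show "order_iso_on (\<lambda>a. 1 - \<Phi> (1 - a)) EFF EFF"
  proof (rule order_iso_onI)
    fix b :: 'b assume "b \<in> EFF"
    then obtain x where x: "x \<in> EFF" "\<Phi> x = 1 - b" using surj[of "1 - b"] by auto
    show "\<exists>a\<in>EFF. 1 - \<Phi> (1 - a) = b" by (rule bexI[of _ "1 - x"]) (use x in simp_all)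
  qed (simp_all add: in_EFF le_iff)
  show "1 - \<Phi> (1 - of_real (1/2)) = of_real (1/2)"
    unfolding one_minus_of_real using half by (simp del: of_real_divide) (simp add: one_minus_of_real del: of_real_divide)
qed

lemma one_third: "\<Phi> (of_real (1/3)) = of_real (1/3)"
proof -
  have "1 - \<Phi> (of_real (1 - 2/3)) = of_real (2/3)"
    using eff_iso.two_thirds[OF dual] unfolding one_minus_of_real .
  hence "\<Phi> (of_real (1 - 2/3)) = 1 - of_real (2/3)" by (metis diff_diff_eq2 add_diff_cancel_left')
  thus ?thesis unfolding one_minus_of_real by (simp del: of_real_divide)
qed

lemma rescale:
  assumes st: "0 \<le> s" "s < t" "t \<le> 1"
    and fp: "\<Phi> (of_real s) = of_real s" "\<Phi> (of_real t) = of_real t"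
      "\<Phi> (of_real ((s + t) / 2)) = of_real ((s + t) / 2)"
  shows "eff_iso (\<lambda>a. (1 / (t - s)) *\<^sub>R (\<Phi> (of_real s + (t - s) *\<^sub>R a) - of_real s))" (is "eff_iso ?\<Psi>")
proof (intro eff_iso.intro AWA AWB noI1)
  define r where "r = t - s"
  have r: "r > 0" and rs: "r + s = t" using st by (auto simp: r_def)
  have i1: "order_iso_on (\<lambda>x. of_real s + r *\<^sub>R x) EFF (ival (of_real s) (of_real t :: 'a))"
    using order_iso_on_affine[OF r, of "of_real s :: 'a" 0 1] rs
    by (simp add: EFF_ival of_real_def add.commute flip: scaleR_left.add)
  have i2: "order_iso_on \<Phi> (ival (of_real s) (of_real t)) (ival (of_real s) (of_real t))"
    using order_iso_on_restrict[OF iso, of "of_real s" "of_real t"] ival_of_real_subset[OF st(1,3), where 'c='a]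
      ival_of_real_subset[OF st(1,3), where 'c='b] fp st by simp
  have i3: "order_iso_on (\<lambda>x. of_real (- s / r) + (1 / r) *\<^sub>R x) (ival (of_real s) (of_real t :: 'b)) EFF"
  proof -
    have "- s / r + 1 / r * s = 0" "- s / r + 1 / r * t = 1" using r rs by (auto simp: field_simps)
    hence "of_real (- s / r) + (1 / r) *\<^sub>R of_real s = (0 :: 'b)" "of_real (- s / r) + (1 / r) *\<^sub>R of_real t = (1 :: 'b)"
      by (metis of_real_0 of_real_1 of_real_add of_real_mult scaleR_conv_of_real)+
    thus ?thesis
      using order_iso_on_affine[of "1 / r" "of_real (- s / r) :: 'b" "of_real s" "of_real t"] r
      by (simp only: EFF_ival) simp
  qed
  have "order_iso_on (\<lambda>x. of_real (- s / r) + (1 / r) *\<^sub>R \<Phi> (of_real s + r *\<^sub>R x)) EFF EFF"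
    by (rule order_iso_on_comp[OF order_iso_on_comp[OF i1 i2] i3])
  moreover have "?\<Psi> = (\<lambda>x. of_real (- s / r) + (1 / r) *\<^sub>R \<Phi> (of_real s + r *\<^sub>R x))"
    by (rule ext) (simp add: r_def of_real_def scaleR_diff_right)
  ultimately show "order_iso_on ?\<Psi> EFF EFF" by simp
  have "of_real s + (t - s) *\<^sub>R of_real (1/2) = (of_real ((s + t) / 2) :: 'a)"
    by (simp add: of_real_def field_simps flip: scaleR_left.add)
  moreover have "(1 / (t - s)) *\<^sub>R (of_real ((s + t) / 2) - of_real s) = (of_real (1/2) :: 'b)"
    using st by (simp add: of_real_def flip: scaleR_left_diff_distrib)
  ultimately show "?\<Psi> (of_real (1/2)) = of_real (1/2)" using fp(3) by simp
qed

definition fixed :: "real \<Rightarrow> bool" where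
  "fixed r \<longleftrightarrow> 0 \<le> r \<and> r \<le> 1 \<and> \<Phi> (of_real r) = of_real r"

text \<open>The rescaled restriction to the interval from \<open>r - d\<close> to
  \<open>r + d\<close> fixes 1/2, hence also 1/3 and 2/3, which correspond to
  \<open>r - d / 3\<close> and \<open>r + d / 3\<close>.\<close>

lemma fixed_thirds:
  assumes "fixed (r - d)" "fixed r" "fixed (r + d)" "d > 0"
  shows "fixed (r - d / 3)" "fixed (r + d / 3)"
proof -
  define s t where "s = r - d" and "t = r + d"
  have st: "0 \<le> s" "s < t" "t \<le> 1" "t - s = 2 * d" "(s + t) / 2 = r"
    using assms by (auto simp: s_def t_def fixed_def)
  have E: "eff_iso (\<lambda>a. (1 / (t - s)) *\<^sub>R (\<Phi> (of_real s + (t - s) *\<^sub>R a) - of_real s))"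
    using rescale[OF st(1-3)] st(5) assms by (simp add: s_def t_def fixed_def)
  have eq: "\<Phi> (of_real (s + 2 * d * u)) = of_real (s + 2 * d * u)"
    if "(1 / (t - s)) *\<^sub>R (\<Phi> (of_real s + (t - s) *\<^sub>R of_real u) - of_real s) = of_real u" for u
  proof -
    have "(2 * d) *\<^sub>R ((1 / (2 * d)) *\<^sub>R (\<Phi> (of_real (s + 2 * d * u)) - of_real s)) = (2 * d) *\<^sub>R of_real u"
      using that unfolding st(4) by (simp add: scaleR_conv_of_real)
    hence "\<Phi> (of_real (s + 2 * d * u)) - of_real s = (2 * d) *\<^sub>R of_real u" using assms(4) by simp
    hence "\<Phi> (of_real (s + 2 * d * u)) = of_real s + (2 * d) *\<^sub>R of_real u" by (metis diff_eq_eq add.commute)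
    thus ?thesis by (simp only: scaleR_conv_of_real of_real_mult[symmetric] of_real_add[symmetric])
  qed
  have "s + 2 * d * (1/3) = r - d / 3" "s + 2 * d * (2/3) = r + d / 3" by (simp_all add: s_def field_simps)
  hence "\<Phi> (of_real (r - d / 3)) = of_real (r - d / 3)" "\<Phi> (of_real (r + d / 3)) = of_real (r + d / 3)"
    using eq[OF eff_iso.one_third[OF E]] eq[OF eff_iso.two_thirds[OF E]] by metis+
  thus "fixed (r - d / 3)" "fixed (r + d / 3)"
    using assms unfolding fixed_def by auto
qed

text \<open>The two new points split the interval into overlapping pieces, from \<open>r - d\<close>
  to \<open>r + d / 3\<close> and from \<open>r - d / 3\<close> to \<open>r + d\<close>. Their
  midpoints are again the new fixed points, so the recursion can continue, with half-length
  \<open>2 d / 3\<close>.\<close>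

lemma fixed_triples:
  assumes "0 \<le> x" "x \<le> 1"
  shows "\<exists>r d. fixed (r - d) \<and> fixed r \<and> fixed (r + d) \<and> 0 < d \<and> d \<le> (2/3) ^ n \<and> r - d \<le> x \<and> x \<le> r + d"
proof (induction n)
  case 0
  show ?case
    by (rule exI[of _ "1/2"], rule exI[of _ "1/2"]) (use assms zero one half in \<open>simp add: fixed_def\<close>)
next
  case (Suc n)
  then obtain r d where rd: "fixed (r - d)" "fixed r" "fixed (r + d)" "0 < d" "d \<le> (2/3) ^ n" "r - d \<le> x" "x \<le> r + d"
    by blast
  note th = fixed_thirds[OF rd(1-4)]
  show ?case
  proof (cases "x \<le> r")
    case True
    define r' d' where "r' = r - d / 3" and "d' = 2 * d / 3"
    have "r' - d' = r - d" "r' + d' = r + d / 3" by (simp_all add: r'_def d'_def)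
    moreover have "fixed r'" "0 < d'" "d' \<le> (2/3) ^ Suc n" using th rd by (simp_all add: r'_def d'_def)
    ultimately have "fixed (r' - d') \<and> fixed r' \<and> fixed (r' + d') \<and> 0 < d' \<and> d' \<le> (2/3) ^ Suc n \<and> r' - d' \<le> x \<and> x \<le> r' + d'"
      using th rd True by auto
    thus ?thesis by blast
  next
    case False
    define r' d' where "r' = r + d / 3" and "d' = 2 * d / 3"
    have "r' - d' = r - d / 3" "r' + d' = r + d" by (simp_all add: r'_def d'_def)
    moreover have "fixed r'" "0 < d'" "d' \<le> (2/3) ^ Suc n" using th rd by (simp_all add: r'_def d'_def)
    ultimately have "fixed (r' - d') \<and> fixed r' \<and> fixed (r' + d') \<and> 0 < d' \<and> d' \<le> (2/3) ^ Suc n \<and> r' - d' \<le> x \<and> x \<le> r' + d'"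
      using th rd False by auto
    thus ?thesis by blast
  qed
qed

lemma of_real_image:
  assumes x: "0 \<le> x" "x \<le> 1" shows "\<Phi> (of_real x) = of_real x"
proof -
  have "\<Phi> (of_real x) - of_real x = 0"
  proof (rule eq_0_of_cle_small)
    fix e :: real assume "e > 0"
    then obtain n where n: "(2/3) ^ n < e / 2" using real_arch_pow_inv[of "e / 2" "2/3"] by auto
    obtain r d where rd: "fixed (r - d)" "fixed (r + d)" "0 < d" "d \<le> (2/3) ^ n" "r - d \<le> x" "x \<le> r + d"
      using fixed_triples[OF x] by blast
    have E: "of_real (r - d) \<in> (EFF :: 'a set)" "of_real x \<in> (EFF :: 'a set)" "of_real (r + d) \<in> (EFF :: 'a set)"
      using rd x unfolding EFF_of_real fixed_def by auto
    have "\<Phi> (of_real (r - d)) \<sqsubseteq> \<Phi> (of_real x)" "\<Phi> (of_real x) \<sqsubseteq> \<Phi> (of_real (r + d))"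
      unfolding le_iff[OF E(1,2)] le_iff[OF E(2,3)] cle_of_real using rd by auto
    moreover have "\<Phi> (of_real (r - d)) = of_real (r - d)" "\<Phi> (of_real (r + d)) = of_real (r + d)"
      using rd unfolding fixed_def by blast+
    ultimately have "of_real (r - d) \<sqsubseteq> \<Phi> (of_real x)" "\<Phi> (of_real x) \<sqsubseteq> of_real (r + d)"
      by simp_all
    moreover have "of_real (x - e) \<sqsubseteq> (of_real (r - d) :: 'b)" "of_real (r + d) \<sqsubseteq> (of_real (x + e) :: 'b)"
      unfolding cle_of_real using rd n by auto
    ultimately have "of_real (x - e) \<sqsubseteq> \<Phi> (of_real x)" "\<Phi> (of_real x) \<sqsubseteq> of_real (x + e)"
      using cle_trans by blast+
    thus "- of_real e \<sqsubseteq> \<Phi> (of_real x) - of_real x \<and> \<Phi> (of_real x) - of_real x \<sqsubseteq> of_real e"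
      by (simp add: cle_def algebra_simps)
  qed
  thus ?thesis by simp
qed

lemma scaleR_projection_image:
  assumes p: "projection p" and r: "0 \<le> r" "r \<le> 1"
  shows "\<Phi> (r *\<^sub>R p) = r *\<^sub>R \<Phi> p"
proof -
  have "of_real r \<in> (EFF :: 'a set)" using r by simp
  from commuting_image(1)[OF p this of_real_commute] of_real_image[OF r] show ?thesis
    by (simp add: scaleR_conv_of_real)
qed

lemma image_split:
  assumes p: "projection p" and a: "a \<in> EFF" and ap: "a * p = p * a"
  shows "\<Phi> a = \<Phi> (a * p) + \<Phi> (a * (1 - p))"
proof -
  have "\<Phi> a = \<Phi> a * \<Phi> p + \<Phi> a * \<Phi> (1 - p)" by (simp add: compl_image[OF p] right_diff_distrib)
  also have "\<dots> = \<Phi> (a * p) + \<Phi> (a * (1 - p))"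
    using commuting_image(1)[OF p a ap] commuting_image(1)[OF projection_compl[OF p] a] ap
    by (simp add: algebra_simps)
  finally show ?thesis .
qed

end

text \<open>The spectrum of \<open>a\<close> is cut into \<open>n\<close> slices of length
  \<open>d\<close>. On one slice both maps take values between the same two multiples of the image
  of a projection, so they differ by at most \<open>d\<close> times it. Measuring the error against
  \<open>\<Phi> p\<close> instead of 1 lets the errors of orthogonal slices add up to
  \<open>d\<close> and not to \<open>n d\<close>.\<close>

lemma eff_iso_approx_unique:
  fixes \<Phi> \<Psi> :: "'a::cstar_algebra \<Rightarrow> 'b::cstar_algebra"
  assumes A: "eff_iso \<Phi>" and B: "eff_iso \<Psi>" and agree: "\<And>p. projection p \<Longrightarrow> \<Phi> p = \<Psi> p"
    and d: "d > 0"
  shows "projection p \<Longrightarrow> l *\<^sub>R p \<sqsubseteq> a \<Longrightarrow> a \<sqsubseteq> (l + real n * d) *\<^sub>R p \<Longrightarrow> 0 \<le> l \<Longrightarrow> l + real n * d \<le> 1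
    \<Longrightarrow> - (d *\<^sub>R \<Phi> p) \<sqsubseteq> \<Phi> a - \<Psi> a \<and> \<Phi> a - \<Psi> a \<sqsubseteq> d *\<^sub>R \<Phi> p"
proof (induction n arbitrary: p a)
  case 0
  hence "a = l *\<^sub>R p" by (intro cle_antisym) auto
  hence "\<Phi> a - \<Psi> a = 0"
    using eff_iso.scaleR_projection_image[OF A] eff_iso.scaleR_projection_image[OF B] 0 agree by simp
  moreover have "positive (d *\<^sub>R \<Phi> p)"
    using eff_iso.projection_image[OF A] 0 d by (simp add: positive_scaleR projection_positive)
  ultimately show ?case by (simp add: cle_def)
next
  case (Suc n)
  interpret A: eff_iso \<Phi> by (rule A)
  interpret B: eff_iso \<Psi> by (rule B)
  note p = Suc.prems(1)
  have nd: "0 \<le> real n * d" using d by simp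
  have s1: "l + real (Suc n) * d = (l + real n * d) + d" by (simp add: algebra_simps)
  define m where "m = l + real n * d"
  have m: "0 \<le> m" "m + d \<le> 1" "l \<le> m" using Suc.prems(4,5) nd d unfolding s1 by (auto simp: m_def)
  have pa: "positive a"
    using positive_mono[OF _ Suc.prems(2)] Suc.prems(4) p by (simp add: positive_scaleR projection_positive)
  have "a \<sqsubseteq> (m + d) *\<^sub>R p" using Suc.prems(3) unfolding s1 m_def .
  moreover have "(m + d) *\<^sub>R p \<sqsubseteq> p" using cle_scaleR_left[OF projection_positive[OF p] m(2)] by simp
  ultimately have up: "a \<sqsubseteq> (m + d) *\<^sub>R p" and ap: "a \<sqsubseteq> p" using cle_trans by blast+
  have aE: "a \<in> EFF" by (rule EFF_mono[OF pa ap projection_EFF[OF p]])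
  have pa1: "p * a = a" "a * p = a" using le_projection[OF pa ap p] by auto
  \<comment> \<open>Cuts off the top slice: \<open>f\<close> will carry the part of \<open>a\<close>
    between \<open>m\<close> and \<open>m + d\<close>, and the induction hypothesis applies to
    \<open>g = p - f\<close>, where \<open>a\<close> is at most \<open>m\<close>.\<close>
  obtain e where e: "projection e" "of_real m * e \<sqsubseteq> a * e" "a * (1 - e) \<sqsubseteq> of_real m * (1 - e)"
    and ec: "\<And>c. c * a = a * c \<Longrightarrow> c * e = e * c"
    using spectral_projection[OF A.AWA positive_selfadj[OF pa]] by blast
  have pe: "p * e = e * p" using ec[of p] pa1 by simp
  have ae: "a * e = e * a" using ec[of a] by simp
  define f where "f = e * p"
  define g where "g = p - f"
  have ff: "projection f" unfolding projection_def f_def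
    using p e(1) pe by (simp add: adj_simps projection_def) (metis mult.assoc)
  have pf: "p * f = f" and fp: "f * p = f"
    using pe projection_idem[OF p] by (metis f_def mult.assoc)+
  have gg: "projection g"
    using p ff pf fp by (simp add: projection_def g_def adj_simps right_diff_distrib left_diff_distrib)
  have af: "a * f = f * a" using ae pa1 by (metis f_def mult.assoc)
  have ag: "a * g = a * (1 - f)" using pa1 by (simp add: g_def right_diff_distrib)
  have ga: "a * g = g * a" using af pa1 by (simp add: g_def right_diff_distrib left_diff_distrib)
  have pg: "p * (1 - f) = g" using pf by (simp add: g_def right_diff_distrib)
  have conj_eq: "q * a * q = a * q" if "projection q" "a * q = q * a" for q
    using that projection_idem[OF that(1)] by (metis mult.assoc)
  have fpf: "f * p * f = f" "g * p * g = g" "p * e * p = f"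
    using pf fp pe projection_idem[OF ff] projection_idem[OF gg] projection_idem[OF p]
    by (simp_all add: g_def f_def mult.assoc left_diff_distrib right_diff_distrib)
  have pme: "p * (1 - e) * p = g"
    using fpf(3) projection_idem[OF p] by (simp add: g_def right_diff_distrib left_diff_distrib)
  have lf: "m *\<^sub>R f \<sqsubseteq> a * f"
  proof -
    have "p * (of_real m * e) * p \<sqsubseteq> p * (a * e) * p" by (rule cle_conj'[OF e(2) projection_selfadj[OF p]])
    moreover have "p * (of_real m * e) * p = m *\<^sub>R f" using fpf(3) by (simp add: of_real_def)
    moreover have "p * (a * e) * p = a * f" using pa1 by (simp add: f_def flip: mult.assoc)
    ultimately show ?thesis by simp
  qed
  have uf: "a * f \<sqsubseteq> (m + d) *\<^sub>R f"
    using cle_conj'[OF up projection_selfadj[OF ff]] conj_eq[OF ff af] fpf(1) by simp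
  have lg: "l *\<^sub>R g \<sqsubseteq> a * g"
    using cle_conj'[OF Suc.prems(2) projection_selfadj[OF gg]] conj_eq[OF gg ga] fpf(2) by simp
  have ug: "a * g \<sqsubseteq> (l + real n * d) *\<^sub>R g"
  proof -
    have "p * (a * (1 - e)) * p \<sqsubseteq> p * (of_real m * (1 - e)) * p" by (rule cle_conj'[OF e(3) projection_selfadj[OF p]])
    moreover have "p * (of_real m * (1 - e)) * p = m *\<^sub>R g" using pme by (simp add: of_real_def)
    moreover have "p * (a * (1 - e)) * p = a * g"
    proof -
      have "p * (a * (1 - e)) * p = a * ((1 - e) * p)" using pa1(1) by (metis mult.assoc)
      thus ?thesis using pa1(2) by (simp add: g_def f_def left_diff_distrib right_diff_distrib)
    qed
    ultimately show ?thesis by (simp add: m_def)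
  qed
  have IH: "- (d *\<^sub>R \<Phi> g) \<sqsubseteq> \<Phi> (a * g) - \<Psi> (a * g) \<and> \<Phi> (a * g) - \<Psi> (a * g) \<sqsubseteq> d *\<^sub>R \<Phi> g"
    by (rule Suc.IH[OF gg lg ug Suc.prems(4)]) (use m d in \<open>simp add: m_def\<close>)
  have afE: "a * f \<in> EFF"
    by (rule EFF_mono[OF positive_mult_projection[OF pa ff af] aE])
  have fE: "r *\<^sub>R f \<in> EFF" if "0 \<le> r" "r \<le> 1" for r using EFF_scaleR[OF projection_EFF[OF ff] that] .
  have b1: "m *\<^sub>R \<Phi> f \<sqsubseteq> \<Phi> (a * f)" "\<Phi> (a * f) \<sqsubseteq> (m + d) *\<^sub>R \<Phi> f"
    using A.le_iff[OF fE[of m] afE] A.le_iff[OF afE fE[of "m + d"]] lf uf m d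
      A.scaleR_projection_image[OF ff] by simp_all
  have b2: "m *\<^sub>R \<Phi> f \<sqsubseteq> \<Psi> (a * f)" "\<Psi> (a * f) \<sqsubseteq> (m + d) *\<^sub>R \<Phi> f"
    using B.le_iff[OF fE[of m] afE] B.le_iff[OF afE fE[of "m + d"]] lf uf m d
      B.scaleR_projection_image[OF ff] agree[OF ff] by simp_all
  have f1: "\<Phi> (a * f) - \<Psi> (a * f) \<sqsubseteq> d *\<^sub>R \<Phi> f"
    using positive_add[OF b1(2)[unfolded cle_def] b2(1)[unfolded cle_def]] by (simp add: cle_def algebra_simps)
  have f2: "- (d *\<^sub>R \<Phi> f) \<sqsubseteq> \<Phi> (a * f) - \<Psi> (a * f)"
    using positive_add[OF b2(2)[unfolded cle_def] b1(1)[unfolded cle_def]] by (simp add: cle_def algebra_simps)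
  have "\<Phi> p = \<Phi> (p * f) + \<Phi> (p * (1 - f))"
    by (rule A.image_split[OF ff projection_EFF[OF p]]) (simp add: pf fp)
  hence Pp: "\<Phi> p = \<Phi> f + \<Phi> g" by (simp add: pf pg)
  have "\<Phi> a = \<Phi> (a * f) + \<Phi> (a * g)" "\<Psi> a = \<Psi> (a * f) + \<Psi> (a * g)"
    using A.image_split[OF ff aE af] B.image_split[OF ff aE af] ag by simp_all
  hence eq: "\<Phi> a - \<Psi> a = (\<Phi> (a * f) - \<Psi> (a * f)) + (\<Phi> (a * g) - \<Psi> (a * g))" by simp
  show ?case unfolding eq Pp
    using cle_add[OF f1 conjunct2[OF IH]] cle_add[OF f2 conjunct1[OF IH]] by (simp add: scaleR_add_right)
qed

lemma eff_iso_unique: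
  fixes \<Phi> \<Psi> :: "'a::cstar_algebra \<Rightarrow> 'b::cstar_algebra"
  assumes A: "eff_iso \<Phi>" and B: "eff_iso \<Psi>" and agree: "\<And>p. projection p \<Longrightarrow> \<Phi> p = \<Psi> p"
    and a: "a \<in> EFF"
  shows "\<Phi> a = \<Psi> a"
proof -
  have "\<Phi> a - \<Psi> a = 0"
  proof (rule eq_0_of_cle_small)
    fix e :: real assume "e > 0"
    then obtain n where n: "inverse (real (Suc n)) < e" using reals_Archimedean by blast
    define d where "d = inverse (real (Suc n))"
    have d: "d > 0" "real (Suc n) * d = 1" by (auto simp: d_def)
    have "- (d *\<^sub>R \<Phi> 1) \<sqsubseteq> \<Phi> a - \<Psi> a \<and> \<Phi> a - \<Psi> a \<sqsubseteq> d *\<^sub>R \<Phi> 1"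
      by (rule eff_iso_approx_unique[OF A B agree d(1), where l=0 and n="Suc n"])
         (use a d(2) in \<open>simp_all add: EFF_iff cle_0_iff del: of_nat_Suc\<close>)
    hence "- of_real d \<sqsubseteq> \<Phi> a - \<Psi> a \<and> \<Phi> a - \<Psi> a \<sqsubseteq> of_real d"
      using eff_iso.one[OF A] by (simp add: of_real_def)
    moreover have "of_real d \<sqsubseteq> (of_real e :: 'b)" using n by (simp add: d_def)
    moreover have "- of_real e \<sqsubseteq> (- of_real d :: 'b)" using n by (simp add: d_def)
    ultimately show "- of_real e \<sqsubseteq> \<Phi> a - \<Psi> a \<and> \<Phi> a - \<Psi> a \<sqsubseteq> of_real e" using cle_trans by blast
  qed
  thus ?thesis by simp
qed

section \<open>Affinity of normalised isomorphisms\<close>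

context eff_iso
begin

text \<open>The claim is that \<open>\<Phi>\<close> equals one of its own rescaled restrictions. By
  \<open>eff_iso_unique\<close> this needs checking on projections only, where splitting along
  \<open>p\<close> computes the value.\<close>

lemma affine_scalar:
  assumes s: "0 \<le> s" "0 < r" "s + r \<le> 1" and a: "a \<in> EFF"
  shows "\<Phi> (of_real s + r *\<^sub>R a) = of_real s + r *\<^sub>R \<Phi> a"
proof -
  have "eff_iso (\<lambda>a. (1 / (s + r - s)) *\<^sub>R (\<Phi> (of_real s + (s + r - s) *\<^sub>R a) - of_real s))"
    by (rule rescale) (use s in \<open>auto simp del: of_real_add of_real_divide intro!: of_real_image\<close>)
  hence E: "eff_iso (\<lambda>a. (1 / r) *\<^sub>R (\<Phi> (of_real s + r *\<^sub>R a) - of_real s))" by simp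
  have "(1 / r) *\<^sub>R (\<Phi> (of_real s + r *\<^sub>R a) - of_real s) = \<Phi> a"
  proof (rule eff_iso_unique[OF E eff_iso_axioms _ a])
    fix p :: 'a assume p: "projection p"
    define c where "c = of_real s + r *\<^sub>R p"
    have pc: "c * p = p * c" by (simp add: c_def algebra_simps of_real_def)
    have cp: "c * p = (s + r) *\<^sub>R p" "c * (1 - p) = s *\<^sub>R (1 - p)"
      using projection_idem[OF p] by (simp_all add: c_def algebra_simps of_real_def)
    have "positive c" unfolding c_def
      by (rule positive_add[OF _ positive_scaleR[OF projection_positive[OF p]]]) (use s in auto)
    moreover have "c \<sqsubseteq> 1"
    proof -
      have "r *\<^sub>R p \<sqsubseteq> r *\<^sub>R 1" using s by (intro cle_scaleR projection_le_one p) simp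
      hence "c \<sqsubseteq> of_real (s + r)" by (simp add: c_def of_real_def algebra_simps)
      also have "of_real (s + r) \<sqsubseteq> (of_real 1 :: 'a)" unfolding cle_of_real by (rule s)
      finally show ?thesis by simp
    qed
    ultimately have "c \<in> EFF" by (simp add: EFF_iff)
    from image_split[OF p this pc] have "\<Phi> c = (s + r) *\<^sub>R \<Phi> p + s *\<^sub>R (1 - \<Phi> p)"
      unfolding cp using s by (simp add: scaleR_projection_image p projection_compl compl_image)
    thus "(1 / r) *\<^sub>R (\<Phi> (of_real s + r *\<^sub>R p) - of_real s) = \<Phi> p"
      using s by (simp add: c_def algebra_simps of_real_def)
  qed
  hence "r *\<^sub>R ((1 / r) *\<^sub>R (\<Phi> (of_real s + r *\<^sub>R a) - of_real s)) = r *\<^sub>R \<Phi> a" by simp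
  thus ?thesis using s by (simp add: algebra_simps)
qed

lemma scaleR_image: "0 \<le> r \<Longrightarrow> r \<le> 1 \<Longrightarrow> a \<in> EFF \<Longrightarrow> \<Phi> (r *\<^sub>R a) = r *\<^sub>R \<Phi> a"
  using affine_scalar[of 0 r a] zero by (cases "r = 0") auto

text \<open>Conjugation by square roots turns the order unit \<open>b\<close> into \<open>1\<close>, and homogeneity says that midpoints are
  still preserved.\<close>

lemma affine_invertible:
  assumes b: "b \<in> EFF" "b \<in> PINV" and a: "positive a" "a \<sqsubseteq> b" and s: "0 \<le> s" "0 < r" "s + r \<le> 1"
  shows "\<Phi> (s *\<^sub>R b + r *\<^sub>R a) = s *\<^sub>R \<Phi> b + r *\<^sub>R \<Phi> a"
proof -
  obtain d where d: "d > 0" "of_real d \<sqsubseteq> b" using b PINV_iff by blast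
  define d' where "d' = min d 1"
  have d': "0 < d'" "d' \<le> 1" using d by (auto simp: d'_def)
  have "of_real d' \<sqsubseteq> (of_real d :: 'a)" by (simp add: d'_def)
  hence "of_real d' \<sqsubseteq> b" using d cle_trans by blast
  hence "\<Phi> (of_real d') \<sqsubseteq> \<Phi> b" using le_iff[of "of_real d'" b] d' b by simp
  hence BP: "\<Phi> b \<in> PINV" using of_real_image[of d'] d' PINV_iff by auto
  define k where "k = psqrt b"
  define K where "K = cinv (psqrt (\<Phi> b))"
  have kP: "k \<in> PINV" and KP: "K \<in> PINV" using PINV_psqrt PINV_cinv b BP by (auto simp: k_def K_def)
  have kk: "k * k = b" using psqrt(2)[OF PINV_positive[OF b(2)]] by (simp add: k_def)
  have KK: "K * \<Phi> b * K = 1" using cinv_psqrt_conj(1)[OF BP] by (simp add: K_def)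
  define \<Psi> where "\<Psi> x = K * \<Phi> (k * x * k) * K" for x
  have i1: "order_iso_on (\<lambda>x. k * x * k) EFF (ival 0 b)"
    using order_iso_on_conj[OF kP, of 0 1] kk by (simp add: EFF_ival)
  have "ival 0 b \<subseteq> EFF" "ival 0 (\<Phi> b) \<subseteq> EFF"
    using EFF_mono b(1) in_EFF[OF b(1)] by (auto simp: ival_def cle_0_iff)
  hence i2: "order_iso_on \<Phi> (ival 0 b) (ival 0 (\<Phi> b))"
    using order_iso_on_restrict[OF iso, of 0 b] b zero by simp
  have i3: "order_iso_on (\<lambda>x. K * x * K) (ival 0 (\<Phi> b)) EFF"
    using order_iso_on_conj[OF KP, of 0 "\<Phi> b"] KK by (simp add: EFF_ival)
  have "order_iso_on \<Psi> EFF EFF"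
    unfolding \<Psi>_def by (rule order_iso_on_comp[OF order_iso_on_comp[OF i1 i2] i3])
  moreover have "\<Psi> (of_real (1/2)) = of_real (1/2)"
  proof -
    have "k * of_real (1/2) * k = (1/2) *\<^sub>R b" using kk by (simp add: of_real_def)
    moreover have "\<Phi> ((1/2) *\<^sub>R b) = (1/2) *\<^sub>R \<Phi> b" by (rule scaleR_image) (use b in auto)
    ultimately show ?thesis using KK by (simp add: \<Psi>_def of_real_def)
  qed
  ultimately have E: "eff_iso \<Psi>" by (intro eff_iso.intro AWA AWB noI1)
  define a' where "a' = cinv k * a * cinv k"
  have ka: "k * a' * k = a" unfolding a'_def by (rule conj_cinv[OF kP])
  have "k * 0 * k \<sqsubseteq> k * a' * k" "k * a' * k \<sqsubseteq> k * 1 * k" using a ka kk by (simp_all add: cle_0_iff)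
  hence "a' \<in> EFF" unfolding conj_cle_iff[OF kP] by (simp add: EFF_iff cle_0_iff)
  from eff_iso.affine_scalar[OF E s this]
  have 1: "K * \<Phi> (k * (of_real s + r *\<^sub>R a') * k) * K = of_real s + r *\<^sub>R (K * \<Phi> a * K)"
    using ka by (simp add: \<Psi>_def)
  have "k * (of_real s + r *\<^sub>R a') * k = s *\<^sub>R b + r *\<^sub>R a"
    using kk ka by (simp add: of_real_def algebra_simps)
  moreover have "of_real s + r *\<^sub>R (K * \<Phi> a * K) = K * (s *\<^sub>R \<Phi> b + r *\<^sub>R \<Phi> a) * K"
    using KK by (simp add: of_real_def algebra_simps)
  ultimately have "K * \<Phi> (s *\<^sub>R b + r *\<^sub>R a) * K = K * (s *\<^sub>R \<Phi> b + r *\<^sub>R \<Phi> a) * K" using 1 by simp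
  thus ?thesis using conj_cinv(2)[OF KP] by metis
qed

end

section \<open>Extension to a Jordan isomorphism\<close>

lemma cscale_complex:
  fixes h k :: "'a::cstar_algebra"
  shows "cscale c (h + cscale \<i> k) = (Re c *\<^sub>R h - Im c *\<^sub>R k) + cscale \<i> (Im c *\<^sub>R h + Re c *\<^sub>R k)"
proof -
  have "cscale c y = Re c *\<^sub>R y + Im c *\<^sub>R cscale \<i> y" for y :: 'a
  proof -
    have "cscale (of_real (Re c) + of_real (Im c) * \<i>) y = Re c *\<^sub>R y + Im c *\<^sub>R cscale \<i> y"
      by (simp only: cscale_add_left scaleR_cscale cscale_cscale)
    moreover have "of_real (Re c) + of_real (Im c) * \<i> = c" by (simp add: complex_eq_iff)
    ultimately show ?thesis by simp
  qed
  thus ?thesis by (simp add: cscale_add_right cscale_scaleR cscale_ii_ii scaleR_add_right)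
qed

text \<open>Partial fractions: the identity expresses a square through sums and inverses, the route
  by which preservation of inverses leads to the Jordan product.\<close>

lemma cinv_one_pm:
  fixes y :: "'a::cstar_algebra"
  assumes "invertible_el (1 + y)" "invertible_el (1 + - y)"
  shows "cinv (1 + y) + cinv (1 + - y) = 2 *\<^sub>R cinv (1 + - (y * y))"
proof -
  define u v where "u = 1 + y" and "v = 1 + - y"
  have uv: "invertible_el u" "invertible_el v" "v + u = 2 *\<^sub>R 1" "v * u = 1 + - (y * y)"
    using assms by (simp_all add: u_def v_def algebra_simps scaleR_2)
  have "cinv u * (v + u) * cinv v = cinv u * (v * cinv v) + (cinv u * u) * cinv v"
    by (simp only: distrib_left distrib_right mult.assoc)
  hence "cinv u + cinv v = cinv u * (v + u) * cinv v" using cinv[OF uv(1)] cinv[OF uv(2)] by simp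
  also have "\<dots> = 2 *\<^sub>R cinv (v * u)" unfolding uv(3) by (simp add: invertible_mult(2)[OF uv(2,1)])
  finally show ?thesis unfolding uv(4) by (simp add: u_def v_def)
qed

lemma common_bound:
  fixes a b :: "'a::cstar_algebra"
  assumes "positive a" "positive b"
  shows "\<exists>k>0. a \<sqsubseteq> of_real k \<and> b \<sqsubseteq> of_real (k::real)"
proof (intro exI conjI)
  show "a \<sqsubseteq> of_real (norm a + norm b + 1)" by (rule cle_norm[OF positive_selfadj[OF assms(1)]]) simp
  show "b \<sqsubseteq> of_real (norm a + norm b + 1)" by (rule cle_norm[OF positive_selfadj[OF assms(2)]]) simp
  show "0 < norm a + norm b + 1" by (simp add: add_nonneg_pos)
qed

lemma selfadj_diff_positive: "selfadj x \<Longrightarrow> \<exists>u v. positive u \<and> positive v \<and> x = u - v" for x :: "'a::cstar_algebra"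
  using selfadj_positive_shift[of x] positive_of_real[of "norm x", where 'a='a]
  by (metis add_diff_cancel_right' norm_ge_zero)

lemma scaled_EFF:
  fixes a :: "'a::cstar_algebra"
  assumes "positive a" "k > 0" "a \<sqsubseteq> of_real k" shows "(1/k) *\<^sub>R a \<in> EFF"
proof -
  have "(1/k) *\<^sub>R a \<sqsubseteq> (1/k) *\<^sub>R of_real k" using assms by (intro cle_scaleR) auto
  thus ?thesis using assms by (simp add: EFF_iff positive_scaleR of_real_def)
qed

text \<open>This is \<open>(1 - a) / (1 + a)\<close>: inversion turned into an order reversing
  involution of the effects that exchanges \<open>p\<close> and \<open>1 - p\<close>.\<close>

definition hinv :: "'a::cstar_algebra \<Rightarrow> 'a" where "hinv a = 2 *\<^sub>R cinv (1 + a) - 1"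

lemma one_plus_PINV: "positive a \<Longrightarrow> 1 + a \<in> PINV" for a :: "'a::cstar_algebra"
  by (simp add: PINV_add)

lemma hinv_EFF:
  fixes a :: "'a::cstar_algebra"
  assumes a: "a \<in> EFF" shows "hinv a \<in> EFF"
proof -
  have P: "1 + a \<in> PINV" by (rule one_plus_PINV[OF EFF_positive[OF a]])
  have "cinv (1 + a) \<sqsubseteq> 1" by (rule cinv_le_one) (use EFF_positive[OF a] in \<open>simp add: cle_def\<close>)
  from cle_scaleR[OF this, of 2] have "hinv a \<sqsubseteq> 1"
    by (simp add: hinv_def cle_def scaleR_2 algebra_simps del: one_add_one)
  moreover have "1 + a \<sqsubseteq> 2 *\<^sub>R 1" using EFF_le_one[OF a] by (simp add: cle_def scaleR_2 del: one_add_one)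
  from cinv_antimono[OF P this] have "inverse 2 *\<^sub>R 1 \<sqsubseteq> cinv (1 + a)"
    using invertible_scaleR(2)[of "1::'a" 2] by simp
  from cle_scaleR[OF this, of 2] have "positive (hinv a)" by (simp add: hinv_def cle_def)
  ultimately show ?thesis by (simp add: EFF_iff)
qed

lemma hinv_hinv:
  fixes a :: "'a::cstar_algebra"
  assumes a: "positive a" shows "hinv (hinv a) = a"
proof -
  note P = PINV_invertible[OF one_plus_PINV[OF a]]
  have "cinv (1 + hinv a) = inverse 2 *\<^sub>R (1 + a)"
    using invertible_scaleR(2)[OF invertible_cinv[OF P], of 2] cinv_cinv[OF P] by (simp add: hinv_def)
  thus ?thesis by (simp add: hinv_def)
qed

lemma hinv_cle_iff:
  fixes a b :: "'a::cstar_algebra"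
  assumes "positive a" "positive b" shows "hinv b \<sqsubseteq> hinv a \<longleftrightarrow> a \<sqsubseteq> b"
  using cinv_cle_iff[OF one_plus_PINV[OF assms(1)] one_plus_PINV[OF assms(2)]] by (simp add: hinv_def)

lemma hinv_projection:
  fixes p :: "'a::cstar_algebra"
  assumes "projection p" shows "hinv p = 1 - p"
proof -
  have h: "(1/2) *\<^sub>R p + (1/2) *\<^sub>R p = p" by (simp flip: scaleR_left.add)
  have "(1 + p) * (1 - (1/2) *\<^sub>R p) = 1 + p - ((1/2) *\<^sub>R p + (1/2) *\<^sub>R p)"
    "(1 - (1/2) *\<^sub>R p) * (1 + p) = 1 + p - ((1/2) *\<^sub>R p + (1/2) *\<^sub>R p)"
    using projection_idem[OF assms] by (simp_all only: algebra_simps) simp_all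
  hence "(1 + p) * (1 - (1/2) *\<^sub>R p) = 1" "(1 - (1/2) *\<^sub>R p) * (1 + p) = 1" unfolding h by simp_all
  hence "cinv (1 + p) = 1 - (1/2) *\<^sub>R p" by (rule cinv_eq(2))
  thus ?thesis by (simp add: hinv_def scaleR_diff_right) (simp add: scaleR_2)
qed

lemma hinv_of_real:
  assumes "r \<ge> 0" shows "hinv (of_real r :: 'a::cstar_algebra) = of_real (2 / (1 + r) - 1)"
proof -
  have "cinv (of_real (1 + r) :: 'a) = of_real (inverse (1 + r))" using assms by (intro invertible_of_real(2)) simp
  hence "cinv (1 + of_real r :: 'a) = of_real (inverse (1 + r))" by simp
  thus ?thesis by (simp add: hinv_def of_real_def divide_inverse scaleR_diff_left)
qed

section \<open>From effects to the cone, the self-adjoint part and the whole algebra\<close>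

context eff_iso
begin

text \<open>The conjugate of \<open>\<Phi>\<close> by \<open>hinv\<close> agrees with
  \<open>\<Phi>\<close> on projections because \<open>hinv p = 1 - p\<close>. It fixes 1/2 because
  \<open>hinv\<close> exchanges 1/2 and 1/3 and \<open>\<Phi>\<close> fixes 1/3.\<close>

lemma hinv_image:
  assumes a: "a \<in> EFF" shows "\<Phi> (hinv a) = hinv (\<Phi> a)"
proof -
  define \<Psi> where "\<Psi> x = hinv (\<Phi> (hinv x))" for x
  have "order_iso_on \<Psi> EFF EFF"
  proof (rule order_iso_onI)
    fix b :: 'b assume b: "b \<in> EFF"
    then obtain x where x: "x \<in> EFF" "\<Phi> x = hinv b" using surj[OF hinv_EFF] by blast
    have "\<Psi> (hinv x) = b" using x b by (simp add: \<Psi>_def hinv_hinv EFF_positive)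
    thus "\<exists>a\<in>EFF. \<Psi> a = b" using hinv_EFF[OF x(1)] by blast
  qed (simp_all add: \<Psi>_def hinv_EFF in_EFF hinv_cle_iff EFF_positive le_iff)
  moreover have "\<Psi> (of_real (1/2)) = of_real (1/2)"
  proof -
    have "hinv (of_real (1/2) :: 'a) = of_real (1/3)" by (subst hinv_of_real) simp_all
    moreover have "hinv (of_real (1/3) :: 'b) = of_real (1/2)" by (subst hinv_of_real) simp_all
    ultimately show ?thesis by (simp only: \<Psi>_def one_third)
  qed
  ultimately have E: "eff_iso \<Psi>" by (intro eff_iso.intro AWA AWB noI1)
  have "\<Psi> a = \<Phi> a"
  proof (rule eff_iso_unique[OF E eff_iso_axioms _ a])
    fix p :: 'a assume p: "projection p"
    have "\<Psi> p = hinv (1 - \<Phi> p)" by (simp add: \<Psi>_def hinv_projection[OF p] compl_image[OF p])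
    thus "\<Psi> p = \<Phi> p" using hinv_projection[OF projection_compl[OF projection_image[OF p]]] by simp
  qed
  thus ?thesis using hinv_hinv[of "\<Phi> (hinv a)"] in_EFF[OF hinv_EFF[OF a]] by (simp add: \<Psi>_def EFF_positive)
qed

text \<open>The homogeneous extension. The scale \<open>norm a + 1\<close> is one admissible choice,
  with the 1 preventing division by zero; \<open>pext_eq\<close> shows independence of the
  scale.\<close>

definition pext :: "'a \<Rightarrow> 'b" where
  "pext a = (norm a + 1) *\<^sub>R \<Phi> ((1 / (norm a + 1)) *\<^sub>R a)"

lemma pext_scale_indep:
  assumes a: "positive a" and k: "0 < k" "k \<le> k'" "a \<sqsubseteq> of_real k"
  shows "k' *\<^sub>R \<Phi> ((1/k') *\<^sub>R a) = k *\<^sub>R \<Phi> ((1/k) *\<^sub>R a)"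
proof -
  have "(1/k') *\<^sub>R a = (k/k') *\<^sub>R ((1/k) *\<^sub>R a)" using k by simp
  moreover have "\<Phi> ((k/k') *\<^sub>R ((1/k) *\<^sub>R a)) = (k/k') *\<^sub>R \<Phi> ((1/k) *\<^sub>R a)"
    using k by (intro scaleR_image scaled_EFF a) auto
  ultimately show ?thesis using k by simp
qed

lemma pext_eq:
  assumes a: "positive a" and k: "0 < k" "a \<sqsubseteq> of_real k"
  shows "pext a = k *\<^sub>R \<Phi> ((1/k) *\<^sub>R a)"
proof -
  have n: "0 < norm a + 1" by (simp add: add_nonneg_pos)
  have an: "a \<sqsubseteq> of_real (norm a + 1)" by (rule cle_norm[OF positive_selfadj[OF a]]) simp
  show ?thesis
  proof (cases "k \<le> norm a + 1")
    case True
    show ?thesis unfolding pext_def by (rule pext_scale_indep[OF a k(1) True k(2)])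
  next
    case False
    hence "norm a + 1 \<le> k" by simp
    thus ?thesis unfolding pext_def by (rule pext_scale_indep[OF a n _ an, symmetric])
  qed
qed

lemma pext_EFF: "a \<in> EFF \<Longrightarrow> pext a = \<Phi> a"
  using pext_eq[of a 1] by (simp add: EFF_iff)

lemma pext_positive: "positive a \<Longrightarrow> positive (pext a)"
  using common_bound[of a a] pext_eq[of a] in_EFF[OF scaled_EFF[of a]]
  by (metis EFF_positive less_imp_le positive_scaleR)

lemma pext_cle_iff:
  assumes "positive a" "positive b" shows "pext a \<sqsubseteq> pext b \<longleftrightarrow> a \<sqsubseteq> b"
proof -
  obtain k where k: "k > 0" "a \<sqsubseteq> of_real k" "b \<sqsubseteq> of_real k" using common_bound[OF assms] by blast
  have "pext a \<sqsubseteq> pext b \<longleftrightarrow> (1/k) *\<^sub>R a \<sqsubseteq> (1/k) *\<^sub>R b"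
    using k assms by (simp add: pext_eq[OF _ k(1)] le_iff scaled_EFF)
  thus ?thesis using k by simp
qed

lemma pext_surj:
  assumes "positive b" shows "\<exists>a. positive a \<and> pext a = b"
proof -
  obtain k where k: "k > 0" "b \<sqsubseteq> of_real k" using common_bound[OF assms assms] by blast
  obtain x where x: "x \<in> EFF" "\<Phi> x = (1/k) *\<^sub>R b" using surj[OF scaled_EFF[OF assms k]] by blast
  have "k *\<^sub>R x \<sqsubseteq> k *\<^sub>R 1" using EFF_le_one[OF x(1)] k by simp
  hence "k *\<^sub>R x \<sqsubseteq> of_real k" by (simp add: of_real_def)
  moreover have "positive (k *\<^sub>R x)" using EFF_positive[OF x(1)] k by (simp add: positive_scaleR)
  ultimately show ?thesis using pext_eq[of "k *\<^sub>R x" k] k x by (intro exI[of _ "k *\<^sub>R x"]) simp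
qed

lemma pext_scaleR:
  assumes a: "positive a" and r: "r \<ge> 0" shows "pext (r *\<^sub>R a) = r *\<^sub>R pext a"
proof (cases "r = 0")
  case True
  thus ?thesis by (simp add: pext_def zero)
next
  case False
  hence r: "r > 0" using r by simp
  obtain k where k: "k > 0" "a \<sqsubseteq> of_real k" using common_bound[OF a a] by blast
  have "r *\<^sub>R a \<sqsubseteq> of_real (r * k)"
    using cle_scaleR[OF k(2), of r] r by (simp add: scaleR_conv_of_real)
  thus ?thesis using pext_eq[OF a k] pext_eq[of "r *\<^sub>R a" "r * k"] k r a by (simp add: positive_scaleR)
qed

text \<open>\<open>affine_invertible\<close> needs an invertible effect that dominates the other
  summand. As \<open>b / k\<close> is bounded below by some \<open>d\<close>, dividing
  \<open>a\<close> by \<open>K = k / d\<close> brings it below \<open>b / k\<close>;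
  \<open>s\<close> and \<open>r\<close> are the convex weights that compensate for the two different
  scalings.\<close>

lemma pext_add_PINV:
  assumes b: "b \<in> PINV" and a: "positive a" shows "pext (b + a) = pext b + pext a"
proof -
  note pb = PINV_positive[OF b]
  obtain k where k: "k > 0" "b \<sqsubseteq> of_real k" "a \<sqsubseteq> of_real k" using common_bound[OF pb a] by blast
  define b1 where "b1 = (1/k) *\<^sub>R b"
  have b1: "b1 \<in> EFF" "b1 \<in> PINV" using scaled_EFF[OF pb k(1,2)] PINV_scaleR[OF b] k by (auto simp: b1_def)
  obtain d where d: "d > 0" "of_real d \<sqsubseteq> b1" using b1(2) PINV_iff by blast
  define K where "K = k / d"
  have K: "K > 0" "(1/K) * k = d" using k d by (auto simp: K_def)
  define a1 where "a1 = (1/K) *\<^sub>R a"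
  have "a1 \<sqsubseteq> (1/K) *\<^sub>R of_real k" unfolding a1_def using k K by (intro cle_scaleR) auto
  also have "(1/K) *\<^sub>R of_real k = (of_real d :: 'a)" using K by (simp add: of_real_def)
  finally have a1: "positive a1" "a1 \<sqsubseteq> b1" using a K d cle_trans by (auto simp: a1_def positive_scaleR)
  define s where "s = k / (k + K)"
  define r where "r = K / (k + K)"
  have sr: "0 \<le> s" "0 < r" "s + r \<le> 1" "(k + K) * s = k" "(k + K) * r = K" "s \<le> 1" "r \<le> 1"
    using k K by (auto simp: s_def r_def field_simps)
  have a1E: "a1 \<in> EFF" by (rule EFF_mono[OF a1 b1(1)])
  have c: "b + a = (k + K) *\<^sub>R (s *\<^sub>R b1 + r *\<^sub>R a1)"
    using k K by (simp add: scaleR_add_right sr b1_def a1_def)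
  have "s *\<^sub>R b1 + r *\<^sub>R a1 \<in> EFF"
  proof -
    have "s *\<^sub>R b1 + r *\<^sub>R a1 \<sqsubseteq> s *\<^sub>R b1 + r *\<^sub>R b1" using a1 sr by simp
    also have "\<dots> = (s + r) *\<^sub>R b1" by (simp add: scaleR_add_left)
    also have "\<dots> \<sqsubseteq> 1 *\<^sub>R b1" by (rule cle_scaleR_left[OF EFF_positive[OF b1(1)] sr(3)])
    finally show ?thesis using EFF_mono[OF _ _ b1(1)] sr a1 EFF_positive[OF b1(1)]
      by (simp add: positive_add positive_scaleR)
  qed
  hence "pext (b + a) = (k + K) *\<^sub>R \<Phi> (s *\<^sub>R b1 + r *\<^sub>R a1)"
    unfolding c using k K by (simp add: pext_scaleR EFF_positive pext_EFF)
  also have "\<dots> = k *\<^sub>R \<Phi> b1 + K *\<^sub>R \<Phi> a1"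
    by (simp add: affine_invertible[OF b1 a1 sr(1-3)] scaleR_add_right sr)
  also have "\<dots> = pext b + pext a"
    using pext_scaleR[OF a, of "1/K"] pext_scaleR[OF pb, of "1/k"] k K
    by (simp add: pext_EFF[OF b1(1), symmetric] pext_EFF[OF a1E, symmetric]) (simp add: a1_def b1_def)
  finally show ?thesis .
qed

text \<open>Adding 1 makes the first summand invertible; evaluating at \<open>1 + a + b\<close> in
  two ways removes it again.\<close>

lemma pext_add:
  assumes "positive a" "positive b" shows "pext (a + b) = pext a + pext b"
proof -
  have "pext (1 + (a + b)) = pext 1 + pext (a + b)"
    by (rule pext_add_PINV) (use assms positive_add in auto)
  moreover have "pext ((1 + a) + b) = pext (1 + a) + pext b"
    by (rule pext_add_PINV) (use assms one_plus_PINV in auto)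
  moreover have "pext (1 + a) = pext 1 + pext a" by (rule pext_add_PINV) (use assms in auto)
  ultimately show ?thesis by (simp add: add.assoc)
qed

lemma pext_of_real: "r \<ge> 0 \<Longrightarrow> pext (of_real r) = of_real r"
  using pext_scaleR[of 1 r] pext_EFF[of 1] one by (simp add: of_real_def)

definition sext :: "'a \<Rightarrow> 'b" where
  "sext x = pext (x + of_real (norm x)) - of_real (norm x)"

lemma sext_diff:
  assumes u: "positive u" and v: "positive v" shows "sext (u - v) = pext u - pext v"
proof -
  define x where "x = u - v"
  have sx: "selfadj x" unfolding x_def by (intro selfadj_diff positive_selfadj u v)
  have "pext ((x + of_real (norm x)) + v) = pext (x + of_real (norm x)) + pext v"
    by (rule pext_add[OF selfadj_positive_shift[OF sx] v])
  moreover have "(x + of_real (norm x)) + v = u + of_real (norm x)" by (simp add: x_def)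
  moreover have "pext (u + of_real (norm x)) = pext u + of_real (norm x)"
    using pext_add[OF u, of "of_real (norm x)"] by (simp add: pext_of_real)
  ultimately have "pext (x + of_real (norm x)) + pext v = pext u + of_real (norm x)" by simp
  thus ?thesis unfolding sext_def x_def[symmetric] by (simp add: algebra_simps)
qed

lemma sext_positive: "positive a \<Longrightarrow> sext a = pext a"
  using sext_diff[of a 0] pext_of_real[of 0] by simp

lemma sext_EFF: "a \<in> EFF \<Longrightarrow> sext a = \<Phi> a"
  by (simp add: sext_positive EFF_positive pext_EFF)

lemma sext_selfadj: "selfadj x \<Longrightarrow> selfadj (sext x)"
  unfolding sext_def by (rule selfadj_diff[OF positive_selfadj[OF pext_positive[OF selfadj_positive_shift]]]) auto

lemma sext_add:
  assumes "selfadj x" "selfadj y" shows "sext (x + y) = sext x + sext y"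
proof -
  obtain u v u' v' where uv: "positive u" "positive v" "x = u - v" "positive u'" "positive v'" "y = u' - v'"
    using selfadj_diff_positive assms by metis
  have "x + y = (u + u') - (v + v')" using uv by simp
  hence "sext (x + y) = pext (u + u') - pext (v + v')" using uv by (simp only: sext_diff positive_add)
  thus ?thesis using uv by (simp add: pext_add sext_diff)
qed

lemma sext_minus:
  assumes "selfadj x" shows "sext (- x) = - sext x"
proof -
  obtain u v where "positive u" "positive v" "x = u - v" using selfadj_diff_positive assms by metis
  thus ?thesis by (simp add: sext_diff)
qed

lemma sext_scaleR:
  assumes "selfadj x" shows "sext (r *\<^sub>R x) = r *\<^sub>R sext x"
proof -
  have pos: "sext (r *\<^sub>R x) = r *\<^sub>R sext x" if "r \<ge> 0" "selfadj x" for r x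
  proof -
    obtain u v where "positive u" "positive v" "x = u - v" using selfadj_diff_positive \<open>selfadj x\<close> by metis
    thus ?thesis using that by (simp add: sext_diff scaleR_diff_right positive_scaleR pext_scaleR)
  qed
  show ?thesis
  proof (cases "r \<ge> 0")
    case True
    thus ?thesis using pos assms by blast
  next
    case False
    hence "sext ((- r) *\<^sub>R (- x)) = (- r) *\<^sub>R sext (- x)" using pos[of "- r" "- x"] selfadj_minus[OF assms] by simp
    thus ?thesis using sext_minus[OF assms] by simp
  qed
qed

lemma sext_diff_selfadj: "selfadj x \<Longrightarrow> selfadj y \<Longrightarrow> sext (x - y) = sext x - sext y"
  using sext_add[of x "- y"] sext_minus[of y] by (simp add: selfadj_minus)

lemma sext_positive_iff:
  assumes "selfadj x" shows "positive (sext x) \<longleftrightarrow> positive x"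
proof -
  obtain u v where "positive u" "positive v" "x = u - v" using selfadj_diff_positive assms by metis
  thus ?thesis using pext_cle_iff[of v u] by (simp add: sext_diff cle_def)
qed

lemma sext_cle_iff: "selfadj x \<Longrightarrow> selfadj y \<Longrightarrow> sext x \<sqsubseteq> sext y \<longleftrightarrow> x \<sqsubseteq> y"
  using sext_positive_iff[of "y - x"] by (simp add: cle_def sext_diff_selfadj selfadj_diff)

lemma sext_inj: "selfadj x \<Longrightarrow> selfadj y \<Longrightarrow> sext x = sext y \<Longrightarrow> x = y"
  using sext_cle_iff[of x y] sext_cle_iff[of y x] cle_antisym by auto

lemma sext_surj:
  assumes "selfadj y" shows "\<exists>x. selfadj x \<and> sext x = y"
proof -
  obtain u v where uv: "positive u" "positive v" "y = u - v" using selfadj_diff_positive assms by metis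
  obtain a b where "positive a" "pext a = u" "positive b" "pext b = v" using pext_surj uv by metis
  thus ?thesis using uv(3) sext_diff[of a b] by (intro exI[of _ "a - b"]) (simp add: selfadj_diff positive_selfadj)
qed

lemma sext_of_real: "sext (of_real r) = of_real r"
  using sext_scaleR[of 1 r] sext_EFF[of 1] one by (simp add: of_real_def)

lemma sext_1: "sext 1 = 1"
  using sext_of_real[of 1] by simp

text \<open>Division by \<open>c\<close> leaves \<open>1 + a\<close> with an effect
  \<open>a\<close>, and \<open>cinv (1 + a) = (1 + hinv a) / 2\<close> reduces inversion to
  \<open>hinv_image\<close>.\<close>

lemma sext_cinv:
  assumes c: "c > 0" and x: "of_real c \<sqsubseteq> x" "x \<sqsubseteq> of_real (2 * c)"
  shows "sext (cinv x) = cinv (sext x)"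
proof -
  define a where "a = (1/c) *\<^sub>R x - 1"
  have sx: "selfadj x" using cle_selfadj[OF x(1)] by simp
  have "(1/c) *\<^sub>R of_real c \<sqsubseteq> (1/c) *\<^sub>R x" "(1/c) *\<^sub>R x \<sqsubseteq> (1/c) *\<^sub>R of_real (2 * c)"
    using x c by (simp_all del: of_real_mult)
  hence "1 \<sqsubseteq> (1/c) *\<^sub>R x" "(1/c) *\<^sub>R x \<sqsubseteq> 2 *\<^sub>R 1" using c by (simp_all add: of_real_def)
  hence a: "a \<in> EFF" by (simp_all add: EFF_iff a_def cle_def scaleR_2 algebra_simps)
  have xa: "x = c *\<^sub>R (1 + a)" using c by (simp add: a_def)
  note P = PINV_invertible[OF one_plus_PINV[OF EFF_positive[OF a]]]
  note PB = PINV_invertible[OF one_plus_PINV[OF EFF_positive[OF in_EFF[OF a]]]]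
  have sel: "selfadj a" "selfadj (hinv a)" using a hinv_EFF[OF a] EFF_positive positive_selfadj by blast+
  have ci: "cinv (1 + a) = (1/2) *\<^sub>R (1 + hinv a)" by (simp add: hinv_def)
  have "sext (cinv (1 + a)) = (1/2) *\<^sub>R (1 + \<Phi> (hinv a))"
    unfolding ci using sel by (simp add: sext_scaleR sext_add sext_EFF hinv_EFF[OF a] sext_1 selfadj_add)
  also have "\<dots> = cinv (1 + \<Phi> a)" by (simp add: hinv_image[OF a]) (simp add: hinv_def)
  finally have 1: "sext (cinv (1 + a)) = cinv (1 + \<Phi> a)" .
  have "sext (cinv x) = inverse c *\<^sub>R cinv (1 + \<Phi> a)"
    unfolding xa using c 1 P sel selfadj_cinv[OF selfadj_add[OF selfadj_1 sel(1)] P]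
    by (simp add: invertible_scaleR sext_scaleR)
  moreover have "sext x = c *\<^sub>R (1 + \<Phi> a)"
    unfolding xa using sel by (simp add: sext_scaleR sext_add sext_EFF a sext_1 selfadj_add)
  ultimately show ?thesis using invertible_scaleR(2)[OF PB, of c] c by simp
qed

text \<open>Additivity and preservation of inverses carry \<open>cinv_one_pm\<close> from
  \<open>a\<close> to \<open>sext a\<close>, and comparison isolates the square. The bound 1/3 puts
  \<open>1 + a\<close>, \<open>1 - a\<close> and \<open>1 - a * a\<close> between 2/3 and 4/3, a
  range from \<open>c\<close> to \<open>2 c\<close> as \<open>sext_cinv\<close> demands.\<close>

lemma sext_square_small:
  assumes sa: "selfadj a" and na: "norm a \<le> 1/3"
  shows "sext (a * a) = sext a * sext a"
proof -
  define b where "b = sext a"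
  have up: "a \<sqsubseteq> of_real (1/3)" and lo: "- of_real (1/3) \<sqsubseteq> a" using cle_norm[OF sa na] cle_norm'[OF sa na] by auto
  have saa: "selfadj (a * a)" by (rule selfadj_mult_commuting[OF sa sa refl])
  have naa: "norm (a * a) \<le> 1/3" using norm_selfadj_square[OF sa] na power_mono[OF na, of 2] by (simp add: power2_eq_square)
  have bd: "of_real (2/3) \<sqsubseteq> 1 + y \<and> 1 + y \<sqsubseteq> of_real (2 * (2/3))" if y: "selfadj y" "norm y \<le> 1/3" for y :: 'a
  proof -
    have "1 + - of_real (1/3) \<sqsubseteq> 1 + y" "1 + y \<sqsubseteq> 1 + of_real (1/3)"
      unfolding cle_add_cancel using cle_norm[OF y] cle_norm'[OF y] by blast+
    moreover have "1 + - of_real (1/3) = (of_real (2/3) :: 'a)" "1 + of_real (1/3) = (of_real (2 * (2/3)) :: 'a)"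
      using of_real_diff[of 1 "1/3", where 'a='a, symmetric] of_real_add[of 1 "1/3", where 'a='a, symmetric]
      by (simp_all del: of_real_divide of_real_diff of_real_add of_real_mult)
    ultimately show ?thesis by simp
  qed
  have inv: "sext (cinv (1 + y)) = cinv (1 + sext y) \<and> 1 + y \<in> PINV \<and> 1 + sext y \<in> PINV"
    if y: "selfadj y" "norm y \<le> 1/3" for y
  proof -
    have s: "sext (1 + y) = 1 + sext y" using y by (simp add: sext_add sext_1)
    have "sext (of_real (2/3)) \<sqsubseteq> sext (1 + y)"
      using bd[OF y] sext_cle_iff[of "of_real (2/3)" "1 + y"] y by (simp add: selfadj_add del: of_real_divide)
    hence "of_real (2/3) \<sqsubseteq> 1 + sext y" unfolding s sext_of_real .
    moreover have "(0::real) < 2/3" by simp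
    ultimately have "1 + sext y \<in> PINV" "1 + y \<in> PINV" using PINV_iff bd[OF y] by blast+
    thus ?thesis using sext_cinv[of "2/3" "1 + y"] bd[OF y] s by simp
  qed
  have sm: "selfadj (- a)" "norm (- a) \<le> 1/3" "selfadj (- (a * a))" "norm (- (a * a)) \<le> 1/3"
    using sa na saa naa by (simp_all add: selfadj_minus)
  note i1 = inv[OF sa na] and i2 = inv[OF sm(1,2)] and i3 = inv[OF sm(3,4)]
  have sc: "selfadj (cinv (1 + a))" "selfadj (cinv (1 + - a))" "selfadj (cinv (1 + - (a * a)))"
    using i1 i2 i3 PINV_cinv PINV_selfadj by blast+
  have mb: "sext (- a) = - b" using sext_minus[OF sa] by (simp add: b_def)
  have "cinv (1 + b) + cinv (1 + - b) = sext (cinv (1 + a) + cinv (1 + - a))"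
    using i1 i2 mb sext_add[OF sc(1,2)] by (simp add: b_def)
  also have "\<dots> = 2 *\<^sub>R sext (cinv (1 + - (a * a)))"
    using cinv_one_pm[of a] i1 i2 PINV_invertible sext_scaleR[OF sc(3)] by metis
  also have "\<dots> = 2 *\<^sub>R cinv (1 + - sext (a * a))" using i3 sext_minus[OF saa] by simp
  finally have e1: "cinv (1 + b) + cinv (1 + - b) = 2 *\<^sub>R cinv (1 + - sext (a * a))" .
  have ib: "invertible_el (1 + b)" "invertible_el (1 + - b)"
    using i1 i2 mb PINV_invertible by (auto simp: b_def)
  have "cinv (1 + - (b * b)) = cinv (1 + - sext (a * a))" using e1 cinv_one_pm[OF ib] by simp
  moreover have "invertible_el (1 + - (b * b))"
  proof -
    have "(1 + - b) * (1 + b) = 1 + - (b * b)" by (simp add: algebra_simps)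
    thus ?thesis using invertible_mult(1)[OF ib(2,1)] by simp
  qed
  moreover have "invertible_el (1 + - sext (a * a))" using i3 sext_minus[OF saa] PINV_invertible by metis
  ultimately have "1 + - (b * b) = 1 + - sext (a * a)" by (metis cinv_cinv)
  thus ?thesis by (simp add: b_def)
qed

lemma sext_square:
  assumes sa: "selfadj a" shows "sext (a * a) = sext a * sext a"
proof -
  define r where "r = 1 / (3 * (norm a + 1))"
  have r: "r > 0" by (simp add: r_def add_nonneg_pos)
  have "norm (r *\<^sub>R a) = norm a / (norm a + 1) / 3" using r by (simp add: r_def)
  also have "\<dots> \<le> 1/3" by (simp add: divide_le_eq_1 add_nonneg_pos)
  finally have "sext ((r *\<^sub>R a) * (r *\<^sub>R a)) = sext (r *\<^sub>R a) * sext (r *\<^sub>R a)"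
    by (intro sext_square_small selfadj_scaleR sa)
  hence "(r * r) *\<^sub>R sext (a * a) = (r * r) *\<^sub>R (sext a * sext a)"
    using sext_scaleR[OF selfadj_mult_commuting[OF sa sa refl], of "r * r"] sext_scaleR[OF sa] by simp
  thus ?thesis using r by simp
qed

lemma sext_jordan:
  assumes a: "selfadj a" and b: "selfadj b"
  shows "sext (a * b + b * a) = sext a * sext b + sext b * sext a"
proof -
  have s: "selfadj (a * b + b * a)" using a b by (simp add: selfadj_def adj_simps add.commute)
  have saa: "selfadj (a * a)" "selfadj (b * b)" using selfadj_mult_commuting a b by blast+
  have "(a + b) * (a + b) = (a * a + b * b) + (a * b + b * a)" by (simp add: algebra_simps)
  hence "sext a * sext a + sext b * sext b + sext (a * b + b * a) = (sext a + sext b) * (sext a + sext b)"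
    using sext_square[OF selfadj_add[OF a b]] sext_add[OF selfadj_add[OF saa] s] sext_add[OF saa] sext_add[OF a b]
      sext_square[OF a] sext_square[OF b] by simp
  thus ?thesis by (simp add: algebra_simps)
qed

definition jext :: "'a \<Rightarrow> 'b" where
  "jext x = sext (re_part x) + cscale \<i> (sext (im_part x))"

lemma jext_eq: "selfadj h \<Longrightarrow> selfadj k \<Longrightarrow> jext (h + cscale \<i> k) = sext h + cscale \<i> (sext k)"
  by (simp add: jext_def re_im_parts_eq)

lemma jext_selfadj: "selfadj h \<Longrightarrow> jext h = sext h"
  using jext_eq[of h 0] sext_of_real[of 0] by (simp add: cscale_zero_right)

lemma jordan_star_iso_jext: "jordan_star_iso jext"
  unfolding jordan_star_iso_def
proof (intro conjI allI)
  show "bij jext"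
  proof (rule bijI)
    show "inj jext"
    proof (rule injI)
      fix x y assume "jext x = jext y"
      hence "re_part (jext x) = re_part (jext y)" "im_part (jext x) = im_part (jext y)" by simp_all
      hence "sext (re_part x) = sext (re_part y)" "sext (im_part x) = sext (im_part y)"
        by (simp_all add: jext_def re_im_parts_eq sext_selfadj re_im_parts(1,2))
      hence "re_part x = re_part y" "im_part x = im_part y" using sext_inj re_im_parts(1,2) by blast+
      thus "x = y" using re_im_parts(3)[of x] re_im_parts(3)[of y] by metis
    qed
    show "surj jext"
      unfolding surj_def
    proof
      fix y :: 'b
      obtain h k where hk: "selfadj h" "sext h = re_part y" "selfadj k" "sext k = im_part y"
        using sext_surj re_im_parts(1,2) by metis
      show "\<exists>x. y = jext x"
        by (rule exI[of _ "h + cscale \<i> k"]) (use hk re_im_parts(3)[of y] in \<open>simp add: jext_eq\<close>)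
    qed
  qed
next
  fix x y :: 'a
  obtain h k h' k' where hk: "selfadj h" "selfadj k" "x = h + cscale \<i> k" "selfadj h'" "selfadj k'" "y = h' + cscale \<i> k'"
    using selfadj_decomposition by metis
  have "x + y = (h + h') + cscale \<i> (k + k')" using hk by (simp add: cscale_add_right algebra_simps)
  hence "jext (x + y) = sext (h + h') + cscale \<i> (sext (k + k'))" using hk by (simp only: jext_eq selfadj_add)
  thus "jext (x + y) = jext x + jext y" using hk by (simp add: jext_eq sext_add cscale_add_right algebra_simps)
  have "x * y + y * x = ((h * h' + h' * h) - (k * k' + k' * k)) + cscale \<i> ((h * k' + k' * h) + (k * h' + h' * k))"
    using hk by (simp add: distrib_left distrib_right mult_cscale_left mult_cscale_right cscale_add_right cscale_ii_ii)
  moreover have s: "selfadj (h * h' + h' * h)" "selfadj (k * k' + k' * k)" "selfadj (h * k' + k' * h)" "selfadj (k * h' + h' * k)"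
    using hk by (auto simp: selfadj_def adj_simps add.commute)
  ultimately have "jext (x * y + y * x) = sext ((h * h' + h' * h) - (k * k' + k' * k)) + cscale \<i> (sext ((h * k' + k' * h) + (k * h' + h' * k)))"
    by (simp only: jext_eq selfadj_add selfadj_diff)
  also have "\<dots> = (sext h * sext h' + sext h' * sext h) - (sext k * sext k' + sext k' * sext k)
     + cscale \<i> ((sext h * sext k' + sext k' * sext h) + (sext k * sext h' + sext h' * sext k))"
    using s hk by (simp only: sext_diff_selfadj sext_add sext_jordan)
  also have "\<dots> = jext x * jext y + jext y * jext x"
    using hk by (simp add: jext_eq distrib_left distrib_right mult_cscale_left mult_cscale_right cscale_add_right cscale_ii_ii)
  finally show "jext (x * y + y * x) = jext x * jext y + jext y * jext x" .
next
  fix x :: 'a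
  obtain h k where hk: "selfadj h" "selfadj k" "x = h + cscale \<i> k" using selfadj_decomposition by metis
  have "adj x = h + cscale \<i> (- k)" using hk by (simp add: adj_simps selfadj_def cscale_minus_left cscale_minus_right)
  hence "jext (adj x) = sext h + cscale \<i> (- sext k)" using hk by (simp add: jext_eq selfadj_minus sext_minus)
  also have "\<dots> = adj (jext x)"
    using hk sext_selfadj[OF hk(1)] sext_selfadj[OF hk(2)]
    by (simp add: jext_eq adj_simps selfadj_def cscale_minus_left cscale_minus_right)
  finally show "jext (adj x) = adj (jext x)" .
  fix c :: complex
  have "jext (cscale c x) = sext (Re c *\<^sub>R h - Im c *\<^sub>R k) + cscale \<i> (sext (Im c *\<^sub>R h + Re c *\<^sub>R k))"
    unfolding hk(3) cscale_complex by (rule jext_eq) (intro selfadj_intros hk)+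
  also have "\<dots> = (Re c *\<^sub>R sext h - Im c *\<^sub>R sext k) + cscale \<i> (Im c *\<^sub>R sext h + Re c *\<^sub>R sext k)"
    using hk by (simp add: sext_diff_selfadj sext_add sext_scaleR selfadj_scaleR)
  also have "\<dots> = cscale c (jext x)" using hk by (simp add: jext_eq cscale_complex)
  finally show "jext (cscale c x) = cscale c (jext x)" .
qed

lemma jext_EFF: "a \<in> EFF \<Longrightarrow> jext a = \<Phi> a"
  using jext_selfadj sext_EFF EFF_positive positive_selfadj by metis

end

lemma jordan_star_iso_simps:
  fixes J :: "'a::cstar_algebra \<Rightarrow> 'b::cstar_algebra"
  assumes J: "jordan_star_iso J"
  shows "J (x + y) = J x + J y" "J (r *\<^sub>R x) = r *\<^sub>R J x" "J (x - y) = J x - J y" "J 0 = 0" "J 1 = 1"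
    "J (of_real r) = of_real r" "J (cscale c x) = cscale c (J x)" "selfadj x \<Longrightarrow> selfadj (J x)"
proof -
  show add: "J (x + y) = J x + J y" for x y using J by (simp add: jordan_star_iso_def)
  show cs: "J (cscale c x) = cscale c (J x)" for c x using J by (simp add: jordan_star_iso_def)
  show scaleR: "J (r *\<^sub>R x) = r *\<^sub>R J x" for r x unfolding scaleR_cscale by (rule cs)
  show "J (x - y) = J x - J y" using add[of "x - y" y] by (simp add: algebra_simps)
  show "J 0 = 0" using scaleR[of 0 0] by simp
  show "selfadj x \<Longrightarrow> selfadj (J x)" using J by (simp add: jordan_star_iso_def selfadj_def) metis
  obtain e where "J e = 1" using J unfolding jordan_star_iso_def by (metis bij_pointE)
  moreover have "J (e * 1 + 1 * e) = J e * J 1 + J 1 * J e" using J unfolding jordan_star_iso_def by blast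
  ultimately have "2 *\<^sub>R J 1 = 2 *\<^sub>R 1" using add[of e e] by (simp add: scaleR_2 del: one_add_one)
  thus one: "J 1 = 1" by simp
  show "J (of_real r) = of_real r" using scaleR[of r 1] one by (simp add: of_real_def)
qed

lemma jordan_star_iso_unique:
  fixes J J' :: "'a::cstar_algebra \<Rightarrow> 'b::cstar_algebra"
  assumes J: "jordan_star_iso J" "jordan_star_iso J'" and eq: "\<And>a. a \<in> EFF \<Longrightarrow> J a = J' a"
  shows "J = J'"
proof
  fix x :: 'a
  have pos: "J a = J' a" if "positive a" for a
  proof -
    have n: "0 < norm a + 1" by (simp add: add_nonneg_pos)
    have an: "a \<sqsubseteq> of_real (norm a + 1)" by (rule cle_norm[OF positive_selfadj[OF that]]) simp
    have "(1 / (norm a + 1)) *\<^sub>R J a = (1 / (norm a + 1)) *\<^sub>R J' a"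
      using eq[OF scaled_EFF[OF that n an]] unfolding jordan_star_iso_simps(2)[OF J(1)] jordan_star_iso_simps(2)[OF J(2)] .
    thus ?thesis using n by (metis less_irrefl scaleR_left_imp_eq zero_less_divide_1_iff)
  qed
  have sa: "J h = J' h" if "selfadj h" for h
  proof -
    from pos[OF selfadj_positive_shift[OF that]] show ?thesis by (simp add: jordan_star_iso_simps[OF J(1)] jordan_star_iso_simps[OF J(2)])
  qed
  obtain h k where "selfadj h" "selfadj k" "x = h + cscale \<i> k" using selfadj_decomposition by metis
  thus "J x = J' x" using sa by (simp add: jordan_star_iso_simps[OF J(1)] jordan_star_iso_simps[OF J(2)])
qed

lemma eff_iso_jordan: "eff_iso \<Phi> \<Longrightarrow> \<exists>J. jordan_star_iso J \<and> (\<forall>a\<in>EFF. J a = \<Phi> a)"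
  using eff_iso.jordan_star_iso_jext eff_iso.jext_EFF by blast

section \<open>Order isomorphisms of the cone and of its translates\<close>

lemma POS_iff: "a \<in> POS \<longleftrightarrow> positive a"
  by (simp add: POS_def)

lemma selfadj_right_inverse:
  fixes x y :: "'a::cstar_algebra"
  assumes "selfadj x" "selfadj y" "x * y = 1" shows "cinv x = y" "invertible_el x"
proof -
  have "y * x = 1" using arg_cong[OF assms(3), of adj] assms(1,2) by (simp only: adj_mult selfadj_def adj_one)
  thus "cinv x = y" "invertible_el x" using cinv_eq[OF assms(3)] by auto
qed

lemma ival_cinv_iff:
  fixes a b :: "'a::cstar_algebra"
  assumes "a \<in> PINV" "b \<in> PINV"
  shows "x \<in> ival (cinv b) (cinv a) \<longleftrightarrow> x \<in> PINV \<and> cinv x \<in> ival a b"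
proof (cases "x \<in> PINV")
  case True
  thus ?thesis using cinv_cle_iff[OF assms(1) PINV_cinv[OF True]] cinv_cle_iff[OF PINV_cinv[OF True] assms(2)]
    by (auto simp: ival_def cinv_cinv PINV_invertible)
next
  case False
  thus ?thesis using PINV_mono[OF PINV_cinv[OF assms(2)]] by (auto simp: ival_def)
qed

lemma order_iso_on_inverse:
  fixes f :: "'a::cstar_algebra \<Rightarrow> 'b::cstar_algebra"
  assumes f: "order_iso_on f (ival a b) (ival a' b')" and P: "a \<in> PINV" "a' \<in> PINV" "a \<sqsubseteq> b" "a' \<sqsubseteq> b'"
  shows "order_iso_on (\<lambda>x. cinv (f (cinv x))) (ival (cinv b) (cinv a)) (ival (cinv b') (cinv a'))"
proof -
  have P': "b \<in> PINV" "b' \<in> PINV" using P PINV_mono by blast+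
  note A = ival_cinv_iff[OF P(1) P'(1)] and B = ival_cinv_iff[OF P(2) P'(2)]
  have ivP: "x \<in> PINV" if "x \<in> ival a b" for x using that PINV_mono[OF P(1)] by (simp add: ival_def)
  have ivP': "x \<in> PINV" if "x \<in> ival a' b'" for x using that PINV_mono[OF P(2)] by (simp add: ival_def)
  show ?thesis
  proof (rule order_iso_onI)
    fix x assume "x \<in> ival (cinv b) (cinv a)"
    hence "f (cinv x) \<in> ival a' b'" using A order_iso_onD(1)[OF f] by blast
    thus "cinv (f (cinv x)) \<in> ival (cinv b') (cinv a')"
      using B ivP' by (simp add: PINV_cinv cinv_cinv PINV_invertible)
  next
    fix y assume y: "y \<in> ival (cinv b') (cinv a')"
    then obtain z where z: "z \<in> ival a b" "f z = cinv y" using B order_iso_onD(2)[OF f] by blast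
    have "cinv (f (cinv (cinv z))) = y" using z y B ivP by (simp add: cinv_cinv PINV_invertible)
    moreover have "cinv z \<in> ival (cinv b) (cinv a)" using z A ivP by (simp add: PINV_cinv cinv_cinv PINV_invertible)
    ultimately show "\<exists>x\<in>ival (cinv b) (cinv a). cinv (f (cinv x)) = y" by blast
  next
    fix x y assume "x \<in> ival (cinv b) (cinv a)" "y \<in> ival (cinv b) (cinv a)"
    hence xy: "x \<in> PINV" "y \<in> PINV" "cinv x \<in> ival a b" "cinv y \<in> ival a b" using A by auto
    have "cinv (f (cinv x)) \<sqsubseteq> cinv (f (cinv y)) \<longleftrightarrow> f (cinv y) \<sqsubseteq> f (cinv x)"
      using xy by (intro cinv_cle_iff ivP' order_iso_onD(1)[OF f])
    also have "\<dots> \<longleftrightarrow> cinv y \<sqsubseteq> cinv x" using order_iso_onD(3)[OF f] xy by blast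
    also have "\<dots> \<longleftrightarrow> x \<sqsubseteq> y" using cinv_cle_iff xy by blast
    finally show "x \<sqsubseteq> y \<longleftrightarrow> cinv (f (cinv x)) \<sqsubseteq> cinv (f (cinv y))" by simp
  qed
qed

section \<open>Order isomorphisms of the full cone: midpoints and linearity\<close>

locale pos_iso =
  fixes \<Phi> :: "'a::cstar_algebra \<Rightarrow> 'b::cstar_algebra"
  assumes AWA: "AW_star TYPE('a)" and AWB: "AW_star TYPE('b)"
    and noI1: "\<not> has_type_I1_summand TYPE('a)"
    and iso: "order_iso_on \<Phi> POS POS"
begin

lemma positive_image: "positive a \<Longrightarrow> positive (\<Phi> a)"
  using order_iso_onD(1)[OF iso] by (simp add: POS_iff)

lemma le_iff: "positive a \<Longrightarrow> positive b \<Longrightarrow> \<Phi> a \<sqsubseteq> \<Phi> b \<longleftrightarrow> a \<sqsubseteq> b"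
  using order_iso_onD(3)[OF iso] by (simp add: POS_iff)

lemma zero: "\<Phi> 0 = 0"
proof -
  obtain a where a: "positive a" "\<Phi> a = 0" using order_iso_onD(2)[OF iso, of 0] by (auto simp: POS_iff)
  have "\<Phi> 0 \<sqsubseteq> 0" using le_iff[of 0 a] a by (simp add: cle_0_iff)
  thus ?thesis using positive_image[of 0] by (intro cle_antisym) (simp_all add: cle_0_iff)
qed

lemma cofinal:
  assumes "0 \<le> K" shows "\<exists>n. \<forall>m\<ge>n. of_real K \<sqsubseteq> \<Phi> (of_real m)"
proof -
  obtain x where x: "positive x" "\<Phi> x = of_real K"
    using order_iso_onD(2)[OF iso, of "of_real K"] assms by (auto simp: POS_iff)
  have "of_real K \<sqsubseteq> \<Phi> (of_real m)" if "m \<ge> norm x" for m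
  proof -
    have "x \<sqsubseteq> of_real m" by (rule cle_norm[OF positive_selfadj[OF x(1)] that])
    moreover have "0 \<le> m" using that norm_ge_zero[of x] by linarith
    ultimately show ?thesis using le_iff[of x "of_real m"] x by simp
  qed
  thus ?thesis by blast
qed

lemma restrict_ival: "0 \<le> n \<Longrightarrow> order_iso_on \<Phi> (ival 0 (of_real n)) (ival 0 (\<Phi> (of_real n)))"
  using order_iso_on_restrict[OF iso, of 0 "of_real n"] zero by (simp add: POS_iff ival_def cle_0_iff subset_iff)

text \<open>The map \<open>u \<mapsto> (\<Phi> (u\<^sup>-\<^sup>1 - s) + S)\<^sup>-\<^sup>1\<close> preserves midpoints if \<open>s\<close> and \<open>S\<close> are chosen so that the midpoint
  corresponds to \<open>N \<mapsto> c\<close>; this is possible as soon as \<open>b = \<Phi> n\<close> is large compared to \<open>c\<close>. Hence it is affine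
  on scalars.\<close>

lemma harmonic_interpolation:
  assumes N: "0 < N" and n: "4 * N \<le> n"
    and c: "c = \<Phi> (of_real N)" "c \<in> PINV" and b: "b = \<Phi> (of_real n)" "4 *\<^sub>R c \<sqsubseteq> b"
    and \<tau>: "\<tau> = (2 * n - N) / (3 * n - 2 * N)"
    and S: "S = cinv (cinv c - 2 *\<^sub>R cinv b)"
  shows "cinv c - 2 *\<^sub>R cinv b \<in> PINV" "S \<in> PINV" "S \<sqsubseteq> 2 *\<^sub>R c"
    and "cinv (\<Phi> (of_real (N / 2)) + S) = (1 - \<tau>) *\<^sub>R cinv (b + S) + \<tau> *\<^sub>R (cinv c - 2 *\<^sub>R cinv b)"
proof -
  define b' c' \<sigma> where "b' = cinv b" and "c' = cinv c" and "\<sigma> = cinv c - 2 *\<^sub>R cinv b"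
  have c4P: "4 *\<^sub>R c \<in> PINV" using PINV_scaleR[OF c(2)] by simp
  have bP: "b \<in> PINV" by (rule PINV_mono[OF c4P b(2)])
  note ci = PINV_invertible[OF c(2)] and bi = PINV_invertible[OF bP]
  have bb: "b * b' = 1" "b' * b = 1" and cc: "c * c' = 1" "c' * c = 1"
    using cinv[OF bi] cinv[OF ci] by (simp_all add: b'_def c'_def)
  have c'P: "c' \<in> PINV" and b'P: "b' \<in> PINV" using PINV_cinv c(2) bP by (auto simp: c'_def b'_def)
  have "b' \<sqsubseteq> (1/4) *\<^sub>R c'"
    using cinv_antimono[OF c4P b(2)] invertible_scaleR(2)[OF ci, of 4] by (simp add: b'_def c'_def)
  from cle_scaleR[OF this, of 2] have "2 *\<^sub>R b' \<sqsubseteq> (1/2) *\<^sub>R c'" by simp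
  hence half\<sigma>: "(1/2) *\<^sub>R c' \<sqsubseteq> \<sigma>"
  proof -
    have eq: "c' - (1/2) *\<^sub>R c' = (1/2) *\<^sub>R c'" using scaleR_left_diff_distrib[of 1 "1/2" c'] by simp
    have "c' - (1/2) *\<^sub>R c' \<sqsubseteq> c' - 2 *\<^sub>R b'" unfolding cle_add_cancel by fact
    thus ?thesis unfolding eq by (simp only: \<sigma>_def b'_def c'_def)
  qed
  have hc'P: "(1/2) *\<^sub>R c' \<in> PINV" using PINV_scaleR[OF c'P] by simp
  show \<sigma>P: "cinv c - 2 *\<^sub>R cinv b \<in> PINV" using PINV_mono[OF hc'P half\<sigma>] by (simp add: \<sigma>_def)
  hence \<sigma>P: "\<sigma> \<in> PINV" by (simp add: \<sigma>_def)
  have S\<sigma>: "S = cinv \<sigma>" by (simp add: S \<sigma>_def)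
  show SP: "S \<in> PINV" unfolding S\<sigma> by (rule PINV_cinv[OF \<sigma>P])
  have SS: "S * \<sigma> = 1" "\<sigma> * S = 1" using cinv[OF PINV_invertible[OF \<sigma>P]] by (simp_all add: S\<sigma>)
  have ciS: "cinv S = \<sigma>" unfolding S\<sigma> by (rule cinv_cinv[OF PINV_invertible[OF \<sigma>P]])
  show "S \<sqsubseteq> 2 *\<^sub>R c"
    using cinv_antimono[OF hc'P half\<sigma>] invertible_scaleR(2)[OF PINV_invertible[OF c'P], of "1/2"] cinv_cinv[OF ci]
    by (simp add: S\<sigma> c'_def)
  have bSP: "b + S \<in> PINV" by (rule PINV_add[OF bP PINV_positive[OF SP]])
  define U where "U = cinv (b + S)"
  have UP: "U \<in> PINV" unfolding U_def by (rule PINV_cinv[OF bSP])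
  have bSU: "(b + S) * U = 1" "U * (b + S) = 1" using cinv[OF PINV_invertible[OF bSP]] by (simp_all add: U_def)
  have c\<sigma>: "c * \<sigma> = 1 - 2 *\<^sub>R (c * b')" using cc by (simp add: \<sigma>_def b'_def c'_def right_diff_distrib)
  \<comment> \<open>\<open>c + S\<close> has to be the harmonic mean of \<open>S\<close> and
    \<open>b + S\<close>. Solving this for commuting elements gives
    \<open>1 / S = 1 / c - 2 / b\<close>; the identity \<open>(c + S) U = 2 c b'\<close> verifies
    that the formula stays right without commutation.\<close>
  have mid: "(c + S) * ((1/2) *\<^sub>R (U + \<sigma>)) = 1"
  proof -
    have "(c + S) * \<sigma> = 2 *\<^sub>R 1 - 2 *\<^sub>R (c * b')" using c\<sigma> SS by (simp add: distrib_right scaleR_2 del: one_add_one)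
    moreover have "(c + S) * U = 2 *\<^sub>R (c * b')"
    proof -
      have "S = c * \<sigma> * S + 2 *\<^sub>R (c * b') * S" unfolding c\<sigma> by (simp add: algebra_simps)
      also have "c * \<sigma> * S = c" using SS by (simp add: mult.assoc)
      finally have S1: "S = c + 2 *\<^sub>R (c * b') * S" .
      have "c + S = c + (c + 2 *\<^sub>R (c * b') * S)" using S1 by simp
      also have "\<dots> = 2 *\<^sub>R (c * b' * (b + S))" using bb by (simp add: distrib_left distrib_right scaleR_add_right scaleR_2 mult.assoc)
      finally have "(c + S) * U = 2 *\<^sub>R (c * b' * ((b + S) * U))" by (simp add: mult.assoc)
      thus ?thesis using bSU by simp
    qed
    ultimately show ?thesis by (simp add: distrib_left scaleR_diff_right)
  qed
  have cSP: "c + S \<in> PINV" by (rule PINV_add[OF c(2) PINV_positive[OF SP]])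
  have midinv: "cinv (c + S) = (1/2) *\<^sub>R (U + \<sigma>)"
    by (rule selfadj_right_inverse(1)[OF PINV_selfadj[OF cSP] _ mid])
       (intro selfadj_scaleR selfadj_add PINV_selfadj UP \<sigma>P)
  have Ule: "U \<sqsubseteq> \<sigma>" unfolding U_def ciS[symmetric]
    by (rule cinv_antimono[OF SP]) (use PINV_positive[OF bP] in \<open>simp add: cle_def\<close>)
  define D where "D = \<sigma> - U"
  have "positive D" using Ule by (simp add: D_def cle_def)
  \<comment> \<open>As a product of invertible factors, \<open>D\<close> is invertible, so the
    interval from \<open>U\<close> to \<open>\<sigma>\<close> can be normalised to the
    effects.\<close>
  moreover have "D = \<sigma> * b * U"
  proof -
    have "\<sigma> * b * U = \<sigma> * ((b + S) * U) - (\<sigma> * S) * U" by (simp add: algebra_simps)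
    thus ?thesis using bSU SS by (simp add: D_def)
  qed
  hence "invertible_el D" using invertible_mult(1) PINV_invertible \<sigma>P bP UP by metis
  ultimately have DP: "D \<in> PINV" by (simp add: PINV_def)
  define k where "k = cinv (psqrt D)"
  have kP: "k \<in> PINV" unfolding k_def by (intro PINV_cinv PINV_psqrt DP)
  have kDk: "k * D * k = 1" using cinv_psqrt_conj(1)[OF DP] by (simp add: k_def)
  \<comment> \<open>The scalar counterpart \<open>1 / s = 1 / N - 2 / n\<close> of \<open>S\<close>:
    it makes \<open>N + s\<close> the harmonic mean of \<open>s\<close> and
    \<open>n + s\<close>.\<close>
  define s where "s = N * n / (n - 2 * N)"
  have s: "s > 0" "n > 0" using N n by (simp_all add: s_def)
  define u0 u1 where "u0 = 1 / (n + s)" and "u1 = 1 / s"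
  have u: "0 < u0" "u0 < u1" using s by (simp_all add: u0_def u1_def frac_less2)
  have sN: "s * (n - 2 * N) = N * n" using N n by (simp add: s_def)
  have umid: "1 / ((u0 + u1) / 2) = N + s"
  proof -
    have "2 * (s * (n + s)) = (N + s) * (n + 2 * s)" using sN by (simp add: algebra_simps)
    thus ?thesis using s by (simp add: u0_def u1_def field_simps)
  qed
  \<comment> \<open>\<open>\<tau>\<close> is the parameter at which the point between
    \<open>u0\<close> and \<open>u1\<close> is the inverse of \<open>N / 2 + s\<close>.\<close>
  have u\<tau>: "1 / (u0 + (u1 - u0) * \<tau>) = N / 2 + s"
  proof -
    have nz: "3 * n - 2 * N > 0" "n - 2 * N > 0" using N n by linarith+
    have "\<tau> = s * (n - N / 2) / (n * (N / 2 + s))"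
    proof -
      define p q where "p = n - 2 * N" and "q = 3 * n - 2 * N"
      have pq: "p > 0" "q > 0" using nz by (auto simp: p_def q_def)
      have "N / 2 + s = N * q / (2 * p)"
        using nz by (simp add: s_def p_def q_def field_simps)
      moreover have "s = N * n / p" by (simp add: s_def p_def)
      moreover have "(N * n / p) * (n - N / 2) / (n * (N * q / (2 * p))) = 2 * (n - N / 2) / q"
        using pq N s(2) by simp
      ultimately show ?thesis by (simp add: \<tau> q_def right_diff_distrib)
    qed
    moreover have "u1 - u0 = n / (s * (n + s))" using s by (simp add: u0_def u1_def field_simps)
    ultimately have "u0 + (u1 - u0) * \<tau> = 1 / (n + s) + (n - N / 2) / ((n + s) * (N / 2 + s))"
      using s N by (simp add: u0_def)
    also have "\<dots> = 1 / (N / 2 + s)" using s N by (simp add: divide_simps)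
    finally show ?thesis by simp
  qed
  have \<tau>01: "0 \<le> \<tau>" "\<tau> \<le> 1" using N n by (simp_all add: \<tau> divide_le_eq)
  define f where "f x = S + 1 *\<^sub>R \<Phi> (of_real (- s) + 1 *\<^sub>R x)" for x
  have f1: "order_iso_on (\<lambda>x. of_real (- s) + 1 *\<^sub>R x) (ival (of_real s) (of_real (n + s))) (ival 0 (of_real n :: 'a))"
    using order_iso_on_affine[of 1 "of_real (- s) :: 'a" "of_real s" "of_real (n + s)"] by simp
  have f2: "order_iso_on (\<lambda>x. S + 1 *\<^sub>R x) (ival 0 b) (ival S (b + S))"
    using order_iso_on_affine[of 1 S 0 b] by (simp add: add.commute)
  have "order_iso_on f (ival (of_real s) (of_real (n + s))) (ival S (b + S))"
    unfolding f_def using order_iso_on_comp[OF order_iso_on_comp[OF f1 restrict_ival] f2[unfolded b(1)]] s b(1) by simp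
  hence "order_iso_on (\<lambda>x. cinv (f (cinv x))) (ival (cinv (of_real (n + s))) (cinv (of_real s))) (ival (cinv (b + S)) (cinv S))"
    by (rule order_iso_on_inverse) (use s SP PINV_of_real[of s] PINV_positive[OF bP] in \<open>auto simp: cle_def\<close>)
  hence g: "order_iso_on (\<lambda>x. cinv (f (cinv x))) (ival (of_real u0) (of_real u1)) (ival U \<sigma>)"
    using s by (simp add: invertible_of_real ciS U_def u0_def u1_def inverse_eq_divide del: of_real_add of_real_divide)
  have h1: "order_iso_on (\<lambda>x. of_real u0 + (u1 - u0) *\<^sub>R x) EFF (ival (of_real u0) (of_real u1 :: 'a))"
    using order_iso_on_affine[of "u1 - u0" "of_real u0 :: 'a" 0 1] u
    by (simp add: EFF_ival of_real_def flip: scaleR_left.add)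
  have h2: "order_iso_on (\<lambda>x. - U + 1 *\<^sub>R x) (ival U \<sigma>) (ival 0 D)"
    using order_iso_on_affine[of 1 "- U" U \<sigma>] by (simp add: D_def)
  have h3: "order_iso_on (\<lambda>x. k * x * k) (ival 0 D) EFF"
    using order_iso_on_conj[OF kP, of 0 D] kDk by (simp add: EFF_ival)
  \<comment> \<open>After shifting, inverting and normalising on both sides, the choice of
    \<open>s\<close> and \<open>S\<close> makes 1/2 a fixed point, hence every scalar of the unit
    interval, in particular \<open>\<tau>\<close>.\<close>
  define \<Theta> where "\<Theta> x = k * (- U + 1 *\<^sub>R cinv (f (cinv (of_real u0 + (u1 - u0) *\<^sub>R x)))) * k" for x
  have "order_iso_on \<Theta> EFF EFF"
    unfolding \<Theta>_def by (rule order_iso_on_comp[OF order_iso_on_comp[OF order_iso_on_comp[OF h1 g] h2] h3])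
  have val: "f (cinv (of_real u0 + (u1 - u0) *\<^sub>R of_real t)) = S + \<Phi> (of_real (1 / (u0 + (u1 - u0) * t) - s))"
    if "0 \<le> t" for t
  proof -
    have "u0 + (u1 - u0) * t \<noteq> 0" using u that by (metis add_pos_nonneg diff_gt_0_iff_gt less_irrefl less_imp_le mult_nonneg_nonneg)
    hence "cinv (of_real (u0 + (u1 - u0) * t)) = (of_real (1 / (u0 + (u1 - u0) * t)) :: 'a)"
      using invertible_of_real(2)[where 'a='a] by (simp only: inverse_eq_divide)
    moreover have "of_real u0 + (u1 - u0) *\<^sub>R of_real t = (of_real (u0 + (u1 - u0) * t) :: 'a)"
      by (simp add: scaleR_conv_of_real)
    ultimately have "cinv (of_real u0 + (u1 - u0) *\<^sub>R of_real t) = (of_real (1 / (u0 + (u1 - u0) * t)) :: 'a)"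
      by simp
    thus ?thesis by (simp only: f_def scaleR_one of_real_minus) (simp add: algebra_simps del: of_real_divide)
  qed
  have "\<Theta> (of_real (1/2)) = of_real (1/2)"
  proof -
    have "u0 + (u1 - u0) * (1/2) = (u0 + u1) / 2" by (simp add: field_simps)
    hence e: "1 / (u0 + (u1 - u0) * (1/2)) - s = N" using umid by (metis add_diff_cancel_right')
    have h: "(0::real) \<le> 1/2" by simp
    have "f (cinv (of_real u0 + (u1 - u0) *\<^sub>R of_real (1/2))) = c + S"
      using val[OF h] unfolding e by (simp only: c(1) add.commute)
    hence "\<Theta> (of_real (1/2)) = k * (- U + (1/2) *\<^sub>R (U + \<sigma>)) * k" unfolding \<Theta>_def by (simp add: midinv)
    also have "- U + (1/2) *\<^sub>R (U + \<sigma>) = (1/2) *\<^sub>R D"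
    proof -
      have "(1/2) *\<^sub>R U + (1/2) *\<^sub>R U = U" by (simp flip: scaleR_left.add)
      thus ?thesis by (simp add: D_def scaleR_add_right scaleR_diff_right) (metis add_diff_cancel_left' add.commute add_uminus_conv_diff diff_add_eq minus_diff_eq)
    qed
    finally show ?thesis using kDk by (simp add: of_real_def)
  qed
  hence E: "eff_iso \<Theta>" using \<open>order_iso_on \<Theta> EFF EFF\<close> by (intro eff_iso.intro AWA AWB noI1)
  have "\<Theta> (of_real \<tau>) = of_real \<tau>" by (rule eff_iso.of_real_image[OF E \<tau>01])
  moreover have "f (cinv (of_real u0 + (u1 - u0) *\<^sub>R of_real \<tau>)) = \<Phi> (of_real (N / 2)) + S"
    using val[OF \<tau>01(1)] unfolding u\<tau> by (simp add: add.commute del: of_real_divide)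
  ultimately have "k * (- U + cinv (\<Phi> (of_real (N / 2)) + S)) * k = k * (\<tau> *\<^sub>R D) * k"
    using kDk by (simp add: \<Theta>_def of_real_def del: of_real_divide)
  hence "- U + cinv (\<Phi> (of_real (N / 2)) + S) = \<tau> *\<^sub>R D" using conj_cinv(2)[OF kP] by metis
  hence "cinv (\<Phi> (of_real (N / 2)) + S) = U + \<tau> *\<^sub>R D" by (simp add: algebra_simps)
  thus "cinv (\<Phi> (of_real (N / 2)) + S) = (1 - \<tau>) *\<^sub>R cinv (b + S) + \<tau> *\<^sub>R (cinv c - 2 *\<^sub>R cinv b)"
    by (simp add: D_def U_def \<sigma>_def algebra_simps)
qed

text \<open>Write \<open>c\<close> for \<open>\<Phi> (of_real N)\<close>. Formally, as
  \<open>n\<close> tends to infinity, \<open>cinv b\<close> and \<open>cinv (b + S)\<close> vanish,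
  \<open>S\<close> tends to \<open>c\<close> and \<open>\<tau>\<close> to 2/3, and the interpolation
  identity becomes \<open>cinv (X + c) = (2/3) cinv c\<close>, that is \<open>X = c / 2\<close>.
  Multiplying by \<open>X + S\<close> and estimating the defect \<open>E\<close> avoids the limit of
  \<open>S\<close>.\<close>

lemma half_image:
  assumes N: "0 < N" and c: "\<Phi> (of_real N) \<in> PINV"
  shows "\<Phi> (of_real (N / 2)) = (1/2) *\<^sub>R \<Phi> (of_real N)"
proof -
  define c' X where "c' = cinv (\<Phi> (of_real N))" and "X = \<Phi> (of_real (N / 2))"
  define C where "C = norm (\<Phi> (of_real N))"
  define E where "E = X * c' - (1/2) *\<^sub>R 1"
  note ci = PINV_invertible[OF c]
  have pX: "positive X" unfolding X_def using N by (intro positive_image) simp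
  have "of_real (N / 2) \<sqsubseteq> (of_real N :: 'a)" using N by (simp only: cle_of_real)
  hence "X \<sqsubseteq> \<Phi> (of_real N)" unfolding X_def using N le_iff[of "of_real (N / 2)" "of_real N"]
    by (simp del: of_real_divide)
  also have "\<Phi> (of_real N) \<sqsubseteq> of_real C" unfolding C_def by (rule cle_norm[OF PINV_selfadj[OF c]]) simp
  finally have nX: "norm X \<le> C" by (rule norm_le_of_cle[OF pX])
  have bound: "norm E \<le> 2 * ((5 * C + N) / K)" if K: "K > 0" "4 * C \<le> K" for K
  proof -
    obtain m where m: "\<And>n. n \<ge> m \<Longrightarrow> of_real K \<sqsubseteq> \<Phi> (of_real n)" using cofinal[of K] K by auto
    \<comment> \<open>\<open>m\<close> makes \<open>b\<close> at least \<open>K\<close>,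
      \<open>4 * N\<close> is required by \<open>harmonic_interpolation\<close>, and
      \<open>K\<close> controls the deviation of \<open>\<tau>\<close> from 2/3.\<close>
    define n where "n = Max {m, 4 * N, K}"
    have n: "n \<ge> m" "4 * N \<le> n" "K \<le> n" by (simp_all add: n_def)
    define b where "b = \<Phi> (of_real n)"
    have Kb: "of_real K \<sqsubseteq> b" unfolding b_def by (rule m[OF n(1)])
    have bP: "b \<in> PINV" using Kb K PINV_iff by blast
    have "4 *\<^sub>R \<Phi> (of_real N) \<sqsubseteq> 4 *\<^sub>R of_real C"
      unfolding C_def using cle_norm[OF PINV_selfadj[OF c] order_refl] by simp
    also have "4 *\<^sub>R of_real C = (of_real (4 * C) :: 'b)" by (simp only: scaleR_conv_of_real of_real_mult)
    also have "(of_real (4 * C) :: 'b) \<sqsubseteq> of_real K" using K by (simp only: cle_of_real)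
    also note Kb
    finally have b4: "4 *\<^sub>R \<Phi> (of_real N) \<sqsubseteq> b" .
    define \<tau> where "\<tau> = (2 * n - N) / (3 * n - 2 * N)"
    define b' \<sigma> where "b' = cinv b" and "\<sigma> = c' - 2 *\<^sub>R cinv b"
    define S where "S = cinv \<sigma>"
    note H = harmonic_interpolation[OF N n(2) refl c b_def b4 \<tau>_def, of S, folded c'_def, folded \<sigma>_def, OF S_def, folded X_def]
    define U where "U = cinv (b + S)"
    have small: "norm (cinv y) \<le> 1 / K" if "of_real K \<sqsubseteq> y" for y :: 'b
    proof (rule norm_le_of_cle)
      have yP: "y \<in> PINV" using that K PINV_iff by blast
      show "positive (cinv y)" by (rule PINV_positive[OF PINV_cinv[OF yP]])
      show "cinv y \<sqsubseteq> of_real (1 / K)"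
        using cinv_antimono[OF PINV_of_real that] K by (simp add: invertible_of_real inverse_eq_divide del: of_real_divide)
    qed
    have nb: "norm b' \<le> 1 / K" unfolding b'_def by (rule small[OF Kb])
    have "b \<sqsubseteq> b + S" using PINV_positive[OF H(2)] by (simp add: cle_def)
    hence nU: "norm U \<le> 1 / K" unfolding U_def using Kb cle_trans small by blast
    have nS: "norm S \<le> 2 * C"
    proof (rule norm_le_of_cle[OF PINV_positive[OF H(2)]])
      have "S \<sqsubseteq> 2 *\<^sub>R \<Phi> (of_real N)" by (rule H(3))
      also have "2 *\<^sub>R \<Phi> (of_real N) \<sqsubseteq> 2 *\<^sub>R of_real C"
        unfolding C_def using cle_norm[OF PINV_selfadj[OF c] order_refl] by simp
      also have "2 *\<^sub>R of_real C = (of_real (2 * C) :: 'b)" by (simp only: scaleR_conv_of_real of_real_mult)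
      finally show "S \<sqsubseteq> of_real (2 * C)" .
    qed
    have XSP: "X + S \<in> PINV" using PINV_add[OF H(2) pX] by (simp add: add.commute)
    have "(X + S) * ((1 - \<tau>) *\<^sub>R U + \<tau> *\<^sub>R \<sigma>) = 1"
      using cinv(1)[OF PINV_invertible[OF XSP]] H(4) by (simp add: U_def)
    moreover have "S * \<sigma> = 1" using cinv(2)[OF PINV_invertible[OF H(1)]] by (simp add: S_def)
    ultimately have eq1: "(1 - \<tau>) *\<^sub>R ((X + S) * U) + \<tau> *\<^sub>R (X * \<sigma> + 1) = 1"
      by (simp add: distrib_left distrib_right)
    have X\<sigma>: "X * \<sigma> = E + (1/2) *\<^sub>R 1 - 2 *\<^sub>R (X * b')" by (simp add: E_def \<sigma>_def b'_def right_diff_distrib)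
    \<comment> \<open>Each term on the right contains \<open>1 - 3 \<tau> / 2\<close>,
      \<open>U\<close> or \<open>b'\<close>, all of order \<open>1 / K\<close>; of \<open>S\<close>
      only boundedness is used.\<close>
    have eq2: "\<tau> *\<^sub>R E = (1 - \<tau> * (3/2)) *\<^sub>R 1 - (1 - \<tau>) *\<^sub>R ((X + S) * U) + (2 * \<tau>) *\<^sub>R (X * b')"
    proof -
      have "\<tau> *\<^sub>R (X * \<sigma> + 1) = \<tau> *\<^sub>R E + (\<tau> * (3/2)) *\<^sub>R 1 - (2 * \<tau>) *\<^sub>R (X * b')"
      proof -
        have "(1/2) *\<^sub>R 1 + 1 = (3/2) *\<^sub>R (1::'b)" using scaleR_left.add[of "1/2" 1 "1::'b"] by simp
        hence "X * \<sigma> + 1 = E + (3/2) *\<^sub>R 1 - 2 *\<^sub>R (X * b')" unfolding X\<sigma> by (simp add: algebra_simps)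
        thus ?thesis by (simp add: scaleR_add_right scaleR_diff_right mult.commute)
      qed
      moreover define W where "W = (1 - \<tau>) *\<^sub>R ((X + S) * U)"
      ultimately have "W + (\<tau> *\<^sub>R E + (\<tau> * (3/2)) *\<^sub>R 1 - (2 * \<tau>) *\<^sub>R (X * b')) = 1" using eq1 by simp
      hence "\<tau> *\<^sub>R E = 1 - (\<tau> * (3/2)) *\<^sub>R 1 - W + (2 * \<tau>) *\<^sub>R (X * b')"
        by (simp only: diff_eq_eq eq_diff_eq add.assoc add.commute add.left_commute add_diff_eq diff_add_eq)
      thus ?thesis by (simp only: W_def scaleR_left_diff_distrib scaleR_one)
    qed
    have nz: "3 * n - 2 * N > 0" using N n by linarith
    have \<tau>: "2/3 \<le> \<tau>" "\<tau> \<le> 1" using nz N n by (simp_all add: \<tau>_def field_simps)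
    have "\<tau> * (3/2) - 1 = N / (2 * (3 * n - 2 * N))" using nz by (simp add: \<tau>_def field_simps)
    moreover have "N / (2 * (3 * n - 2 * N)) \<le> N / K" using N n K by (intro divide_left_mono) auto
    moreover have "0 \<le> N / (2 * (3 * n - 2 * N))" using N nz by simp
    ultimately have t1: "\<bar>1 - \<tau> * (3/2)\<bar> \<le> N / K" by linarith
    have C0: "0 \<le> C" by (simp add: C_def)
    have nXS: "norm (X + S) \<le> 3 * C" using norm_triangle_ineq[of X S] nX nS by linarith
    have t2: "norm ((X + S) * U) \<le> 3 * C / K"
    proof -
      have "norm ((X + S) * U) \<le> norm (X + S) * norm U" by (rule norm_mult_ineq)
      also have "\<dots> \<le> (3 * C) * (1 / K)" using nXS nU C0 by (intro mult_mono) auto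
      finally show ?thesis by simp
    qed
    have t3: "norm (X * b') \<le> C / K"
    proof -
      have "norm (X * b') \<le> norm X * norm b'" by (rule norm_mult_ineq)
      also have "\<dots> \<le> C * (1 / K)" using nX nb C0 by (intro mult_mono) auto
      finally show ?thesis by simp
    qed
    have "\<tau> * norm E = norm (\<tau> *\<^sub>R E)" using \<tau> by simp
    also have "\<dots> \<le> norm ((1 - \<tau> * (3/2)) *\<^sub>R (1::'b)) + norm ((1 - \<tau>) *\<^sub>R ((X + S) * U)) + norm ((2 * \<tau>) *\<^sub>R (X * b'))"
      unfolding eq2 by (intro order_trans[OF norm_triangle_ineq] add_mono norm_triangle_ineq4 order_refl)
    also have "\<dots> = \<bar>1 - \<tau> * (3/2)\<bar> + (1 - \<tau>) * norm ((X + S) * U) + 2 * \<tau> * norm (X * b')" using \<tau> by simp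
    also have "\<dots> \<le> N / K + 1 * (3 * C / K) + 2 * 1 * (C / K)"
      using t1 t2 t3 \<tau> C0 K by (intro add_mono mult_mono) auto
    also have "\<dots> = (5 * C + N) / K" by (simp add: add_divide_distrib)
    finally have "\<tau> * norm E \<le> (5 * C + N) / K" .
    moreover have "(1/2) * norm E \<le> \<tau> * norm E" using \<tau> by (intro mult_right_mono) auto
    ultimately show ?thesis by linarith
  qed
  have "norm E \<le> 0 + e" if e: "e > 0" for e
  proof -
    have C0: "0 \<le> C" by (simp add: C_def)
    define K where "K = 4 * C + 2 * (5 * C + N) / e + 1"
    have q: "0 \<le> 2 * (5 * C + N) / e" using C0 N e by simp
    have K: "K > 0" "4 * C \<le> K" "2 * (5 * C + N) / e \<le> K" using C0 q by (auto simp: K_def)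
    have "2 * ((5 * C + N) / K) \<le> e" using K(1,3) e by (simp add: field_simps)
    thus ?thesis using bound[OF K(1,2)] by linarith
  qed
  hence "norm E \<le> 0" by (rule field_le_epsilon)
  hence "X * c' = (1/2) *\<^sub>R 1" by (simp add: E_def)
  hence "X * c' * \<Phi> (of_real N) = (1/2) *\<^sub>R \<Phi> (of_real N)" by simp
  thus ?thesis using cinv(2)[OF ci] by (simp add: mult.assoc c'_def X_def del: of_real_divide)
qed

end

context pos_iso
begin

text \<open>\<open>\<kappa>\<close> and \<open>r\<close> are separate because two normalisations
  occur: each \<open>N\<close> with its own root and \<open>r = 1\<close>, and a single
  \<open>\<kappa>\<close> for all large \<open>N\<close> with \<open>r = 1 / N\<close>.\<close>

lemma eff_iso_scaled:
  assumes N: "0 < N" "\<Phi> (of_real N) \<in> PINV" and \<kappa>: "\<kappa> \<in> PINV" and r: "0 < r" "r *\<^sub>R (\<kappa> * \<Phi> (of_real N) * \<kappa>) = 1"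
  shows "eff_iso (\<lambda>a. r *\<^sub>R (\<kappa> * \<Phi> (N *\<^sub>R a) * \<kappa>))"
proof (intro eff_iso.intro AWA AWB noI1)
  have i1: "order_iso_on (\<lambda>x. 0 + N *\<^sub>R x) EFF (ival 0 (of_real N :: 'a))"
    using order_iso_on_affine[OF N(1), of 0 0 "1::'a"] by (simp add: EFF_ival of_real_def)
  have i2: "order_iso_on \<Phi> (ival 0 (of_real N)) (ival 0 (\<Phi> (of_real N)))"
    using restrict_ival N by simp
  have i3: "order_iso_on (\<lambda>x. \<kappa> * x * \<kappa>) (ival 0 (\<Phi> (of_real N))) (ival 0 (\<kappa> * \<Phi> (of_real N) * \<kappa>))"
    using order_iso_on_conj[OF \<kappa>, of 0 "\<Phi> (of_real N)"] by simp
  have i4: "order_iso_on (\<lambda>x. 0 + r *\<^sub>R x) (ival 0 (\<kappa> * \<Phi> (of_real N) * \<kappa>)) EFF"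
    using order_iso_on_affine[OF r(1), of 0 0 "\<kappa> * \<Phi> (of_real N) * \<kappa>"] r(2) by (simp add: EFF_ival)
  show "order_iso_on (\<lambda>a. r *\<^sub>R (\<kappa> * \<Phi> (N *\<^sub>R a) * \<kappa>)) EFF EFF"
    using order_iso_on_comp[OF order_iso_on_comp[OF order_iso_on_comp[OF i1 i2] i3] i4] by simp
  have "N *\<^sub>R of_real (1/2) = (of_real (N / 2) :: 'a)" by (simp add: of_real_def)
  hence "\<Phi> (N *\<^sub>R of_real (1/2)) = (1/2) *\<^sub>R \<Phi> (of_real N)" using half_image[OF N] by simp
  thus "r *\<^sub>R (\<kappa> * \<Phi> (N *\<^sub>R of_real (1/2)) * \<kappa>) = of_real (1/2)"
    using arg_cong[OF r(2), of "\<lambda>x. (1/2) *\<^sub>R x"] by (simp add: of_real_def mult.commute)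
qed

text \<open>Normalising up to \<open>N\<close> and evaluating at \<open>N0 / N\<close> shows that
  \<open>\<Phi>\<close> is linear on large scalars with slope \<open>c\<close>. One conjugation by
  the root of \<open>c\<close> thus normalises all large intervals at once, and the Jordan
  isomorphisms found on them coincide, since effects determine them.\<close>

lemma jordan_form: "\<exists>b\<in>PINV. \<exists>J. jordan_star_iso J \<and> (\<forall>a. positive a \<longrightarrow> \<Phi> a = b * J a * b)"
proof -
  obtain m where m: "\<And>n. n \<ge> m \<Longrightarrow> of_real 1 \<sqsubseteq> \<Phi> (of_real n)" using cofinal[of 1] by auto
  define N0 where "N0 = max m 1"
  have N0: "0 < N0" "N0 \<ge> m" by (auto simp: N0_def)
  have PN: "\<Phi> (of_real N) \<in> PINV" if "N \<ge> N0" for N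
    using m[of N] N0 that PINV_mono[of 1 "\<Phi> (of_real N)"] by simp
  define c b where "c = (1 / N0) *\<^sub>R \<Phi> (of_real N0)" and "b = psqrt c"
  have cP: "c \<in> PINV" unfolding c_def using PINV_scaleR[OF PN[OF order_refl], of "1 / N0"] N0 by simp
  have bP: "b \<in> PINV" unfolding b_def by (rule PINV_psqrt[OF cP])
  define \<kappa> where "\<kappa> = cinv b"
  have \<kappa>P: "\<kappa> \<in> PINV" unfolding \<kappa>_def by (rule PINV_cinv[OF bP])
  have \<kappa>c: "\<kappa> * c * \<kappa> = 1" unfolding \<kappa>_def b_def by (rule cinv_psqrt_conj(1)[OF cP])
  have lin: "\<Phi> (of_real N) = N *\<^sub>R c" if N: "N \<ge> N0" for N
  proof -
    define k where "k = cinv (psqrt (\<Phi> (of_real N)))"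
    have kP: "k \<in> PINV" unfolding k_def by (intro PINV_cinv PINV_psqrt PN N)
    have kk: "k * \<Phi> (of_real N) * k = 1" unfolding k_def by (rule cinv_psqrt_conj(1)[OF PN[OF N]])
    have Np: "N > 0" using N N0 by simp
    have "eff_iso (\<lambda>a. 1 *\<^sub>R (k * \<Phi> (N *\<^sub>R a) * k))"
      by (rule eff_iso_scaled[OF Np PN[OF N] kP]) (simp_all add: kk)
    from eff_iso.of_real_image[OF this, of "N0 / N"] have "k * \<Phi> (N *\<^sub>R of_real (N0 / N)) * k = of_real (N0 / N)"
      using N N0 by simp
    moreover have "N *\<^sub>R of_real (N0 / N) = (of_real N0 :: 'a)" using Np by (simp add: of_real_def)
    ultimately have "k * \<Phi> (of_real N0) * k = k * ((N0 / N) *\<^sub>R \<Phi> (of_real N)) * k"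
      using kk by (simp add: of_real_def)
    hence "\<Phi> (of_real N0) = (N0 / N) *\<^sub>R \<Phi> (of_real N)" using conj_cinv(2)[OF kP] by metis
    thus ?thesis using Np N0 by (simp add: c_def)
  qed
  have E: "\<exists>J. jordan_star_iso J \<and> (\<forall>a\<in>EFF. J a = (1/N) *\<^sub>R (\<kappa> * \<Phi> (N *\<^sub>R a) * \<kappa>))" if N: "N \<ge> N0" for N
  proof (rule eff_iso_jordan, rule eff_iso_scaled[OF _ PN[OF N] \<kappa>P])
    show "0 < N" "0 < 1 / N" using N N0 by simp_all
    show "(1 / N) *\<^sub>R (\<kappa> * \<Phi> (of_real N) * \<kappa>) = 1" using lin[OF N] \<kappa>c N N0 by simp
  qed
  obtain J where J: "jordan_star_iso J" "\<And>a. a \<in> EFF \<Longrightarrow> J a = (1/N0) *\<^sub>R (\<kappa> * \<Phi> (N0 *\<^sub>R a) * \<kappa>)"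
    using E[OF order_refl] by blast
  have "\<Phi> a = b * J a * b" if a: "positive a" for a
  proof -
    define N where "N = max N0 (norm a + 1)"
    have N: "N \<ge> N0" "0 < N" using N0 by (auto simp: N_def)
    have aN: "a \<sqsubseteq> of_real N" by (rule cle_norm[OF positive_selfadj[OF a]]) (simp add: N_def)
    obtain J' where J': "jordan_star_iso J'" "\<And>a. a \<in> EFF \<Longrightarrow> J' a = (1/N) *\<^sub>R (\<kappa> * \<Phi> (N *\<^sub>R a) * \<kappa>)"
      using E[OF N(1)] by blast
    have "J' = J"
    proof (rule jordan_star_iso_unique[OF J'(1) J(1)])
      fix x :: 'a assume x: "x \<in> EFF"
      have "(N0 / N) *\<^sub>R x \<in> EFF" using EFF_scaleR[OF x] N N0 by simp
      from J'(2)[OF this] have "(N0 / N) *\<^sub>R J' x = (1/N) *\<^sub>R (\<kappa> * \<Phi> (N0 *\<^sub>R x) * \<kappa>)"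
        using N by (simp add: jordan_star_iso_simps[OF J'(1)])
      also have "\<dots> = (N0 / N) *\<^sub>R J x" using J(2)[OF x] N0 by simp
      finally show "J' x = J x" using N N0 by simp
    qed
    hence "J ((1/N) *\<^sub>R a) = (1/N) *\<^sub>R (\<kappa> * \<Phi> a * \<kappa>)" using J'(2)[OF scaled_EFF[OF a N(2) aN]] N by simp
    hence "J a = \<kappa> * \<Phi> a * \<kappa>" using N by (simp add: jordan_star_iso_simps[OF J(1)])
    thus ?thesis using conj_cinv(1)[OF bP] by (simp add: \<kappa>_def)
  qed
  thus ?thesis using bP J(1) by blast
qed

end

section \<open>Translated cones and their directed unions\<close>

lemma order_iso_on_shift:
  fixes \<Phi> :: "'a::cstar_algebra \<Rightarrow> 'b::cstar_algebra"
  assumes iso: "order_iso_on \<Phi> S T" and s: "s \<in> S"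
    and up: "\<And>x y. x \<in> S \<Longrightarrow> x \<sqsubseteq> y \<Longrightarrow> y \<in> S" "\<And>x y. x \<in> T \<Longrightarrow> x \<sqsubseteq> y \<Longrightarrow> y \<in> T"
  shows "order_iso_on (\<lambda>a. \<Phi> (s + a) - \<Phi> s) POS POS"
proof (rule order_iso_onI)
  have sS: "s + a \<in> S" if "positive a" for a using up(1)[OF s, of "s + a"] that by (simp add: cle_def)
  note D = order_iso_onD[OF iso]
  fix a :: 'a assume "a \<in> POS"
  hence a: "positive a" by (simp add: POS_iff)
  have "\<Phi> s \<sqsubseteq> \<Phi> (s + a)" using D(3)[OF s sS[OF a]] a by (simp add: cle_def)
  thus "\<Phi> (s + a) - \<Phi> s \<in> POS" by (simp add: POS_iff cle_def)
  fix c :: 'a assume "c \<in> POS"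
  hence c: "positive c" by (simp add: POS_iff)
  show "a \<sqsubseteq> c \<longleftrightarrow> \<Phi> (s + a) - \<Phi> s \<sqsubseteq> \<Phi> (s + c) - \<Phi> s" using D(3)[OF sS[OF a] sS[OF c]] by simp
next
  note D = order_iso_onD[OF iso]
  fix y :: 'b assume "y \<in> POS"
  hence "\<Phi> s \<sqsubseteq> \<Phi> s + y" by (simp add: POS_iff cle_def)
  then obtain x where x: "x \<in> S" "\<Phi> x = \<Phi> s + y" using D(2)[OF up(2)[OF D(1)[OF s]]] by blast
  hence "s \<sqsubseteq> x" using D(3)[OF s x(1)] \<open>\<Phi> s \<sqsubseteq> \<Phi> s + y\<close> by simp
  hence "x - s \<in> POS" by (simp add: POS_iff cle_def)
  thus "\<exists>a\<in>POS. \<Phi> (s + a) - \<Phi> s = y" using x by (intro bexI[of _ "x - s"]) auto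
qed

text \<open>On every translated cone inside \<open>S\<close> the map is affine, and the linear parts agree because any two translated
  cones are contained in a third one.\<close>

lemma affine_on_directed:
  fixes \<Phi> :: "'a::cstar_algebra \<Rightarrow> 'b::cstar_algebra"
  assumes AW: "AW_star TYPE('a)" "AW_star TYPE('b)" "\<not> has_type_I1_summand TYPE('a)"
    and iso: "order_iso_on \<Phi> S T" and s0: "s0 \<in> S"
    and up: "\<And>x y. x \<in> S \<Longrightarrow> x \<sqsubseteq> y \<Longrightarrow> y \<in> S" "\<And>x y. x \<in> T \<Longrightarrow> x \<sqsubseteq> y \<Longrightarrow> y \<in> T"
    and dir: "\<And>x y. x \<in> S \<Longrightarrow> y \<in> S \<Longrightarrow> \<exists>s\<in>S. s \<sqsubseteq> x \<and> s \<sqsubseteq> y"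
  shows "\<exists>b\<in>PINV. \<exists>J c. jordan_star_iso J \<and> (\<forall>x\<in>S. \<Phi> x = b * J x * b + c)"
proof -
  have form: "\<exists>b\<in>PINV. \<exists>J. jordan_star_iso J \<and> (\<forall>a. positive a \<longrightarrow> \<Phi> (s + a) - \<Phi> s = b * J a * b)" if "s \<in> S" for s
    using pos_iso.jordan_form[OF pos_iso.intro[OF AW order_iso_on_shift[OF iso that up]]] .
  obtain b J where b: "b \<in> PINV" and J: "jordan_star_iso J"
    and bJ: "\<And>a. positive a \<Longrightarrow> \<Phi> (s0 + a) - \<Phi> s0 = b * J a * b"
    using form[OF s0] by blast
  have lin: "\<Phi> (s + a) - \<Phi> s = b * J a * b" if s: "s \<in> S" "s \<sqsubseteq> s0" and a: "positive a" for s a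
  proof -
    obtain b' J' where J': "jordan_star_iso J'"
      and bJ': "\<And>a. positive a \<Longrightarrow> \<Phi> (s + a) - \<Phi> s = b' * J' a * b'"
      using form[OF s(1)] by blast
    \<comment> \<open>The cone at \<open>s\<close> contains the cone at \<open>s0\<close>.
      Additivity of \<open>J'\<close> removes the base point, so the linear parts agree on positive
      elements without comparing \<open>b'\<close> to \<open>b\<close> or \<open>J'\<close> to
      \<open>J\<close>.\<close>
    have d: "positive (s0 - s)" using s by (simp add: cle_def)
    have "\<Phi> (s + (s0 - s + a)) - \<Phi> s = b' * J' (s0 - s + a) * b'" by (rule bJ'[OF positive_add[OF d a]])
    hence "\<Phi> (s0 + a) - \<Phi> s = b' * J' (s0 - s + a) * b'" by (simp add: algebra_simps)
    also have "\<dots> = b' * J' (s0 - s) * b' + b' * J' a * b'"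
      by (simp only: jordan_star_iso_simps(1)[OF J'] distrib_left distrib_right)
    also have "b' * J' (s0 - s) * b' = \<Phi> s0 - \<Phi> s" using bJ'[OF d] by simp
    finally have "\<Phi> (s0 + a) - \<Phi> s0 = b' * J' a * b'" by (simp add: algebra_simps)
    thus ?thesis using bJ[OF a] bJ'[OF a] by simp
  qed
  have "\<Phi> x = b * J x * b + (\<Phi> s0 - b * J s0 * b)" if x: "x \<in> S" for x
  proof -
    obtain s where s: "s \<in> S" "s \<sqsubseteq> x" "s \<sqsubseteq> s0" using dir[OF x s0] by blast
    have "\<Phi> x - \<Phi> s = b * J (x - s) * b" "\<Phi> s0 - \<Phi> s = b * J (s0 - s) * b"
      using lin[OF s(1,3), of "x - s"] lin[OF s(1,3), of "s0 - s"] s by (simp_all add: cle_def)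
    hence "\<Phi> x - \<Phi> s0 = b * J (x - s) * b - b * J (s0 - s) * b" by (metis diff_diff_eq2 diff_add_cancel)
    also have "\<dots> = b * J x * b - b * J s0 * b"
      by (simp add: jordan_star_iso_simps(3)[OF J] left_diff_distrib right_diff_distrib)
    finally show ?thesis by (simp add: algebra_simps)
  qed
  thus ?thesis using b J by blast
qed

lemma SA_upclosed: "x \<in> SA \<Longrightarrow> x \<sqsubseteq> y \<Longrightarrow> y \<in> SA" for x :: "'a::cstar_algebra"
  using cle_selfadj by (simp add: SA_def)

lemma SA_directed:
  fixes x y :: "'a::cstar_algebra"
  assumes "x \<in> SA" "y \<in> SA" shows "\<exists>s\<in>SA. s \<sqsubseteq> x \<and> s \<sqsubseteq> y"
proof (intro bexI conjI)
  define r where "r = max (norm x) (norm y)"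
  show "- of_real r \<sqsubseteq> x" "- of_real r \<sqsubseteq> y" using assms by (auto simp: SA_def r_def intro!: cle_norm')
  show "- of_real r \<in> SA" by (simp add: SA_def selfadj_minus)
qed

lemma PINV_directed:
  fixes x y :: "'a::cstar_algebra"
  assumes "x \<in> PINV" "y \<in> PINV" shows "\<exists>s\<in>PINV. s \<sqsubseteq> x \<and> s \<sqsubseteq> y"
proof -
  obtain d e where de: "d > 0" "of_real d \<sqsubseteq> x" "e > 0" "of_real e \<sqsubseteq> y" using assms PINV_iff by blast
  have "of_real (min d e) \<sqsubseteq> (of_real d :: 'a)" "of_real (min d e) \<sqsubseteq> (of_real e :: 'a)" by simp_all
  hence "of_real (min d e) \<sqsubseteq> x" "of_real (min d e) \<sqsubseteq> y" using de cle_trans by blast+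
  thus ?thesis using PINV_of_real[of "min d e", where 'a='a] de by auto
qed

text \<open>The constant vanishes because both cones have infimum 0. On a scalar \<open>e\<close>
  the value is \<open>e * (b * b) + c\<close>; its positivity for small \<open>e\<close> bounds
  \<open>c\<close> from below, and the attainment of arbitrarily small scalars bounds it from
  above.\<close>

lemma order_iso_PINV:
  fixes \<Phi> :: "'a::cstar_algebra \<Rightarrow> 'b::cstar_algebra"
  assumes AW: "AW_star TYPE('a)" "AW_star TYPE('b)" "\<not> has_type_I1_summand TYPE('a)"
    and iso: "order_iso_on \<Phi> PINV PINV"
  shows "\<exists>b\<in>PINV. \<exists>J. jordan_star_iso J \<and> (\<forall>a\<in>PINV. \<Phi> a = b * J a * b)"
proof -
  have "\<exists>b\<in>PINV. \<exists>J c. jordan_star_iso J \<and> (\<forall>x\<in>PINV. \<Phi> x = b * J x * b + c)"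
    by (rule affine_on_directed[OF AW iso PINV_1]) (erule (1) PINV_mono PINV_directed)+
  then obtain b J c where b: "b \<in> PINV" and J: "jordan_star_iso J"
    and \<Phi>: "\<And>x. x \<in> PINV \<Longrightarrow> \<Phi> x = b * J x * b + c" by blast
  note D = order_iso_onD[OF iso]
  have val: "\<Phi> (of_real e) = e *\<^sub>R (b * b) + c" if "e > 0" for e
    using \<Phi>[OF PINV_of_real[OF that]] by (simp add: jordan_star_iso_simps[OF J] of_real_def)
  have bb: "positive (b * b)" by (rule positive_square[OF PINV_selfadj[OF b]])
  have lower: "- (e *\<^sub>R (b * b)) \<sqsubseteq> c" if "e > 0" for e
    using PINV_positive[OF D(1)[OF PINV_of_real[OF that]]] val[OF that] by (simp add: cle_def add.commute)
  have "c = 0"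
  proof (rule eq_0_of_cle_small)
    fix d :: real assume d: "d > 0"
    obtain x where x: "x \<in> PINV" "\<Phi> x = of_real d" using D(2)[OF PINV_of_real[OF d]] by blast
    obtain e where e: "e > 0" "of_real e \<sqsubseteq> x" using x PINV_iff by blast
    have "\<Phi> (of_real e) \<sqsubseteq> of_real d" using D(3)[OF PINV_of_real[OF e(1)] x(1)] e(2) x(2) by simp
    moreover have "c \<sqsubseteq> \<Phi> (of_real e)" unfolding val[OF e(1)] using bb e by (simp add: cle_def positive_scaleR)
    ultimately have "c \<sqsubseteq> of_real d" using cle_trans by blast
    moreover have "- of_real d \<sqsubseteq> c"
    proof -
      define e' where "e' = d / (norm (b * b) + 1)"
      have n: "norm (b * b) + 1 > 0" by (simp add: add_nonneg_pos)
      have e': "e' > 0" "e' * (norm (b * b) + 1) = d" using d n by (auto simp: e'_def)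
      have "e' *\<^sub>R (b * b) \<sqsubseteq> e' *\<^sub>R of_real (norm (b * b) + 1)"
        using cle_norm[OF positive_selfadj[OF bb], of "norm (b * b) + 1"] e' by simp
      also have "\<dots> = of_real d" using e'(2) by (simp only: scaleR_conv_of_real of_real_mult[symmetric])
      finally have "- of_real d \<sqsubseteq> - (e' *\<^sub>R (b * b))" by simp
      thus ?thesis using lower[OF e'(1)] cle_trans by blast
    qed
    ultimately show "- of_real d \<sqsubseteq> c \<and> c \<sqsubseteq> of_real d" by blast
  qed
  thus ?thesis using b J \<Phi> by auto
qed

text \<open>Such a map would be affine on all of \<open>SA\<close>, hence unbounded below along the
  negative scalars, although its values are positive.\<close>

lemma no_order_iso_SA_PINV:
  assumes AW: "AW_star TYPE('a::cstar_algebra)" "AW_star TYPE('b::cstar_algebra)" "\<not> has_type_I1_summand TYPE('a)"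
  shows "\<not> (\<exists>\<Phi> :: 'a \<Rightarrow> 'b. order_iso_on \<Phi> SA PINV)"
proof
  assume "\<exists>\<Phi> :: 'a \<Rightarrow> 'b. order_iso_on \<Phi> SA PINV"
  then obtain \<Phi> :: "'a \<Rightarrow> 'b" where iso: "order_iso_on \<Phi> SA PINV" by blast
  have z: "0 \<in> (SA :: 'a set)" by (simp add: SA_def)
  have "\<exists>b\<in>PINV. \<exists>J c. jordan_star_iso J \<and> (\<forall>x\<in>SA. \<Phi> x = b * J x * b + c)"
    by (rule affine_on_directed[OF AW iso z]) (erule (1) SA_upclosed PINV_mono SA_directed)+
  then obtain b J c where b: "b \<in> PINV" and J: "jordan_star_iso J"
    and \<Phi>: "\<And>x. x \<in> SA \<Longrightarrow> \<Phi> x = b * J x * b + c" by blast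
  have "b * 1 * b \<in> PINV" by (rule PINV_conj[OF PINV_1 b])
  then obtain d where d: "d > 0" "of_real d \<sqsubseteq> b * b" using PINV_iff by auto
  have "\<Phi> 0 = c" using \<Phi>[OF z] by (simp add: jordan_star_iso_simps[OF J])
  hence c: "selfadj c" using PINV_selfadj[OF order_iso_onD(1)[OF iso z]] by simp
  \<comment> \<open>With \<open>b * b\<close> at least \<open>d\<close>, this makes
    \<open>t * (b * b)\<close> at least \<open>norm c + 1\<close>, too large to lie below
    \<open>c\<close>.\<close>
  define t where "t = (norm c + 1) / d"
  have t: "t > 0" using d by (simp add: t_def add_nonneg_pos)
  have "of_real (- t) \<in> (SA :: 'a set)" by (simp only: SA_def mem_Collect_eq selfadj_of_real)
  from PINV_positive[OF order_iso_onD(1)[OF iso this]] \<Phi>[OF this]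
  have "positive (b * of_real (- t) * b + c)" by (simp only: jordan_star_iso_simps[OF J])
  hence "t *\<^sub>R (b * b) \<sqsubseteq> c" by (simp add: cle_def of_real_def)
  moreover have "t *\<^sub>R of_real d \<sqsubseteq> t *\<^sub>R (b * b)" using d t by simp
  moreover have "t *\<^sub>R of_real d = (of_real (norm c + 1) :: 'b)"
    using d by (simp only: scaleR_conv_of_real of_real_mult[symmetric]) (simp add: t_def)
  moreover have "c \<sqsubseteq> of_real (norm c)" by (rule cle_norm[OF c order_refl])
  ultimately have "of_real (norm c + 1) \<sqsubseteq> (of_real (norm c) :: 'b)" using cle_trans by metis
  thus False by (simp only: cle_of_real)
qed

theorem theorem3p1:
  assumes "AW_star TYPE('a::cstar_algebra)"
      and "AW_star TYPE('b::cstar_algebra)"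
      and "\<not> has_type_I1_summand TYPE('a)"
  shows
   "(\<forall>\<Phi> :: 'a \<Rightarrow> 'b. order_iso_on \<Phi> EFF EFF \<and> \<Phi> (cscale (1/2) 1) = cscale (1/2) 1 \<longrightarrow>
        (\<exists>!J. jordan_star_iso J \<and> (\<forall>a\<in>EFF. J a = \<Phi> a)))
  \<and> (\<forall>\<Phi> :: 'a \<Rightarrow> 'b. order_iso_on \<Phi> POS POS \<longrightarrow>
        (\<exists>b\<in>PINV. \<exists>J. jordan_star_iso J \<and> (\<forall>a\<in>POS. \<Phi> a = b * J a * b)))
  \<and> (\<forall>\<Phi> :: 'a \<Rightarrow> 'b. order_iso_on \<Phi> PINV PINV \<longrightarrow>
        (\<exists>b\<in>PINV. \<exists>J. jordan_star_iso J \<and> (\<forall>a\<in>PINV. \<Phi> a = b * J a * b)))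
  \<and> (\<forall>\<Phi> :: 'a \<Rightarrow> 'b. order_iso_on \<Phi> SA SA \<longrightarrow>
        (\<exists>b\<in>PINV. \<exists>c\<in>SA. \<exists>J. jordan_star_iso J \<and> (\<forall>a\<in>SA. \<Phi> a = b * J a * b + c)))
  \<and> \<not> (\<exists>\<Phi> :: 'a \<Rightarrow> 'b. order_iso_on \<Phi> SA PINV)"
proof (intro conjI allI impI)
  fix \<Phi> :: "'a \<Rightarrow> 'b"
  assume \<Phi>: "order_iso_on \<Phi> EFF EFF \<and> \<Phi> (cscale (1/2) 1) = cscale (1/2) 1"
  have "\<Phi> (of_real (1/2)) = of_real (1/2)"
    using \<Phi> cscale_real_one[of "1/2", where 'a='a] cscale_real_one[of "1/2", where 'a='b] by simp
  hence "eff_iso \<Phi>" using \<Phi> by (intro eff_iso.intro assms) auto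
  then obtain J where J: "jordan_star_iso J" "\<And>a. a \<in> EFF \<Longrightarrow> J a = \<Phi> a" using eff_iso_jordan by blast
  show "\<exists>!J. jordan_star_iso J \<and> (\<forall>a\<in>EFF. J a = \<Phi> a)"
  proof (rule ex1I)
    show "jordan_star_iso J \<and> (\<forall>a\<in>EFF. J a = \<Phi> a)" using J by blast
  next
    fix J' assume "jordan_star_iso J' \<and> (\<forall>a\<in>EFF. J' a = \<Phi> a)"
    thus "J' = J" using J by (intro jordan_star_iso_unique) auto
  qed
next
  fix \<Phi> :: "'a \<Rightarrow> 'b" assume "order_iso_on \<Phi> POS POS"
  from pos_iso.jordan_form[OF pos_iso.intro[OF assms this]]
  show "\<exists>b\<in>PINV. \<exists>J. jordan_star_iso J \<and> (\<forall>a\<in>POS. \<Phi> a = b * J a * b)"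
    using POS_iff by blast
next
  fix \<Phi> :: "'a \<Rightarrow> 'b" assume "order_iso_on \<Phi> PINV PINV"
  thus "\<exists>b\<in>PINV. \<exists>J. jordan_star_iso J \<and> (\<forall>a\<in>PINV. \<Phi> a = b * J a * b)"
    by (rule order_iso_PINV[OF assms])
next
  fix \<Phi> :: "'a \<Rightarrow> 'b" assume iso: "order_iso_on \<Phi> SA SA"
  have z: "0 \<in> (SA :: 'a set)" by (simp add: SA_def)
  have "\<exists>b\<in>PINV. \<exists>J c. jordan_star_iso J \<and> (\<forall>x\<in>SA. \<Phi> x = b * J x * b + c)"
    by (rule affine_on_directed[OF assms iso z]) (erule (1) SA_upclosed SA_directed)+
  then obtain b J c where b: "b \<in> PINV" and J: "jordan_star_iso J"
    and \<Phi>: "\<And>x. x \<in> SA \<Longrightarrow> \<Phi> x = b * J x * b + c" by blast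
  have "c = \<Phi> 0" using \<Phi>[OF z] by (simp add: jordan_star_iso_simps[OF J])
  hence "c \<in> SA" using order_iso_onD(1)[OF iso z] by simp
  thus "\<exists>b\<in>PINV. \<exists>c\<in>SA. \<exists>J. jordan_star_iso J \<and> (\<forall>a\<in>SA. \<Phi> a = b * J a * b + c)"
    using b J \<Phi> by blast
next
  show "\<not> (\<exists>\<Phi> :: 'a \<Rightarrow> 'b. order_iso_on \<Phi> SA PINV)" by (rule no_order_iso_SA_PINV[OF assms])
qed

end
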